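(* Let $(K,v_0)$ be a valued field, $x$ transcendental over $K$, $\mathcal V$ the set of all extensions of $v_0$ to $K(x)$ and $\mathcal A$ the set of all non-trivial approximation types over $(K,v_0)$. For every $\mathbf A\in\mathcal A$ there is an extension $v$ of $v_0$ to $K(x)$ such that $\mathrm{appr}_v(x,K)=\mathbf A$; that is, the function $\mathcal V\to\mathcal A$, $v\mapsto\mathrm{appr}_v(x,K)$, is surjective. Moreover, the following assertions hold: 1) If $\mathbf A$ is transcendental immediate, then the extension $v$ (with $\mathrm{appr}_v(x,K)=\mathbf A$) is uniquely determined and $(K(x)|K,v)$ is immediate. 2) If $\mathbf A$ is algebraic immediate with $\mathrm{supp}\,\mathbf A\ne v_0K$, then the extension $v$ can be chosen to be value-transcendental, and it can also be chosen to be residue-transcendental. If $\mathbf A$ is algebraic immediate with $\mathrm{supp}\,\mathbf A=v_0K$, then the extension $v$ is uniquely determined and value-transcendental. 3) If $\mathbf A$ is value-extending, then $v$ can be constructed as follows: take $b\in\bigcap\mathbf A$ and take $\alpha$ in some ordered abelian group containing $v_0K$ such that $\alpha$ is not a torsion element modulo $v_0K$ and $\gamma<\alpha<\varepsilon$ for all $\gamma\in\mathrm{supp}\,\mathbf A$ and all $\varepsilon\in v_0K\setminus\mathrm{supp}\,\mathbf A$. If $v$ is the extension of $v_0$ to $K(x)$ determined by $v\bigl(\sum_i c_i(x-b)^i\bigr)=\min_i\,(v_0c_i+i\alpha)$ for $c_i\in K$, then $\mathrm{appr}_v(x,K)=\mathbf A$. Every extension $(K(x)|K,v)$ constructed in this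 way is value-transcendental. 4) If $\mathbf A$ is residue-extending, then $v$ can be constructed as follows: let $\delta=\max\mathrm{supp}\,\mathbf A$ (so that $\bigcap\mathbf A=\mathbf A_\delta$) and take $b\in\bigcap\mathbf A$. If $v$ is the extension of $v_0$ to $K(x)$ determined by $v\bigl(\sum_i c_i(x-b)^i\bigr)=\min_i\,(v_0c_i+i\delta)$ for $c_i\in K$, then $\mathrm{appr}_v(x,K)=\mathbf A$. Every extension $(K(x)|K,v)$ constructed in this way is residue-transcendental.
   Context: Valuations are Krull valuations written additively; $vK$ is the value group, $Kv$ the residue field, and $\infty$ is larger than all values. Extensions of $v_0$ are identified when they are equivalent over $v_0$ (differ by an order preserving isomorphism of value groups that is the identity on $v_0K$). Balls: for $c\in K$, the closed ball of radius $\gamma\in vK\cup\{\infty\}$ is $B_\gamma(c,K)=\{a\in K\mid v(a-c)\ge\gamma\}$, and the open ball of radius $\gamma\in vK$ is $B^\circ_\gamma(c,K)=\{a\in K\mid v(a-c)>\gamma\}$. Balls are recorded together with their radius and their kind (open/closed). An approximation type $\mathbf A$ over $(K,v)$ is a (possibly empty) collection of closed and open balls in $(K,v)$, any two of which are comparable by inclusion, such that whenever $\mathbf A$ contains a (closed or open) ball with center $c$ and radius $\gamma$, it contains $B_\beta(c,K)$ and $B_\beta^\circ(c,K)$ for all $\beta\in vK$ with $\beta<\gamma$, and whenever it contains $B^\circ_\gamma(c,K)$ it contains $B_\gamma(c,K)$. Its support $\mathrm{supp}\,\mathbf A$ is the set of all $\gamma\in vK\cup\{\infty\}$ such that $\mathbf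 A$ contains a closed ball of radius $\gamma$; this ball is then unique and denoted $\mathbf A_\gamma$. If $\mathbf A$ contains an open ball of radius $\gamma$, it is unique and denoted $\mathbf A_\gamma^\circ$. Put $\mathbf A_\gamma=\emptyset$, resp. $\mathbf A_\gamma^\circ=\emptyset$, if there is no such ball. $\bigcap\mathbf A$ is the intersection of all balls in $\mathbf A$ (and $\bigcap\emptyset=K$). $\mathbf A$ is trivial if $\infty\in\mathrm{supp}\,\mathbf A$. For an extension $(L|K,v)$ of valued fields and $x\in L$, $\mathrm{appr}_v(x,K)$ is the approximation type over $(K,v)$ consisting of all nonempty sets $\{c\in K\mid v(x-c)\ge\gamma\}$, $\gamma\in vK\cup\{\infty\}$ (as closed balls of radius $\gamma$), and all nonempty sets $\{c\in K\mid v(x-c)>\gamma\}$, $\gamma\in vK$ (as open balls of radius $\gamma$). A non-trivial $\mathbf A$ is: immediate if $\mathbf A\neq\emptyset$ and $\bigcap\mathbf A=\emptyset$; value-extending if $\mathbf A_\gamma^\circ\ne\emptyset$ for every $\gamma\in\mathrm{supp}\,\mathbf A$ and $\bigcap\mathbf A\neq\emptyset$ (so the empty type is value-extending); residue-extending if for every $c\in K$ there is $\gamma\in\mathrm{supp}\,\mathbf A$ with $c\in\mathbf A_\gamma\setminus\mathbf A_\gamma^\circ$, and $\bigcap\mathbf A\ne\emptyset$ (then $\mathrm{supp}\,\mathbf A$ has a maximum). An immediate $\mathbf A$ fixes the value of $f\in K[X]$ if there is $\delta\in\mathrm{supp}\,\mathbf A$ such that $vf(c)$ is constant for $c\in\mathbf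 A_\delta$; $\mathbf A$ is transcendental if it fixes the value of every $f\in K[X]$, and algebraic otherwise. An extension $(K(x)|K,v)$ is immediate if $vK(x)=v_0K$ and $K(x)v=Kv_0$ (canonically); value-transcendental if $vK(x)/v_0K$ has rational rank 1 (and hence $K(x)v|Kv_0$ is algebraic); residue-transcendental if $K(x)v|Kv_0$ has transcendence degree 1 (and hence $vK(x)/v_0K$ is torsion). *)

theory Defs
  imports
    "HOL-Algebra.Finite_Extensions"
    "HOL-Algebra.Generated_Fields"
    "HOL-Computational_Algebra.Polynomial"
    "HOL-Computational_Algebra.Fraction_Field"
begin

section \<open>Ordered abelian groups and Krull valuations\<close>

text \<open>
  Value groups are explicit carriers rather than instances of a type class, since the theorem
  asserts the existence of value groups.  The group operation is \<open>\<otimes>\<close> of HOL-Algebra, although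
  valuations are thought of additively: \<open>\<alpha> \<otimes> \<beta>\<close> is \<open>\<alpha> + \<beta>\<close>, \<open>\<one>\<close> is \<open>0\<close> and \<open>\<alpha> [^] i\<close> is \<open>i\<alpha>\<close>.
\<close>

record 'g ogroup = "'g monoid" +
  ord_le :: "'g \<Rightarrow> 'g \<Rightarrow> bool"

locale ordered_abelian_group = comm_group G for G :: "'g ogroup" (structure) +
  assumes ord_refl: "a \<in> carrier G \<Longrightarrow> ord_le G a a"
    and ord_antisym: "\<lbrakk>a \<in> carrier G; b \<in> carrier G; ord_le G a b; ord_le G b a\<rbrakk> \<Longrightarrow> a = b"
    and ord_trans: "\<lbrakk>a \<in> carrier G; b \<in> carrier G; c \<in> carrier G; ord_le G a b; ord_le G b c\<rbrakk>
                      \<Longrightarrow> ord_le G a c"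
    and ord_total: "\<lbrakk>a \<in> carrier G; b \<in> carrier G\<rbrakk> \<Longrightarrow> ord_le G a b \<or> ord_le G b a"
    and ord_mult: "\<lbrakk>a \<in> carrier G; b \<in> carrier G; c \<in> carrier G; ord_le G a b\<rbrakk>
                      \<Longrightarrow> ord_le G (c \<otimes> a) (c \<otimes> b)"

definition ord_less :: "'g ogroup \<Rightarrow> 'g \<Rightarrow> 'g \<Rightarrow> bool" where
  "ord_less G a b \<longleftrightarrow> ord_le G a b \<and> a \<noteq> b"

text \<open>Values live in \<open>'g option\<close>, where \<open>None\<close> stands for \<open>\<infinity>\<close>.\<close>

fun vle :: "'g ogroup \<Rightarrow> 'g option \<Rightarrow> 'g option \<Rightarrow> bool" where
  "vle G \<gamma> None = True"
| "vle G None (Some b) = False"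
| "vle G (Some a) (Some b) = ord_le G a b"

definition vless :: "'g ogroup \<Rightarrow> 'g option \<Rightarrow> 'g option \<Rightarrow> bool" where
  "vless G \<gamma> \<delta> \<longleftrightarrow> vle G \<gamma> \<delta> \<and> \<gamma> \<noteq> \<delta>"

fun vadd :: "'g ogroup \<Rightarrow> 'g option \<Rightarrow> 'g option \<Rightarrow> 'g option" where
  "vadd G (Some a) (Some b) = Some (a \<otimes>\<^bsub>G\<^esub> b)"
| "vadd G _ _ = None"

definition is_vmin :: "'g ogroup \<Rightarrow> 'g option \<Rightarrow> 'g option set \<Rightarrow> bool" where
  "is_vmin G m S \<longleftrightarrow> m \<in> S \<and> (\<forall>s\<in>S. vle G m s)"

definition valuation :: "'g ogroup \<Rightarrow> ('f::field \<Rightarrow> 'g option) \<Rightarrow> bool" where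
  "valuation G v \<longleftrightarrow> ordered_abelian_group G
     \<and> (\<forall>a g. v a = Some g \<longrightarrow> g \<in> carrier G)
     \<and> (\<forall>a. v a = None \<longleftrightarrow> a = 0)
     \<and> (\<forall>a b. v (a * b) = vadd G (v a) (v b))
     \<and> (\<forall>a b. vle G (v a) (v (a + b)) \<or> vle G (v b) (v (a + b)))"

text \<open>A valuation need not be onto the group \<open>G\<close>; its value group is the subgroup of values.\<close>

definition values_of :: "('f::field \<Rightarrow> 'g option) \<Rightarrow> 'f set \<Rightarrow> 'g set" where
  "values_of v S = {g. \<exists>a\<in>S. v a = Some g}"

definition value_group :: "'g ogroup \<Rightarrow> ('f::field \<Rightarrow> 'g option) \<Rightarrow> 'g ogroup" where
  "value_group G v = G\<lparr>carrier := values_of v UNIV\<rparr>"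

definition valuation_ring :: "'g ogroup \<Rightarrow> ('f::field \<Rightarrow> 'g option) \<Rightarrow> 'f ring" where
  "valuation_ring G v =
     \<lparr>carrier = {a. vle G (Some \<one>\<^bsub>G\<^esub>) (v a)}, mult = (*), one = 1, zero = 0, add = (+)\<rparr>"

definition valuation_ideal :: "'g ogroup \<Rightarrow> ('f::field \<Rightarrow> 'g option) \<Rightarrow> 'f set" where
  "valuation_ideal G v = {a. vless G (Some \<one>\<^bsub>G\<^esub>) (v a)}"

definition residue_field :: "'g ogroup \<Rightarrow> ('f::field \<Rightarrow> 'g option) \<Rightarrow> 'f set ring" where
  "residue_field G v = valuation_ring G v Quot valuation_ideal G v"

text \<open>The residues of those elements of \<open>S\<close> that lie in the valuation ring.\<close>

definition residues_of :: "'g ogroup \<Rightarrow> ('f::field \<Rightarrow> 'g option) \<Rightarrow> 'f set \<Rightarrow> 'f set set" where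
  "residues_of G v S =
     (\<lambda>a. valuation_ideal G v +>\<^bsub>valuation_ring G v\<^esub> a) ` (S \<inter> carrier (valuation_ring G v))"

definition group_order_embedding :: "'g ogroup \<Rightarrow> 'h ogroup \<Rightarrow> ('g \<Rightarrow> 'h) \<Rightarrow> bool" where
  "group_order_embedding G H \<iota> \<longleftrightarrow> \<iota> \<in> hom G H
     \<and> (\<forall>a\<in>carrier G. \<forall>b\<in>carrier G. ord_le G a b \<longleftrightarrow> ord_le H (\<iota> a) (\<iota> b))"

definition group_order_iso :: "'g ogroup \<Rightarrow> 'h ogroup \<Rightarrow> ('g \<Rightarrow> 'h) \<Rightarrow> bool" where
  "group_order_iso G H \<phi> \<longleftrightarrow> \<phi> \<in> iso G H \<and> group_order_embedding G H \<phi>"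


section \<open>Rational rank and transcendence degree\<close>

definition Z_independent :: "('a, 'm) monoid_scheme \<Rightarrow> 'a set \<Rightarrow> bool" where
  "Z_independent A S \<longleftrightarrow> S \<subseteq> carrier A \<and>
     (\<forall>T (m :: 'a \<Rightarrow> int). finite T \<and> T \<subseteq> S \<and> finprod A (\<lambda>t. t [^]\<^bsub>A\<^esub> m t) T = \<one>\<^bsub>A\<^esub>
        \<longrightarrow> (\<forall>t\<in>T. m t = 0))"

definition has_rational_rank :: "('a, 'm) monoid_scheme \<Rightarrow> nat \<Rightarrow> bool" where
  "has_rational_rank A n \<longleftrightarrow>
     (\<exists>S. finite S \<and> card S = n \<and> Z_independent A S)
     \<and> (\<forall>S. finite S \<and> Z_independent A S \<longrightarrow> card S \<le> n)"

text \<open>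
  \<open>S\<close> is algebraically independent over the subfield \<open>k\<close> of \<open>F\<close> iff every element of \<open>S\<close> is
  transcendental over the field generated by \<open>k\<close> and the other elements of \<open>S\<close>.
\<close>

definition transcendence_basis :: "('a, 'm) ring_scheme \<Rightarrow> 'a set \<Rightarrow> 'a set \<Rightarrow> bool" where
  "transcendence_basis F k S \<longleftrightarrow> S \<subseteq> carrier F
     \<and> (\<forall>s\<in>S. ring.transcendental F (generate_field F (k \<union> (S - {s}))) s)
     \<and> (\<forall>y\<in>carrier F. ring.algebraic F (generate_field F (k \<union> S)) y)"

definition has_transcendence_degree :: "('a, 'm) ring_scheme \<Rightarrow> 'a set \<Rightarrow> nat \<Rightarrow> bool" where
  "has_transcendence_degree F k n \<longleftrightarrow>
     (\<exists>S. finite S \<and> card S = n \<and> transcendence_basis F k S)"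


section \<open>Extensions of a valuation to the rational function field\<close>

type_synonym 'k ratfun = "'k poly fract"

definition const :: "'k::field \<Rightarrow> 'k ratfun" where
  "const c = Fract [:c:] 1"

definition ratX :: "'k::field ratfun" where
  "ratX = Fract [:0, 1:] 1"

definition extension ::
    "'g ogroup \<Rightarrow> ('k::field \<Rightarrow> 'g option) \<Rightarrow> 'h ogroup \<Rightarrow> ('k ratfun \<Rightarrow> 'h option) \<Rightarrow> bool" where
  "extension G0 v0 G v \<longleftrightarrow> valuation G v \<and>
     (\<exists>\<iota>. group_order_embedding (value_group G0 v0) G \<iota> \<and>
          (\<forall>c. v (const c) = map_option \<iota> (v0 c)))"

text \<open>
  Equivalence over \<open>v0\<close>.  As \<open>\<phi> \<circ> v = w\<close> holds on constants too, \<open>\<phi>\<close> is the identity on \<open>v0 K\<close>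
  (embedded in both value groups via the values of constants) when \<open>v\<close> and \<open>w\<close> extend \<open>v0\<close>.
\<close>

definition equivalent_ext ::
    "'h ogroup \<Rightarrow> ('k::field ratfun \<Rightarrow> 'h option) \<Rightarrow> 'i ogroup \<Rightarrow> ('k ratfun \<Rightarrow> 'i option) \<Rightarrow> bool" where
  "equivalent_ext G v H w \<longleftrightarrow>
     (\<exists>\<phi>. group_order_iso (value_group G v) (value_group H w) \<phi> \<and>
          (\<forall>f. w f = map_option \<phi> (v f)))"

text \<open>
  A type large enough for the value group of any extension to \<open>K(x)\<close>: a value \<open>\<gamma>\<close> can be
  represented by the set of all rational functions of value \<open>\<gamma>\<close>; see \<open>extension_canonical\<close>.
\<close>

type_synonym 'k canonical_value = "'k ratfun set"

lemma value_group_ordered: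
  fixes G (structure)
  assumes val: "valuation G v"
  shows "ordered_abelian_group (value_group G v)"
proof -
  have G: "ordered_abelian_group G" using val by (simp add: valuation_def)
  interpret ordered_abelian_group G by (rule G)
  have vmul: "v (a * b) = vadd G (v a) (v b)" for a b using val by (simp add: valuation_def)
  have vz: "v a = None \<longleftrightarrow> a = 0" for a using val by (simp add: valuation_def)
  have sub: "values_of v UNIV \<subseteq> carrier G"
    using val by (auto simp: values_of_def valuation_def)
  have one: "v 1 = Some \<one>"
  proof -
    obtain g where g: "v 1 = Some g" using vz[of 1] by auto
    then have gc: "g \<in> carrier G" using val by (simp add: valuation_def)
    have "g \<otimes> g = g" using vmul[of 1 1] g by simp
    then show ?thesis using gc g by (metis l_cancel_one)
  qed
  have "subgroup (values_of v UNIV) G"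
  proof
    show "values_of v UNIV \<subseteq> carrier G" by (rule sub)
    show "\<one> \<in> values_of v UNIV" using one by (auto simp: values_of_def)
  next
    fix x y assume "x \<in> values_of v UNIV" "y \<in> values_of v UNIV"
    then obtain a b where "v a = Some x" "v b = Some y" by (auto simp: values_of_def)
    then have "v (a * b) = Some (x \<otimes> y)" by (simp add: vmul)
    then show "x \<otimes> y \<in> values_of v UNIV" by (auto simp: values_of_def)
  next
    fix x assume x: "x \<in> values_of v UNIV"
    then obtain a where a: "v a = Some x" by (auto simp: values_of_def)
    then have "a \<noteq> 0" using vz[of a] by auto
    then obtain y where y: "v (inverse a) = Some y" using vz[of "inverse a"] by auto
    have "y \<otimes> x = \<one>" using vmul[of "inverse a" a] \<open>a \<noteq> 0\<close> one a y by simp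
    moreover have "y \<in> carrier G" using y val by (simp add: valuation_def)
    ultimately have "inv x = y" using x sub by (metis inv_equality subsetD)
    then show "inv x \<in> values_of v UNIV" using y by (auto simp: values_of_def)
  qed
  then have "group (value_group G v)"
    unfolding value_group_def by (rule subgroup_imp_group)
  then have "comm_group (value_group G v)"
    by (rule group.group_comm_groupI)
      (use sub in \<open>auto simp: value_group_def intro: m_comm\<close>)
  moreover have "ordered_abelian_group_axioms (value_group G v)"
  proof -
    have "a \<in> carrier G" if "a \<in> carrier (value_group G v)" for a
      using that sub by (auto simp: value_group_def)
    note c = this
    show ?thesis
    proof
      fix a b c'
      show "ord_le (value_group G v) a a" if "a \<in> carrier (value_group G v)"
        using ord_refl c that by (simp add: value_group_def)
      show "a = b" if "a \<in> carrier (value_group G v)" "b \<in> carrier (value_group G v)"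
        "ord_le (value_group G v) a b" "ord_le (value_group G v) b a"
        using ord_antisym[of a b] c[OF that(1)] c[OF that(2)] that(3,4)
        by (simp add: value_group_def)
      show "ord_le (value_group G v) a c'" if "a \<in> carrier (value_group G v)"
        "b \<in> carrier (value_group G v)" "c' \<in> carrier (value_group G v)"
        "ord_le (value_group G v) a b" "ord_le (value_group G v) b c'"
        using ord_trans[of a b c'] c[OF that(1)] c[OF that(2)] c[OF that(3)] that(4,5)
        by (simp add: value_group_def)
      show "ord_le (value_group G v) a b \<or> ord_le (value_group G v) b a"
        if "a \<in> carrier (value_group G v)" "b \<in> carrier (value_group G v)"
        using ord_total[of a b] c[OF that(1)] c[OF that(2)] by (simp add: value_group_def)
      show "ord_le (value_group G v) (c' \<otimes>\<^bsub>value_group G v\<^esub> a) (c' \<otimes>\<^bsub>value_group G v\<^esub> b)"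
        if "a \<in> carrier (value_group G v)" "b \<in> carrier (value_group G v)"
        "c' \<in> carrier (value_group G v)" "ord_le (value_group G v) a b"
        using ord_mult[of a b c'] c[OF that(1)] c[OF that(2)] c[OF that(3)] that(4)
        by (simp add: value_group_def)
    qed
  qed
  ultimately show ?thesis by (rule ordered_abelian_group.intro)
qed

lemma ordered_abelian_group_transport:
  assumes V: "ordered_abelian_group V" and inj: "inj_on S (carrier V)"
  defines "r \<equiv> inv_into (carrier V) S"
  defines "H \<equiv> \<lparr>carrier = S ` carrier V, mult = (\<lambda>A B. S (r A \<otimes>\<^bsub>V\<^esub> r B)), one = S \<one>\<^bsub>V\<^esub>,
                 ord_le = (\<lambda>A B. ord_le V (r A) (r B))\<rparr>"
  shows "ordered_abelian_group H" and "group_order_iso V H S"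
proof -
  interpret ordered_abelian_group V by (rule V)
  have r: "r (S a) = a" if "a \<in> carrier V" for a
    using that inj by (simp add: r_def)
  have "comm_group H"
  proof (rule comm_groupI)
    fix A assume "A \<in> carrier H"
    then obtain a where a: "a \<in> carrier V" "A = S a" by (auto simp: H_def)
    show "\<exists>B\<in>carrier H. B \<otimes>\<^bsub>H\<^esub> A = \<one>\<^bsub>H\<^esub>"
      using a by (intro bexI[of _ "S (inv\<^bsub>V\<^esub> a)"]) (simp_all add: H_def r)
  qed (auto simp: H_def r m_ac)
  moreover have "ordered_abelian_group_axioms H"
  proof
    fix A B C
    show "ord_le H A A" if "A \<in> carrier H"
      using that ord_refl by (auto simp: H_def r)
    show "A = B" if "A \<in> carrier H" "B \<in> carrier H" "ord_le H A B" "ord_le H B A"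
    proof -
      from that(1,2) obtain a b where "a \<in> carrier V" "b \<in> carrier V" "A = S a" "B = S b"
        by (auto simp: H_def)
      then show ?thesis using that(3,4) ord_antisym[of a b] by (simp add: H_def r)
    qed
    show "ord_le H A C" if "A \<in> carrier H" "B \<in> carrier H" "C \<in> carrier H"
      "ord_le H A B" "ord_le H B C"
    proof -
      from that(1,2,3) obtain a b c where "a \<in> carrier V" "b \<in> carrier V" "c \<in> carrier V"
        "A = S a" "B = S b" "C = S c"
        by (auto simp: H_def)
      then show ?thesis using that(4,5) ord_trans[of a b c] by (simp add: H_def r)
    qed
    show "ord_le H A B \<or> ord_le H B A" if "A \<in> carrier H" "B \<in> carrier H"
    proof -
      from that(1,2) obtain a b where "a \<in> carrier V" "b \<in> carrier V" "A = S a" "B = S b"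
        by (auto simp: H_def)
      then show ?thesis using ord_total[of a b] by (simp add: H_def r)
    qed
    show "ord_le H (C \<otimes>\<^bsub>H\<^esub> A) (C \<otimes>\<^bsub>H\<^esub> B)"
      if "A \<in> carrier H" "B \<in> carrier H" "C \<in> carrier H" "ord_le H A B"
    proof -
      from that(1,2,3) obtain a b c where "a \<in> carrier V" "b \<in> carrier V" "c \<in> carrier V"
        "A = S a" "B = S b" "C = S c"
        by (auto simp: H_def)
      then show ?thesis using that(4) ord_mult[of a b c] by (simp add: H_def r)
    qed
  qed
  ultimately show "ordered_abelian_group H" by (rule ordered_abelian_group.intro)
  show "group_order_iso V H S"
    unfolding group_order_iso_def group_order_embedding_def iso_def hom_def bij_betw_def
    using inj by (auto simp: H_def r)
qed

lemma extension_canonical: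
  fixes G0 :: "'g ogroup" and v0 :: "'k::field \<Rightarrow> 'g option"
    and G :: "'h ogroup" and v :: "'k ratfun \<Rightarrow> 'h option"
  assumes ext: "extension G0 v0 G v"
  shows "\<exists>(H :: 'k canonical_value ogroup) w. extension G0 v0 H w \<and> equivalent_ext G v H w"
proof -
  let ?V = "value_group G v" and ?H0 = "value_group G0 v0"
  define S where "S g = {f. v f = Some g}" for g
  have val: "valuation G v" using ext by (simp add: extension_def)
  obtain \<iota> where \<iota>: "group_order_embedding ?H0 G \<iota>" "\<And>c. v (const c) = map_option \<iota> (v0 c)"
    using ext by (auto simp: extension_def)
  have car: "carrier ?V = values_of v UNIV" by (simp add: value_group_def)
  have inj: "inj_on S (carrier ?V)"
  proof (rule inj_onI)
    fix g h assume "g \<in> carrier ?V" "S g = S h"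
    then obtain a where "v a = Some g" by (auto simp: car values_of_def)
    moreover from this have "a \<in> S h" unfolding \<open>S g = S h\<close>[symmetric] by (simp add: S_def)
    ultimately show "g = h" by (simp add: S_def)
  qed
  obtain H :: "'k canonical_value ogroup" where
    H: "ordered_abelian_group H" and iso: "group_order_iso ?V H S"
    using ordered_abelian_group_transport[OF value_group_ordered[OF val] inj] by blast
  define w where "w f = map_option S (v f)" for f
  have vV: "g \<in> carrier ?V" if "v f = Some g" for f g
    using that by (auto simp: car values_of_def)
  have hom: "S a \<otimes>\<^bsub>H\<^esub> S b = S (a \<otimes>\<^bsub>G\<^esub> b)" if "a \<in> carrier ?V" "b \<in> carrier ?V" for a b
    using iso that by (auto simp: group_order_iso_def iso_def hom_def value_group_def)
  have ord: "ord_le H (S a) (S b) \<longleftrightarrow> ord_le G a b" if "a \<in> carrier ?V" "b \<in> carrier ?V" for a b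
    using iso that by (auto simp: group_order_iso_def group_order_embedding_def value_group_def)
  have onto: "S ` carrier ?V = carrier H"
    using iso by (auto simp: group_order_iso_def iso_def bij_betw_def)
  have vle: "vle H (w a) (w b) \<longleftrightarrow> vle G (v a) (v b)" for a b
    by (cases "v a"; cases "v b") (auto simp: w_def ord vV)
  have wv: "valuation H w"
    unfolding valuation_def
  proof (intro conjI allI impI)
    show "ordered_abelian_group H" by (rule H)
    show "g \<in> carrier H" if "w a = Some g" for a g
      using that vV onto by (auto simp: w_def)
    show "w a = None \<longleftrightarrow> a = 0" for a using val by (simp add: w_def valuation_def)
    show "w (a * b) = vadd H (w a) (w b)" for a b
    proof -
      have "v (a * b) = vadd G (v a) (v b)" using val by (simp add: valuation_def)
      then show ?thesis by (cases "v a"; cases "v b") (auto simp: w_def hom vV)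
    qed
    show "vle H (w a) (w (a + b)) \<or> vle H (w b) (w (a + b))" for a b
      using val by (simp add: vle valuation_def)
  qed
  have vals: "carrier (value_group H w) = S ` carrier ?V"
    by (auto simp: value_group_def values_of_def w_def)
  have "group_order_iso ?V (value_group H w) S"
    using iso vals onto
    by (simp add: group_order_iso_def group_order_embedding_def iso_def hom_def value_group_def)
  then have equiv: "equivalent_ext G v H w"
    unfolding equivalent_ext_def by (auto simp: w_def)
  have \<iota>V: "\<iota> g \<in> carrier ?V" if "g \<in> carrier ?H0" for g
  proof -
    from that obtain c where "v0 c = Some g" by (auto simp: value_group_def values_of_def)
    then have "v (const c) = Some (\<iota> g)" by (simp add: \<iota>(2))
    then show ?thesis by (rule vV)
  qed
  have "group_order_embedding ?H0 H (S \<circ> \<iota>)"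
    unfolding group_order_embedding_def hom_def
  proof (intro conjI ballI CollectI)
    show "S \<circ> \<iota> \<in> carrier ?H0 \<rightarrow> carrier H" using \<iota>V onto by auto
    fix a b assume ab: "a \<in> carrier ?H0" "b \<in> carrier ?H0"
    show "(S \<circ> \<iota>) (a \<otimes>\<^bsub>?H0\<^esub> b) = (S \<circ> \<iota>) a \<otimes>\<^bsub>H\<^esub> (S \<circ> \<iota>) b"
      using \<iota>(1) ab \<iota>V hom by (simp add: group_order_embedding_def hom_def)
    show "ord_le ?H0 a b \<longleftrightarrow> ord_le H ((S \<circ> \<iota>) a) ((S \<circ> \<iota>) b)"
      using \<iota>(1) ab \<iota>V ord by (simp add: group_order_embedding_def)
  qed
  then have "extension G0 v0 H w"
    unfolding extension_def using wv \<iota>(2)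
    by (auto simp: w_def option.map_comp comp_def intro!: exI[of _ "S \<circ> \<iota>"])
  with equiv show ?thesis by blast
qed

definition immediate_ext :: "'h ogroup \<Rightarrow> ('k::field ratfun \<Rightarrow> 'h option) \<Rightarrow> bool" where
  "immediate_ext G v \<longleftrightarrow>
     values_of v UNIV = values_of v (range const)
     \<and> carrier (residue_field G v) = residues_of G v (range const)"

definition value_transcendental :: "'h ogroup \<Rightarrow> ('k::field ratfun \<Rightarrow> 'h option) \<Rightarrow> bool" where
  "value_transcendental G v \<longleftrightarrow>
     has_rational_rank (value_group G v Mod values_of v (range const)) 1"

definition residue_transcendental :: "'h ogroup \<Rightarrow> ('k::field ratfun \<Rightarrow> 'h option) \<Rightarrow> bool" where
  "residue_transcendental G v \<longleftrightarrow>
     has_transcendence_degree (residue_field G v) (residues_of G v (range const)) 1"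

text \<open>
  \<open>v\<close> is the valuation with \<open>v (\<Sum>i. c i * (x - b)^i) = min i. v0 (c i) + i\<alpha>\<close>, where \<open>v0 K\<close> is
  viewed inside \<open>G\<close> via \<open>\<iota>\<close>.
\<close>

definition monomial_valuation ::
    "('k::field \<Rightarrow> 'g option) \<Rightarrow> 'h ogroup \<Rightarrow> ('g \<Rightarrow> 'h) \<Rightarrow> 'k \<Rightarrow> 'h \<Rightarrow> ('k ratfun \<Rightarrow> 'h option) \<Rightarrow> bool"
  where
  "monomial_valuation v0 G \<iota> b \<alpha> v \<longleftrightarrow> valuation G v \<and>
     (\<forall>(c :: nat \<Rightarrow> 'k) n.
        is_vmin G (v (\<Sum>i\<le>n. const (c i) * (ratX - const b) ^ i))
          ((\<lambda>i. vadd G (map_option \<iota> (v0 (c i))) (Some (\<alpha> [^]\<^bsub>G\<^esub> i))) ` {..n}))"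


section \<open>Approximation types\<close>

datatype ball_kind = ClosedBall | OpenBall

text \<open>A ball is recorded with its kind and radius.\<close>

type_synonym ('k, 'g) ball = "ball_kind \<times> 'g option \<times> 'k set"

definition closed_ball :: "'g ogroup \<Rightarrow> ('k::field \<Rightarrow> 'g option) \<Rightarrow> 'g option \<Rightarrow> 'k \<Rightarrow> ('k, 'g) ball" where
  "closed_ball G v \<gamma> c = (ClosedBall, \<gamma>, {a. vle G \<gamma> (v (a - c))})"

definition open_ball :: "'g ogroup \<Rightarrow> ('k::field \<Rightarrow> 'g option) \<Rightarrow> 'g option \<Rightarrow> 'k \<Rightarrow> ('k, 'g) ball" where
  "open_ball G v \<gamma> c = (OpenBall, \<gamma>, {a. vless G \<gamma> (v (a - c))})"

definition balls :: "'g ogroup \<Rightarrow> ('k::field \<Rightarrow> 'g option) \<Rightarrow> ('k, 'g) ball set" where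
  "balls G v =
     {closed_ball G v \<gamma> c | \<gamma> c. \<gamma> \<in> insert None (Some ` values_of v UNIV)}
     \<union> {open_ball G v \<gamma> c | \<gamma> c. \<gamma> \<in> Some ` values_of v UNIV}"

definition approximation_type ::
    "'g ogroup \<Rightarrow> ('k::field \<Rightarrow> 'g option) \<Rightarrow> ('k, 'g) ball set \<Rightarrow> bool" where
  "approximation_type G v A \<longleftrightarrow> A \<subseteq> balls G v
     \<and> (\<forall>(_, _, B)\<in>A. \<forall>(_, _, B')\<in>A. B \<subseteq> B' \<or> B' \<subseteq> B)
     \<and> (\<forall>\<gamma> c. closed_ball G v \<gamma> c \<in> A \<or> open_ball G v \<gamma> c \<in> A \<longrightarrow>
          (\<forall>\<beta>\<in>values_of v UNIV. vless G (Some \<beta>) \<gamma> \<longrightarrow>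
             closed_ball G v (Some \<beta>) c \<in> A \<and> open_ball G v (Some \<beta>) c \<in> A))
     \<and> (\<forall>\<gamma> c. open_ball G v \<gamma> c \<in> A \<longrightarrow> closed_ball G v \<gamma> c \<in> A)"

definition supp :: "('k, 'g) ball set \<Rightarrow> 'g option set" where
  "supp A = {\<gamma>. \<exists>B. (ClosedBall, \<gamma>, B) \<in> A}"

text \<open>
  In an approximation type there is at most one closed (open) ball of a given radius, so the unions
  below are that ball, or empty if there is none.
\<close>

definition closed_at :: "('k, 'g) ball set \<Rightarrow> 'g option \<Rightarrow> 'k set" where
  "closed_at A \<gamma> = \<Union>{B. (ClosedBall, \<gamma>, B) \<in> A}"

definition open_at :: "('k, 'g) ball set \<Rightarrow> 'g option \<Rightarrow> 'k set" where
  "open_at A \<gamma> = \<Union>{B. (OpenBall, \<gamma>, B) \<in> A}"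

definition inter :: "('k, 'g) ball set \<Rightarrow> 'k set" where
  "inter A = (\<Inter>(_, _, B)\<in>A. B)"

definition nontrivial_types :: "'g ogroup \<Rightarrow> ('k::field \<Rightarrow> 'g option) \<Rightarrow> ('k, 'g) ball set set" where
  "nontrivial_types G v = {A. approximation_type G v A \<and> None \<notin> supp A}"

text \<open>
  The approximation type of \<open>x\<close> over \<open>K\<close>.  The radius \<open>\<gamma> \<in> v0 K \<union> {\<infinity>}\<close> is written as \<open>v0 d\<close>; its
  image in \<open>v K(x) \<union> {\<infinity>}\<close> is then \<open>v (const d)\<close>.
\<close>

definition appr ::
    "('k::field \<Rightarrow> 'g option) \<Rightarrow> 'h ogroup \<Rightarrow> ('k ratfun \<Rightarrow> 'h option) \<Rightarrow> ('k, 'g) ball set" where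
  "appr v0 G v =
     {(ClosedBall, v0 d, B) | d B. B = {c. vle G (v (const d)) (v (ratX - const c))} \<and> B \<noteq> {}}
     \<union> {(OpenBall, v0 d, B) | d B. d \<noteq> 0 \<and> B = {c. vless G (v (const d)) (v (ratX - const c))} \<and> B \<noteq> {}}"

definition immediate_type :: "'g ogroup \<Rightarrow> ('k::field \<Rightarrow> 'g option) \<Rightarrow> ('k, 'g) ball set \<Rightarrow> bool" where
  "immediate_type G v A \<longleftrightarrow> A \<in> nontrivial_types G v \<and> A \<noteq> {} \<and> inter A = {}"

definition value_extending :: "'g ogroup \<Rightarrow> ('k::field \<Rightarrow> 'g option) \<Rightarrow> ('k, 'g) ball set \<Rightarrow> bool" where
  "value_extending G v A \<longleftrightarrow> A \<in> nontrivial_types G v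
     \<and> (\<forall>\<gamma>\<in>supp A. open_at A \<gamma> \<noteq> {}) \<and> inter A \<noteq> {}"

definition residue_extending :: "'g ogroup \<Rightarrow> ('k::field \<Rightarrow> 'g option) \<Rightarrow> ('k, 'g) ball set \<Rightarrow> bool" where
  "residue_extending G v A \<longleftrightarrow> A \<in> nontrivial_types G v
     \<and> (\<forall>c. \<exists>\<gamma>\<in>supp A. c \<in> closed_at A \<gamma> - open_at A \<gamma>) \<and> inter A \<noteq> {}"

definition fixes_value :: "('k::field \<Rightarrow> 'g option) \<Rightarrow> ('k, 'g) ball set \<Rightarrow> 'k poly \<Rightarrow> bool" where
  "fixes_value v A f \<longleftrightarrow>
     (\<exists>\<delta>\<in>supp A. \<forall>c\<in>closed_at A \<delta>. \<forall>d\<in>closed_at A \<delta>. v (poly f c) = v (poly f d))"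

definition transcendental_immediate ::
    "'g ogroup \<Rightarrow> ('k::field \<Rightarrow> 'g option) \<Rightarrow> ('k, 'g) ball set \<Rightarrow> bool" where
  "transcendental_immediate G v A \<longleftrightarrow> immediate_type G v A \<and> (\<forall>f. fixes_value v A f)"

definition algebraic_immediate ::
    "'g ogroup \<Rightarrow> ('k::field \<Rightarrow> 'g option) \<Rightarrow> ('k, 'g) ball set \<Rightarrow> bool" where
  "algebraic_immediate G v A \<longleftrightarrow> immediate_type G v A \<and> \<not> (\<forall>f. fixes_value v A f)"

text \<open>
  The conditions on \<open>\<alpha>\<close> for a value-extending type: \<open>G\<close> contains \<open>v0 K\<close> via \<open>\<iota>\<close>, the element \<open>\<alpha>\<close>
  is not torsion modulo \<open>v0 K\<close>, and \<open>\<alpha>\<close> realizes the cut of \<open>v0 K\<close> with lower part \<open>supp A\<close>.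
\<close>

definition realizes_supp ::
    "'g ogroup \<Rightarrow> ('k::field \<Rightarrow> 'g option) \<Rightarrow> ('k, 'g) ball set \<Rightarrow> 'h ogroup \<Rightarrow> ('g \<Rightarrow> 'h) \<Rightarrow> 'h \<Rightarrow> bool"
  where
  "realizes_supp G0 v0 A G \<iota> \<alpha> \<longleftrightarrow>
     ordered_abelian_group G \<and> group_order_embedding (value_group G0 v0) G \<iota>
     \<and> \<alpha> \<in> carrier G
     \<and> (\<forall>n::nat. n > 0 \<longrightarrow> \<alpha> [^]\<^bsub>G\<^esub> n \<notin> \<iota> ` values_of v0 UNIV)
     \<and> (\<forall>\<gamma>\<in>values_of v0 UNIV. Some \<gamma> \<in> supp A \<longrightarrow> ord_less G (\<iota> \<gamma>) \<alpha>)
     \<and> (\<forall>\<epsilon>\<in>values_of v0 UNIV. Some \<epsilon> \<notin> supp A \<longrightarrow> ord_less G \<alpha> (\<iota> \<epsilon>))"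

end

theory Submission
  imports Defs
begin

text \<open>
  A valuation is studied through the preorder \<open>v a \<le> v b\<close> on the field.  Approximation types, the three
  kinds of extensions and equivalence of extensions depend on nothing else, so value groups only
  appear where a valuation is constructed.

  An extension \<open>v\<close> is determined by its comparison of polynomials, and \<open>appr\<close> by the values
  \<open>v (x - c)\<close>.  If \<open>\<Inter>A\<close> contains a point \<open>b\<close>, all balls of \<open>A\<close> are centered at \<open>b\<close> and only the cut of
  their radii has to be matched with \<open>v (x - b)\<close>: this is done by a monomial valuation in \<open>x - b\<close>, as
  \<open>v (x - c)\<close> is then the minimum of \<open>v (x - b)\<close> and \<open>v (b - c)\<close>.  In the value-extending case a suitable
  value \<open>\<alpha>\<close> exists because every cut is realized in some group \<open>v0 K \<oplus> \<int>\<alpha>\<close> (\<open>adjoin_cut\<close>).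

  If \<open>A\<close> is immediate, its balls form a filter on \<open>K\<close>, and \<open>appr\<close> equals \<open>A\<close> iff \<open>x\<close> is a pseudo-limit of
  that filter.  The Taylor expansion of \<open>f\<close> at \<open>c\<close> has eventually one dominant term, and this yields
  Kaplansky's dichotomy for polynomials \<open>f\<close> all of whose Taylor coefficients have eventually constant
  values.  Either \<open>v (f c)\<close> is eventually constant; then \<open>f\<close> differs from the constant \<open>f c\<close> only by
  something of larger value (\<open>fixed_approx\<close>).  Or \<open>v (f c)\<close> grows strictly, like a monomial in the radius
  (\<open>nonfixed_growth\<close>).

  For a transcendental type the first alternative always holds.  So \<open>v f\<close> is the eventual value of
  \<open>v (f c)\<close>, which proves existence, uniqueness and immediateness.

  For an algebraic type let \<open>f\<close> be a non-fixed polynomial of minimal degree.  It is a key polynomial in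
  the sense of MacLane: the eventual values of the digits in \<open>f\<close>-adic expansions and any \<open>\<beta>\<close> that bounds
  the values \<open>v (f c)\<close> define a valuation with \<open>v f = \<beta>\<close> (\<open>key_polynomial_eventual\<close>).  A \<open>\<beta>\<close> above \<open>v0 K\<close> gives a
  value-transcendental extension.  If the support is not all of \<open>v0 K\<close>, the values \<open>v (f c)\<close> are bounded in
  \<open>v0 K\<close>, and a bound from \<open>v0 K\<close> gives a residue-transcendental extension.  If the support is \<open>v0 K\<close>, then
  \<open>v f\<close> must exceed \<open>v0 K\<close>, the lowest digit of a polynomial decides its value, and the extension is
  unique.

  Monomial valuations are the case of a linear key polynomial, so both constructions share one
  proof of multiplicativity, a form of Gauss's lemma (\<open>w_mult\<close>).
\<close>

section \<open>Values in an ordered abelian group with infinity\<close>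

context ordered_abelian_group
begin

abbreviation vals :: "'g option set" where
  "vals \<equiv> insert None (Some ` carrier G)"

lemma vle_refl: "x \<in> vals \<Longrightarrow> vle G x x"
  by (cases x) (auto intro: ord_refl)

lemma vle_trans: "\<lbrakk>x \<in> vals; y \<in> vals; z \<in> vals; vle G x y; vle G y z\<rbrakk> \<Longrightarrow> vle G x z"
  by (cases x; cases y; cases z) (auto intro: ord_trans)

lemma vle_antisym: "\<lbrakk>x \<in> vals; y \<in> vals; vle G x y; vle G y x\<rbrakk> \<Longrightarrow> x = y"
  by (cases x; cases y) (auto intro: ord_antisym)

lemma vle_total: "\<lbrakk>x \<in> vals; y \<in> vals\<rbrakk> \<Longrightarrow> vle G x y \<or> vle G y x"
  using ord_total by (cases x; cases y) auto

lemma vadd_closed: "\<lbrakk>x \<in> vals; y \<in> vals\<rbrakk> \<Longrightarrow> vadd G x y \<in> vals"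
  by (cases x; cases y) auto

lemma vadd_comm: "\<lbrakk>x \<in> vals; y \<in> vals\<rbrakk> \<Longrightarrow> vadd G x y = vadd G y x"
  by (cases x; cases y) (auto simp: m_comm)

lemma vadd_assoc:
  "\<lbrakk>x \<in> vals; y \<in> vals; z \<in> vals\<rbrakk> \<Longrightarrow> vadd G (vadd G x y) z = vadd G x (vadd G y z)"
  by (cases x; cases y; cases z) (auto simp: m_assoc)

lemma vadd_left_comm:
  "\<lbrakk>x \<in> vals; y \<in> vals; z \<in> vals\<rbrakk> \<Longrightarrow> vadd G x (vadd G y z) = vadd G y (vadd G x z)"
  by (cases x; cases y; cases z) (auto simp: m_lcomm)

lemmas vadd_ac = vadd_assoc vadd_comm vadd_left_comm

lemma vadd_None: "vadd G x None = None" "vadd G None x = None"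
  by (cases x; simp)+

lemma vadd_zero: "x \<in> vals \<Longrightarrow> vadd G x (Some \<one>) = x" "x \<in> vals \<Longrightarrow> vadd G (Some \<one>) x = x"
  by (cases x; auto)+

lemma vadd_eq_None: "vadd G x y = None \<longleftrightarrow> x = None \<or> y = None"
  by (cases x; cases y) auto

lemma vadd_mono: "\<lbrakk>x \<in> vals; y \<in> vals; z \<in> vals; vle G x y\<rbrakk> \<Longrightarrow> vle G (vadd G z x) (vadd G z y)"
  by (cases x; cases y; cases z) (auto intro: ord_mult)

lemma vadd_mono2:
  assumes "x \<in> vals" "y \<in> vals" "z \<in> vals" "w \<in> vals" "vle G x y" "vle G z w"
  shows "vle G (vadd G x z) (vadd G y w)"
proof -
  have "vle G (vadd G x z) (vadd G x w)" by (rule vadd_mono) (use assms in auto)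
  moreover have "vle G (vadd G w x) (vadd G w y)" by (rule vadd_mono) (use assms in auto)
  ultimately show ?thesis
    using assms vle_trans[of "vadd G x z" "vadd G x w" "vadd G y w"]
    by (simp add: vadd_closed vadd_comm del: insert_iff image_iff)
qed

lemma vadd_cancel:
  assumes "x \<in> vals" "y \<in> vals" "g \<in> carrier G" "vle G (vadd G (Some g) x) (vadd G (Some g) y)"
  shows "vle G x y"
proof -
  have "vle G (vadd G (Some (inv g)) (vadd G (Some g) x))
              (vadd G (Some (inv g)) (vadd G (Some g) y))"
    by (rule vadd_mono) (use assms in \<open>auto intro!: vadd_closed\<close>)
  moreover have "vadd G (Some (inv g)) (vadd G (Some g) z) = z" if "z \<in> vals" for z
    using that assms(3) by (cases z) (auto simp: m_assoc[symmetric])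
  ultimately show ?thesis using assms by (simp del: insert_iff image_iff)
qed

lemma vadd_cancel_eq:
  assumes "x \<in> vals" "y \<in> vals" "g \<in> carrier G" "vadd G (Some g) x = vadd G (Some g) y"
  shows "x = y"
proof -
  have "vle G (vadd G (Some g) x) (vadd G (Some g) x)"
    by (rule vle_refl, rule vadd_closed) (use assms in auto)
  then have "vle G x y" "vle G y x" using vadd_cancel assms by metis+
  then show ?thesis using vle_antisym assms by blast
qed

lemma is_vmin_unique:
  assumes "S \<subseteq> vals" "is_vmin G x S" "is_vmin G y S"
  shows "x = y"
  using assms vle_antisym[of x y] by (auto simp: is_vmin_def subset_iff)

end


section \<open>Valuations as preorders\<close>

text \<open>
  The comparison \<open>v a \<le> v b\<close> without the value group.  Values become field elements up to \<open>\<approx>\<close>, and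
  arithmetic with values becomes multiplication: \<open>a * g ^ i\<close> stands for \<open>v a + i * v g\<close>.  Larger
  means closer to \<open>0\<close>, the top element.
\<close>

locale valuation_preorder =
  fixes le :: "'f::field \<Rightarrow> 'f \<Rightarrow> bool" (infix "\<preceq>" 50)
  assumes le_total: "a \<preceq> b \<or> b \<preceq> a"
    and le_trans [trans]: "a \<preceq> b \<Longrightarrow> b \<preceq> c \<Longrightarrow> a \<preceq> c"
    and le_mult: "a \<preceq> b \<Longrightarrow> c * a \<preceq> c * b"
    and le_zero [simp]: "a \<preceq> 0"
    and zero_le: "0 \<preceq> a \<Longrightarrow> a = 0"
    and le_add1: "a \<preceq> b \<Longrightarrow> a \<preceq> a + b"
begin

definition lt :: "'f \<Rightarrow> 'f \<Rightarrow> bool" (infix "\<prec>" 50) where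
  "a \<prec> b \<longleftrightarrow> \<not> b \<preceq> a"

definition eqv :: "'f \<Rightarrow> 'f \<Rightarrow> bool" (infix "\<approx>" 50) where
  "a \<approx> b \<longleftrightarrow> a \<preceq> b \<and> b \<preceq> a"

lemma le_refl [simp]: "a \<preceq> a"
  using le_total by blast

lemma lt_irrefl [simp]: "\<not> a \<prec> a"
  by (simp add: lt_def)

lemma zero_le_iff [simp]: "0 \<preceq> a \<longleftrightarrow> a = 0"
  using zero_le by auto

lemma lt_zero_iff [simp]: "a \<prec> 0 \<longleftrightarrow> a \<noteq> 0"
  by (simp add: lt_def)

lemma not_zero_lt [simp]: "\<not> 0 \<prec> a"
  by (simp add: lt_def)

lemma lt_imp_nonzero: "a \<prec> b \<Longrightarrow> a \<noteq> 0"
  by (auto simp: lt_def)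

lemma lt_imp_le: "a \<prec> b \<Longrightarrow> a \<preceq> b"
  using le_total by (auto simp: lt_def)

lemma eqv_refl [simp]: "a \<approx> a"
  by (simp add: eqv_def)

lemma eqv_sym: "a \<approx> b \<Longrightarrow> b \<approx> a"
  by (simp add: eqv_def)

lemma eqv_commute: "a \<approx> b \<longleftrightarrow> b \<approx> a"
  by (auto simp: eqv_def)

lemma eqv_trans [trans]: "a \<approx> b \<Longrightarrow> b \<approx> c \<Longrightarrow> a \<approx> c"
  unfolding eqv_def using le_trans by blast

lemma lt_trans [trans]: "a \<prec> b \<Longrightarrow> b \<prec> c \<Longrightarrow> a \<prec> c"
  unfolding lt_def using le_total le_trans by blast

lemma le_lt_trans [trans]: "a \<preceq> b \<Longrightarrow> b \<prec> c \<Longrightarrow> a \<prec> c"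
  unfolding lt_def using le_trans by blast

lemma lt_le_trans [trans]: "a \<prec> b \<Longrightarrow> b \<preceq> c \<Longrightarrow> a \<prec> c"
  unfolding lt_def using le_trans by blast

lemma eqv_le_trans [trans]: "a \<approx> b \<Longrightarrow> b \<preceq> c \<Longrightarrow> a \<preceq> c"
  unfolding eqv_def using le_trans by blast

lemma le_eqv_trans [trans]: "a \<preceq> b \<Longrightarrow> b \<approx> c \<Longrightarrow> a \<preceq> c"
  unfolding eqv_def using le_trans by blast

lemma eqv_lt_trans [trans]: "a \<approx> b \<Longrightarrow> b \<prec> c \<Longrightarrow> a \<prec> c"
  unfolding eqv_def using le_lt_trans by blast

lemma lt_eqv_trans [trans]: "a \<prec> b \<Longrightarrow> b \<approx> c \<Longrightarrow> a \<prec> c"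
  unfolding eqv_def using lt_le_trans by blast

lemma eqv_zero_iff [simp]: "a \<approx> 0 \<longleftrightarrow> a = 0" "0 \<approx> a \<longleftrightarrow> a = 0"
  by (auto simp: eqv_def)

lemma eqv_imp_zero_iff: "a \<approx> b \<Longrightarrow> a = 0 \<longleftrightarrow> b = 0"
  by auto

lemma lt_or_eqv_or_gt: "a \<prec> b \<or> a \<approx> b \<or> b \<prec> a"
  by (auto simp: lt_def eqv_def)

lemma le_cases: "a \<preceq> b \<longleftrightarrow> a \<prec> b \<or> a \<approx> b"
  using lt_imp_le by (auto simp: lt_def eqv_def)

lemma le_mult_iff: "c \<noteq> 0 \<Longrightarrow> c * a \<preceq> c * b \<longleftrightarrow> a \<preceq> b"
  using le_mult[of "c * a" "c * b" "inverse c"] le_mult[of a b c]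
  by (auto simp: mult.assoc[symmetric])

lemma le_mult_iff': "c \<noteq> 0 \<Longrightarrow> a * c \<preceq> b * c \<longleftrightarrow> a \<preceq> b"
  by (simp add: mult.commute[of _ c] le_mult_iff)

lemma lt_mult_iff: "c \<noteq> 0 \<Longrightarrow> c * a \<prec> c * b \<longleftrightarrow> a \<prec> b"
  by (simp add: lt_def le_mult_iff)

lemma lt_mult_iff': "c \<noteq> 0 \<Longrightarrow> a * c \<prec> b * c \<longleftrightarrow> a \<prec> b"
  by (simp add: lt_def le_mult_iff')

lemma le_mult_mono: "a \<preceq> b \<Longrightarrow> c \<preceq> d \<Longrightarrow> a * c \<preceq> b * d"
  using le_trans[of "c * a" "c * b" "b * d"] le_mult[of a b c] le_mult[of c d b]
  by (simp add: mult.commute)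

lemma eqv_mult: "a \<approx> b \<Longrightarrow> c \<approx> d \<Longrightarrow> a * c \<approx> b * d"
  by (simp add: eqv_def le_mult_mono)

lemma lt_le_mult: "a \<prec> b \<Longrightarrow> c \<preceq> d \<Longrightarrow> c \<noteq> 0 \<Longrightarrow> a * c \<prec> b * d"
proof -
  assume *: "a \<prec> b" "c \<preceq> d" "c \<noteq> 0"
  then have "a * c \<prec> b * c" by (simp add: lt_mult_iff')
  also have "b * c \<preceq> b * d" using * le_mult by blast
  finally show ?thesis .
qed

lemma le_lt_mult: "a \<preceq> b \<Longrightarrow> c \<prec> d \<Longrightarrow> a \<noteq> 0 \<Longrightarrow> a * c \<prec> b * d"
  using lt_le_mult[of c d a b] by (simp add: mult.commute)

lemma le_power: "a \<preceq> b \<Longrightarrow> a ^ n \<preceq> b ^ n"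
  by (induction n) (auto intro: le_mult_mono)

lemma eqv_power: "a \<approx> b \<Longrightarrow> a ^ n \<approx> b ^ n"
  by (simp add: eqv_def le_power)

lemma lt_power: "a \<prec> b \<Longrightarrow> n > 0 \<Longrightarrow> a ^ n \<prec> b ^ n"
proof (cases n)
  case (Suc m)
  assume "a \<prec> b"
  then show ?thesis
    using lt_le_mult[OF _ le_power[of a b m]] lt_imp_le lt_imp_nonzero by (simp add: Suc)
qed simp

lemma le_add: "a \<preceq> b \<Longrightarrow> a \<preceq> c \<Longrightarrow> a \<preceq> b + c"
  using le_total[of b c] le_add1[of b c] le_add1[of c b] le_trans[of a b "b + c"] le_trans[of a c "b + c"]
  by (auto simp: add.commute)

lemma minus_eqv [simp]: "- a \<approx> a"
proof -
  have *: "1 \<approx> -1"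
    using le_total[of 1 "-1"] le_mult[of 1 "-1" "-1"] le_mult[of "-1" 1 "-1"] by (auto simp: eqv_def)
  show ?thesis using eqv_mult[OF * eqv_refl[of a]] by (simp add: eqv_commute)
qed

lemma minus_le [simp]: "- a \<preceq> b \<longleftrightarrow> a \<preceq> b" "a \<preceq> - b \<longleftrightarrow> a \<preceq> b"
  using le_trans[of "- a" a b] le_trans[of a "- a" b] le_trans[of a b "- b"] le_trans[of a "- b" b]
    minus_eqv[of a] minus_eqv[of b] unfolding eqv_def by blast+

lemma minus_lt [simp]: "- a \<prec> b \<longleftrightarrow> a \<prec> b" "a \<prec> - b \<longleftrightarrow> a \<prec> b"
  by (simp_all add: lt_def)

lemma minus_eqv_iff [simp]: "- a \<approx> b \<longleftrightarrow> a \<approx> b" "a \<approx> - b \<longleftrightarrow> a \<approx> b"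
  by (simp_all add: eqv_def)

lemma minus_commute_le: "a - b \<preceq> c \<longleftrightarrow> b - a \<preceq> c" "c \<preceq> a - b \<longleftrightarrow> c \<preceq> b - a"
  using minus_le[of "a - b" c] minus_le[of c "a - b"] by auto

lemma minus_commute_lt: "a - b \<prec> c \<longleftrightarrow> b - a \<prec> c" "c \<prec> a - b \<longleftrightarrow> c \<prec> b - a"
  by (simp_all add: lt_def minus_commute_le)

lemma le_diff: "a \<preceq> b \<Longrightarrow> a \<preceq> c \<Longrightarrow> a \<preceq> b - c"
  using le_add[of a b "- c"] by simp

lemma lt_add: "a \<prec> b \<Longrightarrow> a \<prec> c \<Longrightarrow> a \<prec> b + c"
  using le_total[of b c] le_add[of b b c] le_add[of c b c] lt_le_trans[of a b "b + c"]
    lt_le_trans[of a c "b + c"] by auto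

lemma lt_diff: "a \<prec> b \<Longrightarrow> a \<prec> c \<Longrightarrow> a \<prec> b - c"
  using lt_add[of a b "- c"] by simp

lemma lt_add_eqv: "a \<prec> b \<Longrightarrow> a + b \<approx> a"
proof -
  assume *: "a \<prec> b"
  then have "a \<preceq> a + b" by (simp add: le_add1 lt_imp_le)
  moreover have "a + b \<preceq> a"
  proof (rule ccontr)
    assume "\<not> a + b \<preceq> a"
    then have "a \<prec> (a + b) - b" using * by (intro lt_diff) (simp_all add: lt_def)
    then show False by simp
  qed
  ultimately show ?thesis by (simp add: eqv_def)
qed

lemma lt_diff_eqv: "a \<prec> a - b \<Longrightarrow> a \<approx> b"
  using lt_add_eqv[of a "- (a - b)"] by (simp add: eqv_commute minus_commute_lt)

lemma le_sum: "(\<And>i. i \<in> I \<Longrightarrow> a \<preceq> f i) \<Longrightarrow> a \<preceq> sum f I"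
  by (induction I rule: infinite_finite_induct) (auto intro: le_add)

lemma lt_sum: "a \<noteq> 0 \<Longrightarrow> (\<And>i. i \<in> I \<Longrightarrow> a \<prec> f i) \<Longrightarrow> a \<prec> sum f I"
  by (induction I rule: infinite_finite_induct) (auto intro: lt_add)

lemma dominant_sum:
  assumes "finite I" "i \<in> I" "f i \<noteq> 0" "\<And>j. j \<in> I \<Longrightarrow> j \<noteq> i \<Longrightarrow> f i \<prec> f j"
  shows "sum f I \<approx> f i"
  using lt_add_eqv[OF lt_sum[of "f i" "I - {i}" f]] assms by (simp add: sum.remove[of I i f])

lemma least_term:
  assumes "finite I" "I \<noteq> {}"
  obtains i where "i \<in> I" "f i \<preceq> sum f I" "\<And>j. j \<in> I \<Longrightarrow> f i \<preceq> f j"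
proof -
  have "\<exists>i\<in>I. \<forall>j\<in>I. f i \<preceq> f j"
    using assms
  proof (induction rule: finite_ne_induct)
    case (insert x F)
    then obtain i where i: "i \<in> F" "\<forall>j\<in>F. f i \<preceq> f j" by blast
    show ?case
      using le_total[of "f x" "f i"]
    proof
      assume "f x \<preceq> f i"
      then show ?thesis using i le_trans[of "f x" "f i"] by (intro bexI[of _ x]) auto
    next
      assume "f i \<preceq> f x"
      then show ?thesis using i by (intro bexI[of _ i]) auto
    qed
  qed auto
  then show ?thesis using that le_sum by metis
qed

lemma le_inverse: "a \<preceq> b \<Longrightarrow> b \<noteq> 0 \<Longrightarrow> inverse b \<preceq> inverse a"
  using le_mult[of a b "inverse a * inverse b"] by (cases "a = 0") (auto simp: field_simps)

lemma eqv_inverse: "a \<approx> b \<Longrightarrow> inverse a \<approx> inverse b"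
  using le_inverse[of a b] le_inverse[of b a] by (cases "a = 0"; cases "b = 0") (auto simp: eqv_def)

lemma eqv_divide: "a \<approx> b \<Longrightarrow> c \<approx> d \<Longrightarrow> a / c \<approx> b / d"
  by (simp add: divide_inverse eqv_mult eqv_inverse)

lemma divide_le_divide_iff:
  assumes "b \<noteq> 0" "d \<noteq> 0"
  shows "a / b \<preceq> c / d \<longleftrightarrow> a * d \<preceq> c * b"
  using le_mult_iff[of "b * d" "a / b" "c / d"] assms by (simp add: mult_ac)

end

definition value_le :: "'g ogroup \<Rightarrow> ('f::field \<Rightarrow> 'g option) \<Rightarrow> 'f \<Rightarrow> 'f \<Rightarrow> bool" where
  "value_le G v a b \<longleftrightarrow> vle G (v a) (v b)"

lemma valuationD:
  assumes "valuation G v"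
  shows "ordered_abelian_group G" "v a \<in> insert None (Some ` carrier G)" "v a = None \<longleftrightarrow> a = 0"
    "v (a * b) = vadd G (v a) (v b)"
proof -
  note v = assms[unfolded valuation_def]
  show "ordered_abelian_group G" using v by (rule conjunct1)
  show "v a = None \<longleftrightarrow> a = 0"
    using v[THEN conjunct2, THEN conjunct2, THEN conjunct1] by (rule spec)
  show "v (a * b) = vadd G (v a) (v b)"
    using v[THEN conjunct2, THEN conjunct2, THEN conjunct2, THEN conjunct1] by (elim allE)
  show "v a \<in> insert None (Some ` carrier G)"
    using v[THEN conjunct2, THEN conjunct1] by (cases "v a") auto
qed

lemma valuation_imp_preorder:
  assumes v: "valuation G v"
  shows "valuation_preorder (value_le G v)"
proof -
  interpret ordered_abelian_group G by (rule valuationD(1)[OF v])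
  note car = valuationD(2)[OF v]
  show ?thesis
  proof
    fix a b c
    show "value_le G v a b \<or> value_le G v b a"
      unfolding value_le_def using vle_total[of "v a" "v b"] car[of a] car[of b] by blast
    show "value_le G v a c" if "value_le G v a b" "value_le G v b c"
      using that vle_trans[of "v a" "v b" "v c"] car[of a] car[of b] car[of c]
      unfolding value_le_def by blast
    show "value_le G v (c * a) (c * b)" if "value_le G v a b"
      using that vadd_mono[of "v a" "v b" "v c"] car[of a] car[of b] car[of c]
      unfolding value_le_def valuationD(4)[OF v] by blast
    show "value_le G v a 0"
      using valuationD(3)[OF v, of 0] by (simp add: value_le_def)
    show "a = 0" if "value_le G v 0 a"
      using that valuationD(3)[OF v, of 0] valuationD(3)[OF v, of a]
      by (cases "v a") (auto simp: value_le_def)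
    show "value_le G v a (a + b)" if "value_le G v a b"
    proof -
      have "vle G (v a) (v (a + b)) \<or> vle G (v b) (v (a + b))" using v by (simp add: valuation_def)
      then show ?thesis
      using that vle_trans[of "v a" "v b" "v (a + b)"] car[of a] car[of b] car[of "a + b"]
      unfolding value_le_def by blast
    qed
  qed
qed

lemma eqv_iff_value_eq:
  assumes "valuation G v"
  shows "valuation_preorder.eqv (value_le G v) a b \<longleftrightarrow> v a = v b"
proof -
  interpret ordered_abelian_group G by (rule valuationD(1)[OF assms])
  interpret valuation_preorder "value_le G v" by (rule valuation_imp_preorder[OF assms])
  show ?thesis
    unfolding eqv_def value_le_def
    using vle_antisym[of "v a" "v b"] vle_refl[of "v b"] valuationD(2)[OF assms, of a]
      valuationD(2)[OF assms, of b] by metis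
qed

lemma valuation_one: "valuation G v \<Longrightarrow> v 1 = Some \<one>\<^bsub>G\<^esub>"
proof -
  assume v: "valuation G v"
  interpret ordered_abelian_group G by (rule valuationD(1)[OF v])
  obtain g where g: "v 1 = Some g" using valuationD(3)[OF v, of 1] by auto
  then have "g \<in> carrier G" using valuationD(2)[OF v, of 1] by auto
  moreover have "g \<otimes>\<^bsub>G\<^esub> g = g" using valuationD(4)[OF v, of 1 1] g by simp
  ultimately show ?thesis using g l_cancel_one by auto
qed

lemma valuation_power:
  assumes v: "valuation G v" and "v a = Some g"
  shows "v (a ^ n) = Some (g [^]\<^bsub>G\<^esub> n)"
proof -
  interpret ordered_abelian_group G by (rule valuationD(1)[OF v])
  have "g \<in> carrier G" using valuationD(2)[OF v, of a] assms by auto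
  then show ?thesis
  proof (induction n)
    case 0
    then show ?case by (simp add: valuation_one[OF v])
  next
    case (Suc n)
    have "v (a ^ Suc n) = vadd G (v (a ^ n)) (v a)"
      using valuationD(4)[OF v, of "a ^ n" a] by (simp only: power_Suc2)
    also have "\<dots> = Some (g [^]\<^bsub>G\<^esub> Suc n)" using Suc \<open>v a = Some g\<close> by simp
    finally show ?case .
  qed
qed

text \<open>
  All the notions below that compare values -- the approximation type, being value-transcendental
  and so on -- only depend on the preorder, and equivalence of valuations is equality of preorders.
  So the value group itself need only be handled where a valuation is constructed.
\<close>

lemma equivalent_ext_imp_value_le_eq:
  assumes eq: "equivalent_ext G v H w"
  shows "value_le G v = value_le H w"
proof (intro ext)
  fix a b
  obtain \<phi> where phi: "group_order_iso (value_group G v) (value_group H w) \<phi>"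
    "\<And>f. w f = map_option \<phi> (v f)"
    using eq unfolding equivalent_ext_def by blast
  have *: "ord_le G g h \<longleftrightarrow> ord_le H (\<phi> g) (\<phi> h)" if "v a = Some g" "v b = Some h" for g h
  proof -
    have "g \<in> carrier (value_group G v)" "h \<in> carrier (value_group G v)"
      using that by (auto simp: value_group_def values_of_def)
    then show ?thesis
      using phi(1) by (simp add: group_order_iso_def group_order_embedding_def value_group_def)
  qed
  show "value_le G v a b = value_le H w a b"
    using * by (cases "v a"; cases "v b") (auto simp: value_le_def phi(2))
qed

text \<open>
  The isomorphism sends \<open>v f\<close> to \<open>w f\<close>; it is well defined, injective and monotone because both
  valuations order the field in the same way.
\<close>

lemma value_le_eq_imp_equivalent_ext:
  assumes v: "valuation G v" and w: "valuation H w" and eq: "value_le G v = value_le H w"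
  shows "equivalent_ext G v H w"
proof -
  have same: "v a = v b \<longleftrightarrow> w a = w b" for a b
    using eqv_iff_value_eq[OF v, of a b] eqv_iff_value_eq[OF w, of a b] eq by simp
  define \<phi> where "\<phi> g = the (w (SOME a. v a = Some g))" for g
  have w_phi: "w f = map_option \<phi> (v f)" for f
  proof (cases "v f")
    case None
    then show ?thesis using valuationD(3)[OF v, of f] valuationD(3)[OF w, of f] by simp
  next
    case (Some g)
    have "v (SOME a. v a = Some g) = Some g" by (rule someI[of _ f], rule Some)
    then have "w (SOME a. v a = Some g) = w f" using Some same by metis
    moreover have "w f \<noteq> None" using Some valuationD(3)[OF v, of f] valuationD(3)[OF w, of f] by simp
    ultimately show ?thesis by (auto simp: Some \<phi>_def)
  qed
  let ?V = "value_group G v" and ?W = "value_group H w"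
  have rep: "\<exists>a. v a = Some g \<and> w a = Some (\<phi> g)" if "g \<in> carrier ?V" for g
    using that w_phi by (auto simp: value_group_def values_of_def)
  have "\<phi> \<in> hom ?V ?W"
  proof (rule homI)
    fix g h assume "g \<in> carrier ?V" "h \<in> carrier ?V"
    then obtain a b where ab: "v a = Some g" "w a = Some (\<phi> g)" "v b = Some h" "w b = Some (\<phi> h)"
      using rep by meson
    show "\<phi> g \<in> carrier ?W" using ab by (auto simp: value_group_def values_of_def)
    have "w (a * b) = map_option \<phi> (v (a * b))" by (rule w_phi)
    then show "\<phi> (g \<otimes>\<^bsub>?V\<^esub> h) = \<phi> g \<otimes>\<^bsub>?W\<^esub> \<phi> h"
      using valuationD(4)[OF v, of a b] valuationD(4)[OF w, of a b] ab by (simp add: value_group_def)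
  qed
  moreover have "inj_on \<phi> (carrier ?V)"
  proof (rule inj_onI)
    fix g h assume "g \<in> carrier ?V" "h \<in> carrier ?V" and gh: "\<phi> g = \<phi> h"
    then obtain a b where "v a = Some g" "w a = Some (\<phi> g)" "v b = Some h" "w b = Some (\<phi> h)"
      using rep by meson
    then show "g = h" using same[of a b] gh by simp
  qed
  moreover have "\<phi> ` carrier ?V = carrier ?W"
    using w_phi by (force simp: value_group_def values_of_def)
  moreover have "ord_le ?V g h \<longleftrightarrow> ord_le ?W (\<phi> g) (\<phi> h)" if gh: "g \<in> carrier ?V" "h \<in> carrier ?V" for g h
  proof -
    obtain a b where "v a = Some g" "w a = Some (\<phi> g)" "v b = Some h" "w b = Some (\<phi> h)"
      using rep gh by meson
    then show ?thesis using fun_cong[OF fun_cong[OF eq], of a b] by (simp add: value_le_def value_group_def)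
  qed
  ultimately have "group_order_iso ?V ?W \<phi>"
    by (simp add: group_order_iso_def group_order_embedding_def iso_def bij_betw_def)
  then show ?thesis using w_phi unfolding equivalent_ext_def by blast
qed

lemma const_simps [simp]:
  "const 0 = 0" "const 1 = 1" "const (a + b) = const a + const b" "const (a * b) = const a * const b"
  "const (- a) = - const a" "const (a - b) = const a - const b"
  by (simp_all add: const_def Zero_fract_def One_fract_def pCons_one mult.commute)

lemma const_power [simp]: "const (a ^ n) = const a ^ n"
  by (induction n) simp_all

lemma const_eq_iff [simp]: "const a = const b \<longleftrightarrow> a = b"
  by (simp add: const_def eq_fract)

lemma const_eq_0_iff [simp]: "const a = 0 \<longleftrightarrow> a = 0"
  using const_eq_iff[of a 0] by (simp del: const_eq_iff)

lemma const_inverse [simp]: "const (inverse a) = inverse (const a)"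
proof (cases "a = 0")
  case False
  then have "const a * const (inverse a) = 1" by (simp del: const_simps(4) add: const_simps(4)[symmetric])
  then show ?thesis using False by (simp add: field_simps inverse_unique)
qed simp

lemma const_divide [simp]: "const (a / b) = const a / const b"
  by (simp add: divide_inverse)

definition of_poly :: "'k::field poly \<Rightarrow> 'k ratfun" where
  "of_poly p = Fract p 1"

lemma of_poly_simps [simp]:
  "of_poly 0 = 0" "of_poly 1 = 1" "of_poly (p + q) = of_poly p + of_poly q"
  "of_poly (p * q) = of_poly p * of_poly q"
  "of_poly (- p) = - of_poly p" "of_poly (p - q) = of_poly p - of_poly q"
  by (simp_all add: of_poly_def Zero_fract_def One_fract_def)

lemma of_poly_power [simp]: "of_poly (p ^ n) = of_poly p ^ n"
  by (induction n) simp_all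

lemma of_poly_sum [simp]: "of_poly (sum p I) = (\<Sum>i\<in>I. of_poly (p i))"
  by (induction I rule: infinite_finite_induct) simp_all

lemma of_poly_const [simp]: "of_poly [:c:] = const c"
  by (simp add: of_poly_def const_def)

lemma of_poly_X: "of_poly [:0, 1:] = ratX"
  by (simp add: of_poly_def ratX_def)

lemma of_poly_linear [simp]: "of_poly [:- c, 1:] = ratX - const c"
proof -
  have "[:- c, 1:] = [:0, 1:] - [:c:]" by simp
  then show ?thesis by (simp only: of_poly_simps of_poly_X of_poly_const)
qed

lemma of_poly_pCons: "of_poly (pCons a p) = const a + ratX * of_poly p"
proof -
  have "pCons a p = [:a:] + [:0, 1:] * p" by simp
  then show ?thesis by (simp only: of_poly_simps of_poly_X of_poly_const)
qed

lemma of_poly_eq_iff [simp]: "of_poly p = of_poly q \<longleftrightarrow> p = q"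
  by (simp add: of_poly_def eq_fract)

lemma of_poly_eq_0_iff [simp]: "of_poly p = 0 \<longleftrightarrow> p = 0"
  using of_poly_eq_iff[of p 0] by (simp del: of_poly_eq_iff)

lemma ratfun_cases:
  obtains p q where "q \<noteq> 0" "f = of_poly p / of_poly q"
  by (cases f rule: Fract_cases) (auto simp: of_poly_def)

text \<open>
  Quotients are compared by cross multiplication, so a valuation of \<open>K(x)\<close> is determined, up to
  equivalence, by how it compares polynomials.
\<close>

lemma value_le_eqI_poly:
  fixes le1 le2 :: "'a::field ratfun \<Rightarrow> 'a ratfun \<Rightarrow> bool"
  assumes "valuation_preorder le1" "valuation_preorder le2"
    and poly: "\<And>p q. le1 (of_poly p) (of_poly q) \<longleftrightarrow> le2 (of_poly p) (of_poly q)"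
  shows "le1 = le2"
proof (intro ext)
  fix f g :: "'a ratfun"
  obtain p q where pq: "q \<noteq> 0" "f = of_poly p / of_poly q" by (rule ratfun_cases)
  obtain r s where rs: "s \<noteq> 0" "g = of_poly r / of_poly s" by (rule ratfun_cases)
  show "le1 f g = le2 f g"
    using valuation_preorder.divide_le_divide_iff[OF assms(1), of "of_poly q" "of_poly s" "of_poly p" "of_poly r"]
      valuation_preorder.divide_le_divide_iff[OF assms(2), of "of_poly q" "of_poly s" "of_poly p" "of_poly r"]
      poly[of "p * s" "r * q"] pq rs by simp
qed

lemma extension_value_le:
  assumes v0: "valuation G0 v0" and ext: "extension G0 v0 G v"
  shows "value_le G v (const a) (const b) \<longleftrightarrow> value_le G0 v0 a b"
proof -
  obtain \<iota> where iota: "group_order_embedding (value_group G0 v0) G \<iota>"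
    "\<And>c. v (const c) = map_option \<iota> (v0 c)"
    using ext unfolding extension_def by blast
  have *: "ord_le G0 g h \<longleftrightarrow> ord_le G (\<iota> g) (\<iota> h)" if "v0 a = Some g" "v0 b = Some h" for g h
  proof -
    have "g \<in> carrier (value_group G0 v0)" "h \<in> carrier (value_group G0 v0)"
      using that by (auto simp: value_group_def values_of_def)
    then show ?thesis using iota(1) by (simp add: group_order_embedding_def value_group_def)
  qed
  show ?thesis
    using * by (cases "v0 a"; cases "v0 b") (auto simp: value_le_def iota(2))
qed

section \<open>Valuations on polynomials and on rational functions\<close>

definition poly_valuation :: "'g ogroup \<Rightarrow> ('k::field poly \<Rightarrow> 'g option) \<Rightarrow> bool" where
  "poly_valuation G w \<longleftrightarrow> ordered_abelian_group G
     \<and> (\<forall>p. w p \<in> insert None (Some ` carrier G))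
     \<and> (\<forall>p. w p = None \<longleftrightarrow> p = 0)
     \<and> (\<forall>p q. w (p * q) = vadd G (w p) (w q))
     \<and> (\<forall>p q. vle G (w p) (w (p + q)) \<or> vle G (w q) (w (p + q)))"

lemma poly_valuationD:
  assumes "poly_valuation G w"
  shows "ordered_abelian_group G" "w p \<in> insert None (Some ` carrier G)" "w p = None \<longleftrightarrow> p = 0"
    "w (p * q) = vadd G (w p) (w q)" "vle G (w p) (w (p + q)) \<or> vle G (w q) (w (p + q))"
proof -
  note w = assms[unfolded poly_valuation_def]
  show "ordered_abelian_group G" using w by (rule conjunct1)
  show "w p \<in> insert None (Some ` carrier G)" using w[THEN conjunct2, THEN conjunct1] by (rule spec)
  show "w p = None \<longleftrightarrow> p = 0"
    using w[THEN conjunct2, THEN conjunct2, THEN conjunct1] by (rule spec)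
  show "w (p * q) = vadd G (w p) (w q)"
    using w[THEN conjunct2, THEN conjunct2, THEN conjunct2, THEN conjunct1] by (elim allE)
  show "vle G (w p) (w (p + q)) \<or> vle G (w q) (w (p + q))"
    using w[THEN conjunct2, THEN conjunct2, THEN conjunct2, THEN conjunct2] by (elim allE)
qed

text \<open>
  The extension is \<open>v (p / q) = w p - w q\<close>; multiplicativity of \<open>w\<close> makes this independent of the
  representation.
\<close>

lemma poly_valuation_extends:
  fixes G (structure) and w :: "'k::field poly \<Rightarrow> 'g option"
  assumes w: "poly_valuation G w"
  shows "\<exists>v :: 'k ratfun \<Rightarrow> 'g option. valuation G v \<and> (\<forall>p. v (of_poly p) = w p)"
proof -
  interpret ordered_abelian_group G by (rule poly_valuationD(1)[OF w])
  define neg :: "'g option \<Rightarrow> 'g option" where "neg = map_option (\<lambda>g. inv g)"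
  have wV: "w p \<in> vals" for p by (rule poly_valuationD(2)[OF w])
  have negV: "neg (w p) \<in> vals" for p using wV[of p] by (auto simp: neg_def)
  have neg_cancel: "vadd G (w p) (neg (w p)) = Some \<one>" if "p \<noteq> 0" for p
    using wV[of p] poly_valuationD(3)[OF w, of p] that by (auto simp: neg_def)
  have wmul: "w (p * q) = vadd G (w p) (w q)" for p q by (rule poly_valuationD(4)[OF w])
  have quot_eq: "vadd G (w p) (neg (w q)) = vadd G (w r) (neg (w s))"
    if "q \<noteq> 0" "s \<noteq> 0" "p * s = r * q" for p q r s
  proof -
    have "vadd G (w p) (w s) = vadd G (w r) (w q)" using that(3) wmul by metis
    moreover have "vadd G (w p) (neg (w q)) = vadd G (vadd G (w p) (w s)) (vadd G (neg (w s)) (neg (w q)))"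
    proof -
      have "vadd G (vadd G (w p) (w s)) (vadd G (neg (w s)) (neg (w q)))
          = vadd G (w p) (vadd G (vadd G (w s) (neg (w s))) (neg (w q)))"
        using wV[of p] wV[of s] negV[of s] negV[of q]
        by (simp only: vadd_assoc vadd_closed)
      then show ?thesis using neg_cancel[OF that(2)] negV[of q] by (simp only: vadd_zero)
    qed
    moreover have "vadd G (w r) (neg (w s)) = vadd G (vadd G (w r) (w q)) (vadd G (neg (w s)) (neg (w q)))"
    proof -
      have "vadd G (vadd G (w r) (w q)) (vadd G (neg (w s)) (neg (w q)))
          = vadd G (w r) (vadd G (neg (w s)) (vadd G (w q) (neg (w q))))"
        using wV[of r] wV[of q] negV[of s] negV[of q]
        by (simp only: vadd_assoc vadd_closed vadd_left_comm)
      then show ?thesis using neg_cancel[OF that(1)] negV[of s] by (simp only: vadd_zero)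
    qed
    ultimately show ?thesis by simp
  qed
  define v :: "'k ratfun \<Rightarrow> 'g option" where
    "v f = (let pq = SOME pq. snd pq \<noteq> 0 \<and> f = of_poly (fst pq) / of_poly (snd pq)
            in vadd G (w (fst pq)) (neg (w (snd pq))))" for f
  have v_quot: "v (of_poly p / of_poly q) = vadd G (w p) (neg (w q))" if "q \<noteq> 0" for p q
  proof -
    let ?P = "\<lambda>pq. snd pq \<noteq> 0 \<and> of_poly p / of_poly q = (of_poly (fst pq) / of_poly (snd pq) :: 'k ratfun)"
    have "?P (p, q)" using that by simp
    define rs where "rs = Eps ?P"
    have S: "?P rs" unfolding rs_def by (rule someI[of ?P, OF \<open>?P (p, q)\<close>])
    then have "of_poly p * of_poly (snd rs) = (of_poly (fst rs) * of_poly q :: 'k ratfun)"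
      using that frac_eq_eq[of "of_poly q :: 'k ratfun" "of_poly (snd rs)" "of_poly p" "of_poly (fst rs)"]
      by simp
    then have "p * snd rs = fst rs * q"
      by (simp only: of_poly_simps(4)[symmetric] of_poly_eq_iff)
    then have "vadd G (w p) (neg (w q)) = vadd G (w (fst rs)) (neg (w (snd rs)))"
      using S that by (intro quot_eq) auto
    then show ?thesis unfolding v_def rs_def[symmetric] Let_def by simp
  qed
  have v_poly: "v (of_poly p) = w p" for p
  proof -
    have "w 1 = Some \<one>"
      using wmul[of 1 1] wV[of 1] poly_valuationD(3)[OF w, of 1] by (auto simp: l_cancel_one)
    then have "neg (w 1) = Some \<one>" by (simp add: neg_def)
    then show ?thesis using v_quot[of 1 p] wV[of p] by (simp add: vadd_zero)
  qed
  have "valuation G v"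
    unfolding valuation_def
  proof (intro conjI allI)
    show "ordered_abelian_group G" by (rule ordered_abelian_group_axioms)
    fix f g :: "'k ratfun"
    obtain p q where pq: "q \<noteq> 0" "f = of_poly p / of_poly q" by (rule ratfun_cases)
    obtain r s where rs: "s \<noteq> 0" "g = of_poly r / of_poly s" by (rule ratfun_cases)
    have negN: "neg (w q) \<noteq> None" using pq(1) poly_valuationD(3)[OF w, of q] by (simp add: neg_def)
    show "v f = Some g \<longrightarrow> g \<in> carrier G" for g
      using vadd_closed[OF wV[of p] negV[of q]] by (auto simp: pq v_quot)
    show "v f = None \<longleftrightarrow> f = 0"
      using negN poly_valuationD(3)[OF w, of p] pq(1) unfolding pq(2) v_quot[OF pq(1)] vadd_eq_None
      by (simp del: not_None_eq)
    show "v (f * g) = vadd G (v f) (v g)"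
    proof -
      have "f * g = of_poly (p * r) / of_poly (q * s)" by (simp add: pq rs)
      then have "v (f * g) = vadd G (w (p * r)) (neg (w (q * s)))"
        using pq rs v_quot[of "q * s" "p * r"] by simp
      moreover have "neg (w (q * s)) = vadd G (neg (w q)) (neg (w s))"
        using wV[of q] wV[of s] unfolding wmul
        by (cases "w q"; cases "w s") (auto simp: neg_def inv_mult)
      ultimately show ?thesis
        using wV[of p] wV[of r] negV[of q] negV[of s]
        by (simp only: pq rs v_quot wmul vadd_ac vadd_closed not_False_eq_True)
    qed
    show "vle G (v f) (v (f + g)) \<or> vle G (v g) (v (f + g))"
    proof -
      let ?n = "neg (w (q * s))"
      have f: "v f = vadd G (w (p * s)) ?n"
        using pq rs v_quot[of "q * s" "p * s"] by simp
      have g: "v g = vadd G (w (q * r)) ?n"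
        using pq rs v_quot[of "q * s" "q * r"] by simp
      have "f + g = of_poly (p * s + q * r) / of_poly (q * s)" using pq rs by (simp add: field_simps)
      then have fg: "v (f + g) = vadd G (w (p * s + q * r)) ?n"
        using pq rs v_quot[of "q * s" "p * s + q * r"] by simp
      show ?thesis
        using poly_valuationD(5)[OF w, of "p * s" "q * r"]
      proof
        assume "vle G (w (p * s)) (w (p * s + q * r))"
        then have "vle G (v f) (v (f + g))"
          unfolding f fg by (intro vadd_mono2 vle_refl wV negV)
        then show ?thesis ..
      next
        assume "vle G (w (q * r)) (w (p * s + q * r))"
        then have "vle G (v g) (v (f + g))"
          unfolding g fg by (intro vadd_mono2 vle_refl wV negV)
        then show ?thesis ..
      qed
    qed
  qed
  then show ?thesis using v_poly by blast
qed

section \<open>Valuations with a key polynomial\<close>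

definition vmin :: "'g ogroup \<Rightarrow> 'g option \<Rightarrow> 'g option \<Rightarrow> 'g option" where
  "vmin G x y = (if vle G x y then x else y)"

context ordered_abelian_group
begin

lemma vmin_closed: "x \<in> vals \<Longrightarrow> y \<in> vals \<Longrightarrow> vmin G x y \<in> vals"
  by (simp add: vmin_def)

lemma vmin_le: 
  assumes "x \<in> vals" "y \<in> vals" 
  shows "vle G (vmin G x y) x" "vle G (vmin G x y) y"
  using vle_total[OF assms] vle_refl[OF assms(1)] vle_refl[OF assms(2)] by (auto simp: vmin_def)

lemma le_vmin: "vle G z x \<Longrightarrow> vle G z y \<Longrightarrow> vle G z (vmin G x y)"
  by (simp add: vmin_def)

end

lemma div_poly_degree:
  fixes f g :: "'k::field poly"
  assumes "Polynomial.degree f > 0" "g div f \<noteq> 0"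
  shows "Polynomial.degree (g div f) + Polynomial.degree f = Polynomial.degree g"
proof -
  have f: "f \<noteq> 0" using assms by auto
  have 1: "Polynomial.degree (g div f * f) = Polynomial.degree (g div f) + Polynomial.degree f"
    using f assms by (simp add: degree_mult_eq)
  have "Polynomial.degree (g mod f) < Polynomial.degree (g div f * f)"
    using 1 assms f degree_mod_less[of f g] by (cases "g mod f = 0") auto
  then have "Polynomial.degree (g div f * f + g mod f) = Polynomial.degree (g div f * f)"
    by (rule Polynomial.degree_add_eq_left)
  then show ?thesis by (simp add: 1)
qed

lemma div_poly_smaller:
  fixes f g :: "'k::field poly"
  assumes "Polynomial.degree f > 0"
  shows "g div f = 0 \<or> Polynomial.degree (g div f) < Polynomial.degree g"
proof (cases "g div f = 0")
  case False
  show ?thesis using div_poly_degree[OF assms False] assms by linarith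
qed simp

text \<open>
  Expand \<open>g = \<Sum>i. a i * f ^ i\<close> with digits \<open>a i\<close> of degree less than \<open>f\<close>.  Its value is the minimum
  of \<open>u (a i) + i * \<beta>\<close>; the recursion splits off the lowest digit \<open>g mod f\<close>.  For linear \<open>f\<close> this is
  a Gauss valuation, and in general it is MacLane's augmentation of \<open>u\<close> by the key polynomial \<open>f\<close>
  with value \<open>\<beta>\<close>.
\<close>

function key_val ::
    "'g ogroup \<Rightarrow> ('k::field poly \<Rightarrow> 'g option) \<Rightarrow> 'k poly \<Rightarrow> 'g \<Rightarrow> 'k poly \<Rightarrow> 'g option" where
  "key_val G u f \<beta> g =
     (if g = 0 \<or> Polynomial.degree f = 0 then None
      else vmin G (u (g mod f)) (vadd G (Some \<beta>) (key_val G u f \<beta> (g div f))))"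
  by pat_completeness auto
termination
proof (relation "measure (\<lambda>(_, _, _, _, g). if g = 0 then 0 else Suc (Polynomial.degree g))")
  fix G :: "'g ogroup" and u and f g :: "'k::field poly" and \<beta> :: 'g
  assume "\<not> (g = 0 \<or> Polynomial.degree f = 0)"
  then have "g div f = 0 \<or> Polynomial.degree (g div f) < Polynomial.degree g"
    by (intro div_poly_smaller) simp
  with \<open>\<not> _\<close> show "((G, u, f, \<beta>, g div f), G, u, f, \<beta>, g) \<in>
      measure (\<lambda>(_, _, _, _, g). if g = 0 then 0 else Suc (Polynomial.degree g))"
    by auto
qed simp

declare key_val.simps [simp del]

text \<open>
  Only the values of \<open>u\<close> on digits matter.  There \<open>u\<close> behaves like a valuation of \<open>K[x] / (f)\<close>.  The
  condition \<open>u_carry\<close> says that \<open>\<beta>\<close> is large: when a product of digits is reduced, the carry into the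
  next digit does not lower the value of the product.
\<close>

locale key_polynomial = ordered_abelian_group G for G :: "'g ogroup" (structure) +
  fixes u :: "'k::field poly \<Rightarrow> 'g option" and f :: "'k poly" and \<beta> :: 'g
  assumes deg_f: "Polynomial.degree f > 0"
    and beta: "\<beta> \<in> carrier G"
    and u_closed: "u a \<in> insert None (Some ` carrier G)"
    and u_eq_None: "Polynomial.degree a < Polynomial.degree f \<Longrightarrow> u a = None \<longleftrightarrow> a = 0"
    and u_add: "\<lbrakk>Polynomial.degree a < Polynomial.degree f; Polynomial.degree b < Polynomial.degree f\<rbrakk>
                  \<Longrightarrow> vle G (u a) (u (a + b)) \<or> vle G (u b) (u (a + b))"
    and u_mult: "\<lbrakk>Polynomial.degree a < Polynomial.degree f; Polynomial.degree b < Polynomial.degree f\<rbrakk>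
                  \<Longrightarrow> u ((a * b) mod f) = vadd G (u a) (u b)"
    and u_carry: "\<lbrakk>Polynomial.degree a < Polynomial.degree f; Polynomial.degree b < Polynomial.degree f\<rbrakk>
                  \<Longrightarrow> vle G (vadd G (u a) (u b)) (vadd G (Some \<beta>) (u ((a * b) div f)))"
begin

abbreviation small :: "'k poly \<Rightarrow> bool" where
  "small a \<equiv> Polynomial.degree a < Polynomial.degree f"

abbreviation w :: "'k poly \<Rightarrow> 'g option" where
  "w \<equiv> key_val G u f \<beta>"

lemma f_nonzero: "f \<noteq> 0" using deg_f by auto

lemma small_mod [simp]: "small (g mod f)"
  using deg_f degree_mod_less'[of f g] f_nonzero by (cases "g mod f = 0") auto

lemma small_0 [simp]: "small 0" using deg_f by simp

lemma small_add [simp]: "small a \<Longrightarrow> small b \<Longrightarrow> small (a + b)"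
  by (rule Polynomial.degree_add_less)

lemma mod_small [simp]: "small a \<Longrightarrow> a mod f = a" and div_small [simp]: "small a \<Longrightarrow> a div f = 0"
  by (auto simp: mod_poly_less div_poly_less)

lemma u_0: "u 0 = None" using u_eq_None[OF small_0] by simp

lemma w_0 [simp]: "w 0 = None"
  by (simp add: key_val.simps)

lemma betaV: "Some \<beta> \<in> vals" using beta by simp

lemma uV: "u a \<in> vals" by (rule u_closed)

lemma w_unfold: "w g = vmin G (u (g mod f)) (vadd G (Some \<beta>) (w (g div f)))"
  using deg_f by (cases "g = 0") (simp_all add: key_val.simps[of G u f \<beta> g] u_0 vmin_def)

lemma w_closed: "w g \<in> vals"
proof (induction "Polynomial.degree g" arbitrary: g rule: less_induct)
  case less
  show ?case
  proof (cases "g = 0")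
    case False
    have "g div f = 0 \<or> Polynomial.degree (g div f) < Polynomial.degree g"
      by (intro div_poly_smaller deg_f)
    then have "w (g div f) \<in> vals" using less[of "g div f"] by auto
    then show ?thesis
      by (subst w_unfold) (intro vmin_closed uV vadd_closed betaV)
  qed simp
qed

lemma poly_induct [case_names zero digit]:
  assumes "P 0" "\<And>a g. small a \<Longrightarrow> P g \<Longrightarrow> P (a + f * g)"
  shows "P g"
proof (induction "Polynomial.degree g" arbitrary: g rule: less_induct)
  case less
  show ?case
  proof (cases "g = 0")
    case False
    then have "g div f = 0 \<or> Polynomial.degree (g div f) < Polynomial.degree g"
      by (intro div_poly_smaller deg_f)
    then have "P (g div f)" using less[of "g div f"] assms(1) by auto
    then have "P (g mod f + f * (g div f))" by (intro assms(2) small_mod)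
    then show ?thesis by (simp add: mult.commute)
  qed (simp add: assms(1))
qed

lemma w_digit: "small a \<Longrightarrow> w (a + f * g) = vmin G (u a) (vadd G (Some \<beta>) (w g))"
  using w_unfold[of "a + f * g"] f_nonzero by (simp add: poly_mod_add_left poly_div_add_left)

lemma w_small: "small a \<Longrightarrow> w a = u a"
  using w_digit[of a 0] by (simp add: vmin_def)

lemma w_mult_f: "w (f * g) = vadd G (Some \<beta>) (w g)"
  using w_digit[OF small_0, of g] by (cases "w g") (simp_all add: u_0 vmin_def)

lemma w_digit_le: "small a \<Longrightarrow> vle G (w (a + f * g)) (u a)"
  "small a \<Longrightarrow> vle G (w (a + f * g)) (vadd G (Some \<beta>) (w g))"
  using vmin_le[OF uV[of a] vadd_closed[OF betaV w_closed[of g]]] by (simp_all add: w_digit)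

lemma w_le_mod: "vle G (w g) (u (g mod f))"
  using w_digit_le(1)[of "g mod f" "g div f"] by (simp add: mult.commute)

lemma w_eq_None: "w g = None \<longleftrightarrow> g = 0"
proof (induction g rule: poly_induct)
  case (digit a g)
  show ?case
  proof
    assume "w (a + f * g) = None"
    then have "u a = None" "vadd G (Some \<beta>) (w g) = None"
      using w_digit_le[OF digit(1), of g] by (cases "u a"; cases "w g"; simp)+
    then show "a + f * g = 0" using digit u_eq_None by (simp add: vadd_eq_None)
  qed simp
qed simp

text \<open>
  Digits of a sum are the sums of the digits.  The bound \<open>z\<close> is arbitrary so that it can be lowered
  by \<open>\<beta>\<close> when the induction passes to the next digit.
\<close>

lemma le_w_add:
  assumes z: "z \<in> vals" and "vle G z (w g)" "vle G z (w h)"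
  shows "vle G z (w (g + h))"
  using assms
proof (induction g arbitrary: z h rule: poly_induct)
  case (digit a g)
  define b k where "b = h mod f" and "k = h div f"
  have h: "h = b + f * k" by (simp add: b_def k_def mult.commute)
  have b: "small b" by (simp add: b_def)
  have tr: "vle G z y" if "vle G z x" "vle G x y" "x \<in> vals" "y \<in> vals" for x y
    using vle_trans[OF digit.prems(1)] that by blast
  have "vle G z (u a)" "vle G z (u b)"
    using tr[OF digit.prems(2) w_digit_le(1)[OF digit(1)] w_closed uV]
      tr[OF digit.prems(3) _ w_closed uV] w_digit_le(1)[OF b] h by auto
  then have 1: "vle G z (u (a + b))"
    using u_add[OF digit(1) b] tr[of "u a" "u (a + b)"] tr[of "u b" "u (a + b)"] uV by blast
  have bV: "vadd G (Some \<beta>) (w x) \<in> vals" for x by (intro vadd_closed betaV w_closed)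
  have zg: "vle G z (vadd G (Some \<beta>) (w g))"
    using tr[OF digit.prems(2) w_digit_le(2)[OF digit(1)] w_closed bV] .
  have zk: "vle G z (vadd G (Some \<beta>) (w k))"
    using tr[OF digit.prems(3) _ w_closed bV] w_digit_le(2)[OF b] h by auto
  define z' where "z' = vadd G (Some (inv \<beta>)) z"
  have ibV: "Some (inv \<beta>) \<in> vals" using beta by simp
  have z'V: "z' \<in> vals" unfolding z'_def by (intro vadd_closed ibV digit.prems(1))
  have canc: "vadd G (Some (inv \<beta>)) (vadd G (Some \<beta>) y) = y"
    "vadd G (Some \<beta>) (vadd G (Some (inv \<beta>)) y) = y" if "y \<in> vals" for y
    using that beta by (cases y; auto simp: m_assoc[symmetric])+
  have "vle G z' (w g)" "vle G z' (w k)"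
    using vadd_mono[OF digit.prems(1) bV ibV zg] vadd_mono[OF digit.prems(1) bV ibV zk]
    unfolding z'_def canc(1)[OF w_closed] .
  then have "vle G z' (w (g + k))" by (rule digit.IH[OF z'V])
  then have 2: "vle G z (vadd G (Some \<beta>) (w (g + k)))"
    using vadd_mono[OF z'V w_closed betaV] canc(2)[OF digit.prems(1)] z'_def
    by (metis betaV)
  have "a + f * g + h = (a + b) + f * (g + k)" by (simp add: h algebra_simps)
  then show ?case using 1 2 digit(1) b by (simp only: w_digit[OF small_add[OF digit(1) b]] le_vmin)
qed simp

lemma w_add: "vle G (w g) (w (g + h)) \<or> vle G (w h) (w (g + h))"
  using vle_total[OF w_closed[of g] w_closed[of h]] le_w_add[OF w_closed[of g], of g h]
    le_w_add[OF w_closed[of h], of g h] vle_refl[OF w_closed[of g]] vle_refl[OF w_closed[of h]]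
  by blast

text \<open>
  The product of two digits has only two digits, the remainder and the carry, and by \<open>u_carry\<close> the
  remainder decides.
\<close>

lemma w_mult_small:
  assumes "small a" "small b"
  shows "w (a * b) = vadd G (u a) (u b)"
proof -
  have sm: "small ((a * b) div f)"
  proof (cases "(a * b) div f = 0")
    case False
    have "Polynomial.degree (a * b) \<le> Polynomial.degree a + Polynomial.degree b"
      by (rule Polynomial.degree_mult_le)
    moreover have "Polynomial.degree ((a * b) div f) + Polynomial.degree f \<le> Polynomial.degree (a * b)"
      using div_poly_degree[OF deg_f False] by simp
    ultimately show ?thesis using assms by linarith
  qed (simp add: deg_f)
  have "w (a * b) = vmin G (u ((a * b) mod f)) (vadd G (Some \<beta>) (u ((a * b) div f)))"
    using w_unfold[of "a * b"] w_small[OF sm] by simp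
  then show ?thesis using u_mult[OF assms] u_carry[OF assms] by (simp add: vmin_def)
qed

lemma w_mult_ge_small:
  assumes a: "small a"
  shows "vle G (vadd G (u a) (w g)) (w (a * g))"
proof (induction g rule: poly_induct)
  case zero
  show ?case by simp
next
  case (digit b g)
  have cl: "vadd G (u a) (w x) \<in> vals" for x by (intro vadd_closed uV w_closed)
  have 1: "vle G (vadd G (u a) (w (b + f * g))) (w (a * b))"
    unfolding w_mult_small[OF a digit(1)]
    by (intro vadd_mono w_closed uV w_digit_le digit(1))
  have "vle G (vadd G (u a) (w (b + f * g))) (vadd G (u a) (vadd G (Some \<beta>) (w g)))"
    by (intro vadd_mono w_closed uV vadd_closed betaV w_digit_le digit(1))
  also have "vadd G (u a) (vadd G (Some \<beta>) (w g)) = vadd G (Some \<beta>) (vadd G (u a) (w g))"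
    by (intro vadd_left_comm w_closed uV betaV)
  finally have "vle G (vadd G (u a) (w (b + f * g))) (vadd G (Some \<beta>) (vadd G (u a) (w g)))" .
  moreover have "vle G (vadd G (Some \<beta>) (vadd G (u a) (w g))) (w (f * (a * g)))"
    unfolding w_mult_f by (intro vadd_mono w_closed cl betaV digit(2))
  ultimately have 2: "vle G (vadd G (u a) (w (b + f * g))) (w (f * (a * g)))"
    by (rule vle_trans[OF cl vadd_closed[OF betaV cl] w_closed])
  have "a * (b + f * g) = a * b + f * (a * g)" by (simp add: algebra_simps)
  then show ?case using le_w_add[OF cl 1 2] by simp
qed

lemma w_mult_ge: "vle G (vadd G (w g) (w h)) (w (g * h))"
proof (induction g rule: poly_induct)
  case zero
  show ?case by simp
next
  case (digit a g)
  have cl: "vadd G (w x) (w h) \<in> vals" for x by (intro vadd_closed w_closed)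
  have "vle G (vadd G (w (a + f * g)) (w h)) (vadd G (u a) (w h))"
    by (intro vadd_mono2 w_closed uV w_digit_le vle_refl digit(1))
  then have 1: "vle G (vadd G (w (a + f * g)) (w h)) (w (a * h))"
    by (rule vle_trans[OF cl vadd_closed[OF uV w_closed] w_closed _ w_mult_ge_small[OF digit(1)]])
  have "vle G (vadd G (w (a + f * g)) (w h)) (vadd G (vadd G (Some \<beta>) (w g)) (w h))"
    by (intro vadd_mono2 w_closed uV w_digit_le vle_refl vadd_closed betaV digit(1))
  also have "vadd G (vadd G (Some \<beta>) (w g)) (w h) = vadd G (Some \<beta>) (vadd G (w g) (w h))"
    by (intro vadd_assoc betaV w_closed)
  finally have "vle G (vadd G (w (a + f * g)) (w h)) (vadd G (Some \<beta>) (vadd G (w g) (w h)))" .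
  moreover have "vle G (vadd G (Some \<beta>) (vadd G (w g) (w h))) (w (f * (g * h)))"
    unfolding w_mult_f by (intro vadd_mono w_closed cl betaV digit(2))
  ultimately have 2: "vle G (vadd G (w (a + f * g)) (w h)) (w (f * (g * h)))"
    by (rule vle_trans[OF cl vadd_closed[OF betaV cl] w_closed])
  have "(a + f * g) * h = a * h + f * (g * h)" by (simp add: algebra_simps)
  then show ?case using le_w_add[OF cl 1 2] by simp
qed


lemma w_power_mult: "w (f ^ i * g) = vadd G (Some (\<beta> [^] i)) (w g)"
proof (induction i)
  case 0
  then show ?case using w_closed[of g] by (simp add: vadd_zero)
next
  case (Suc i)
  have "w (f ^ Suc i * g) = vadd G (Some \<beta>) (w (f ^ i * g))"
    by (simp only: power_Suc mult.assoc w_mult_f)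
  also have "\<dots> = vadd G (vadd G (Some \<beta>) (Some (\<beta> [^] i))) (w g)"
    unfolding Suc by (intro vadd_assoc[symmetric] betaV w_closed) (simp add: beta)
  also have "vadd G (Some \<beta>) (Some (\<beta> [^] i)) = Some (\<beta> [^] Suc i)"
    using beta by (simp add: m_comm)
  finally show ?case .
qed

lemma small_1: "small 1" using deg_f by simp

lemma u_minus: "small a \<Longrightarrow> u (- a) = u a"
proof -
  assume a: "small a"
  have m1: "small (- 1)" using deg_f by simp
  obtain e where e: "u (- 1) = Some e" "e \<in> carrier G" using u_eq_None[OF m1] uV[of "- 1"] by auto
  obtain d where d: "u 1 = Some d" "d \<in> carrier G" using u_eq_None[OF small_1] uV[of 1] by auto
  have "u 1 = vadd G (u 1) (u 1)" "u 1 = vadd G (u (- 1)) (u (- 1))"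
    using u_mult[OF small_1 small_1] u_mult[OF m1 m1] small_1 by simp_all
  then have d1: "d = \<one>" and ee: "e \<otimes> e = \<one>" using d e by (auto simp: l_cancel_one)
  have "e = \<one>"
  proof (rule ord_antisym)
    show "ord_le G e \<one>" "ord_le G \<one> e"
      using ord_total[of e \<one>] ord_mult[of e \<one> e] ord_mult[of \<one> e e] ee e(2) by auto
  qed (use e in auto)
  then have "vadd G (u (- 1)) (u a) = u a" using e uV[of a] by (simp add: vadd_zero)
  then show ?thesis using u_mult[OF m1 a] a by simp
qed

lemma w_minus: "w (- g) = w g"
proof (induction g rule: poly_induct)
  case (digit a g)
  have "- (a + f * g) = (- a) + f * (- g)" by simp
  then show ?case using digit by (simp only: w_digit u_minus Polynomial.degree_minus)
qed simp

lemma less_w_add: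
  assumes "z \<in> vals" "\<not> vle G (w g) z" "\<not> vle G (w h) z"
  shows "\<not> vle G (w (g + h)) z"
  using w_add[of g h] vle_trans[OF w_closed w_closed assms(1)] assms(2,3) by blast

text \<open>
  Digits of value greater than the minimum, below the first one that attains it, are moved to \<open>g2\<close>.
  What remains is a power of \<open>f\<close> times a polynomial whose lowest digit attains the minimum.
\<close>

lemma initial_part:
  assumes "g \<noteq> 0"
  shows "\<exists>i g1 g2. g = f ^ i * g1 + g2 \<and> \<not> vle G (w g2) (w g) \<and> w (f ^ i * g1) = w g
           \<and> u (g1 mod f) = w g1"
  using assms
proof (induction g rule: poly_induct)
  case (digit a g)
  let ?g = "a + f * g"
  have bV: "vadd G (Some \<beta>) (w g) \<in> vals" by (intro vadd_closed betaV w_closed)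
  show ?case
  proof (cases "vle G (u a) (vadd G (Some \<beta>) (w g))")
    case True
    then have wg: "w ?g = u a" using digit(1) by (simp add: w_digit vmin_def)
    have "u (?g mod f) = u a" using digit(1) f_nonzero by (simp add: poly_mod_add_left)
    moreover have "\<not> vle G (w 0) (w ?g)"
      using digit(3) w_eq_None[of ?g] by (cases "w ?g") auto
    ultimately show ?thesis
      using wg by (intro exI[of _ 0] exI[of _ ?g] exI[of _ 0]) simp
  next
    case False
    then have wg: "w ?g = vadd G (Some \<beta>) (w g)" using digit(1) by (simp add: w_digit vmin_def)
    then have "g \<noteq> 0" using digit(3) w_eq_None[of ?g] by auto
    then obtain i g1 g2 where g: "g = f ^ i * g1 + g2" "\<not> vle G (w g2) (w g)"
      "w (f ^ i * g1) = w g" "u (g1 mod f) = w g1" using digit(2) by blast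
    have "\<not> vle G (w (f * g2)) (w ?g)"
      using g(2) vadd_cancel[OF w_closed w_closed beta] unfolding wg w_mult_f by blast
    moreover have "\<not> vle G (w a) (w ?g)"
      unfolding wg w_small[OF digit(1)] using False vle_total[OF uV bV] uV bV
      by (metis vle_antisym)
    ultimately have "\<not> vle G (w (f * g2 + a)) (w ?g)"
      by (intro less_w_add w_closed)
    moreover have "w (f ^ Suc i * g1) = w ?g"
      using g(3) by (simp only: power_Suc mult.assoc w_mult_f wg)
    moreover have "?g = f ^ Suc i * g1 + (f * g2 + a)" by (simp add: g(1) algebra_simps)
    ultimately show ?thesis using g(4) by blast
  qed
qed simp

text \<open>
  Gauss's lemma.  By \<open>initial_part\<close> both factors may be assumed to attain their value in the lowest
  digit.  The lowest digit of the product is then the reduced product of the lowest digits, and its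
  value is the sum; this is the upper bound that complements \<open>w_mult_ge\<close>.
\<close>

lemma w_mult: "w (g * h) = vadd G (w g) (w h)"
proof (cases "g = 0 \<or> h = 0")
  case True
  then show ?thesis by (auto simp: vadd_None)
next
  case False
  obtain i g1 g2 where g: "g = f ^ i * g1 + g2" "\<not> vle G (w g2) (w g)"
    "w (f ^ i * g1) = w g" "u (g1 mod f) = w g1"
    using initial_part[of g] False by blast
  obtain j h1 h2 where h: "h = f ^ j * h1 + h2" "\<not> vle G (w h2) (w h)"
    "w (f ^ j * h1) = w h" "u (h1 mod f) = w h1"
    using initial_part[of h] False by blast
  define m where "m = vadd G (w g) (w h)"
  have mV: "m \<in> vals" unfolding m_def by (intro vadd_closed w_closed)
  obtain a b where ab: "w g = Some a" "w h = Some b" "a \<in> carrier G" "b \<in> carrier G"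
    using False w_eq_None[of g] w_eq_None[of h] w_closed[of g] w_closed[of h] by auto
  have m': "m = vadd G (w h) (w g)" unfolding m_def by (intro vadd_comm w_closed)
  have tail: "\<not> vle G (w (x * y)) m"
    if "\<not> vle G (vadd G (w x) (w y)) m" for x y
    using that vle_trans[OF vadd_closed[OF w_closed w_closed] w_closed mV w_mult_ge] by blast
  have "\<not> vle G (vadd G (w h) (w g2)) m"
    using g(2) vadd_cancel[OF w_closed w_closed ab(4), of g2 g] unfolding m' ab(2) by blast
  then have "\<not> vle G (w (h * g2)) m" by (rule tail)
  moreover have "\<not> vle G (vadd G (w (f ^ i * g1)) (w h2)) m"
    using h(2) vadd_cancel[OF w_closed w_closed ab(3), of h2 h] unfolding m_def g(3) ab(1) by blast
  then have "\<not> vle G (w ((f ^ i * g1) * h2)) m" by (rule tail)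
  ultimately have R: "\<not> vle G (w (h * g2 + (f ^ i * g1) * h2)) m"
    by (intro less_w_add mV)
  have P: "vle G (w (f ^ (i + j) * (g1 * h1))) m"
  proof -
    have "vle G (w (g1 * h1)) (u ((g1 * h1) mod f))" by (rule w_le_mod)
    also have "u ((g1 * h1) mod f) = vadd G (w g1) (w h1)"
      using u_mult[of "g1 mod f" "h1 mod f"] g(4) h(4) by (simp add: mod_mult_eq)
    finally have "vle G (w (f ^ (i + j) * (g1 * h1)))
                        (vadd G (Some (\<beta> [^] (i + j))) (vadd G (w g1) (w h1)))"
      unfolding w_power_mult by (intro vadd_mono w_closed vadd_closed) (simp_all add: beta)
    also have "vadd G (Some (\<beta> [^] (i + j))) (vadd G (w g1) (w h1)) =
               vadd G (vadd G (Some (\<beta> [^] i)) (w g1)) (vadd G (Some (\<beta> [^] j)) (w h1))"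
    proof -
      have 1: "Some (\<beta> [^] (i + j)) = vadd G (Some (\<beta> [^] i)) (Some (\<beta> [^] j))"
        using beta by (simp add: nat_pow_mult)
      have 2: "Some (\<beta> [^] i) \<in> vals" "Some (\<beta> [^] j) \<in> vals" using beta by auto
      show ?thesis
        unfolding 1 using 2 w_closed[of g1] w_closed[of h1]
        by (simp only: vadd_ac vadd_closed)
    qed
    also have "\<dots> = m" using g(3) h(3) by (simp add: m_def w_power_mult)
    finally show ?thesis .
  qed
  have eq: "g * h + - (h * g2 + (f ^ i * g1) * h2) = f ^ (i + j) * (g1 * h1)"
  proof -
    have "g * h = h * g2 + (f ^ i * g1) * h" by (subst g(1)) (simp add: algebra_simps)
    also have "(f ^ i * g1) * h = (f ^ i * g1) * h2 + f ^ (i + j) * (g1 * h1)"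
      by (subst h(1)) (simp add: algebra_simps power_add)
    finally show ?thesis by simp
  qed
  have "vle G (w (g * h)) m"
    using less_w_add[OF mV, of "g * h" "- (h * g2 + (f ^ i * g1) * h2)"] R P
    unfolding eq w_minus by blast
  then show ?thesis
    using w_mult_ge[of g h] vle_antisym[OF w_closed mV] unfolding m_def by blast
qed

theorem poly_valuation_w: "poly_valuation G w"
  unfolding poly_valuation_def
  using ordered_abelian_group_axioms w_closed w_eq_None w_mult w_add by blast

lemma w_sum:
  assumes "\<And>i. i \<le> n \<Longrightarrow> small (a i)"
  shows "is_vmin G (w (\<Sum>i\<le>n. a i * f ^ i)) ((\<lambda>i. vadd G (u (a i)) (Some (\<beta> [^] i))) ` {..n})"
  using assms
proof (induction n arbitrary: a)
  case 0
  then show ?case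
    using vle_refl[OF uV[of "a 0"]] vadd_zero(1)[OF uV[of "a 0"]] by (simp add: is_vmin_def w_small)
next
  case (Suc n)
  define b where "b i = a (Suc i)" for i
  define T where "T i = vadd G (u (a i)) (Some (\<beta> [^] i))" for i
  let ?g = "\<Sum>i\<le>n. b i * f ^ i"
  have IH: "is_vmin G (w ?g) ((\<lambda>i. vadd G (u (b i)) (Some (\<beta> [^] i))) ` {..n})"
    by (rule Suc.IH) (simp add: b_def Suc.prems)
  have pV: "Some (\<beta> [^] i) \<in> vals" for i :: nat using beta by simp
  have shift: "vadd G (Some \<beta>) (vadd G (u (b i)) (Some (\<beta> [^] i))) = T (Suc i)" for i
  proof -
    have "vadd G (Some \<beta>) (vadd G (u (b i)) (Some (\<beta> [^] i)))
      = vadd G (u (b i)) (vadd G (Some \<beta>) (Some (\<beta> [^] i)))"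
      by (intro vadd_left_comm betaV uV pV)
    then show ?thesis using beta by (simp add: T_def b_def m_comm)
  qed
  have T0: "T 0 = u (a 0)" using uV[of "a 0"] by (simp add: T_def vadd_zero del: insert_iff)
  have TV: "T i \<in> vals" for i unfolding T_def by (intro vadd_closed uV pV)
  have sum: "(\<Sum>i\<le>Suc n. a i * f ^ i) = a 0 + f * ?g"
    by (simp add: sum.atMost_Suc_shift b_def sum_distrib_left mult_ac del: sum.atMost_Suc)
  have a0: "small (a 0)" by (simp add: Suc.prems)
  have "w (\<Sum>i\<le>Suc n. a i * f ^ i) = vmin G (T 0) (vadd G (Some \<beta>) (w ?g))"
    unfolding sum T0 by (rule w_digit[OF a0])
  moreover obtain i where "i \<le> n" and wi: "w ?g = vadd G (u (b i)) (Some (\<beta> [^] i))"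
    using IH unfolding is_vmin_def by blast
  then have i: "i \<le> n" "vadd G (Some \<beta>) (w ?g) = T (Suc i)" by (simp_all only: wi shift)
  ultimately have w: "w (\<Sum>i\<le>Suc n. a i * f ^ i) = vmin G (T 0) (T (Suc i))" by simp
  have "vle G (T (Suc i)) (T (Suc j))" if "j \<le> n" for j
  proof -
    have "vle G (w ?g) (vadd G (u (b j)) (Some (\<beta> [^] j)))" using IH that unfolding is_vmin_def by blast
    then have "vle G (vadd G (Some \<beta>) (w ?g)) (vadd G (Some \<beta>) (vadd G (u (b j)) (Some (\<beta> [^] j))))"
      by (intro vadd_mono betaV w_closed vadd_closed uV pV)
    then show ?thesis by (simp only: i(2) shift)
  qed
  moreover have "vle G (vmin G (T 0) (T (Suc i))) (T (Suc i))" "vle G (vmin G (T 0) (T (Suc i))) (T 0)"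
    by (rule vmin_le[OF TV TV])+
  ultimately have "vle G (vmin G (T 0) (T (Suc i))) (T j)" if "j \<le> Suc n" for j
  proof (cases j)
    case (Suc l)
    then have "vle G (T (Suc i)) (T j)"
      using \<open>\<And>j. j \<le> n \<Longrightarrow> vle G (T (Suc i)) (T (Suc j))\<close>[of l] that by (simp only: Suc_le_mono)
    then show ?thesis
      using vle_trans[OF vmin_closed[OF TV TV] TV TV] \<open>vle G (vmin G (T 0) (T (Suc i))) (T (Suc i))\<close>
      by blast
  qed (simp only:)
  moreover have "T 0 \<in> T ` {..Suc n}" "T (Suc i) \<in> T ` {..Suc n}"
    using i(1) by (auto intro!: imageI simp del: image_insert atMost_Suc)
  then have "vmin G (T 0) (T (Suc i)) \<in> T ` {..Suc n}" by (simp only: vmin_def split: if_split) blast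
  ultimately have "is_vmin G (vmin G (T 0) (T (Suc i))) (T ` {..Suc n})"
    unfolding is_vmin_def by blast
  moreover have "T = (\<lambda>i. vadd G (u (a i)) (Some (\<beta> [^] i)))" by (simp add: T_def fun_eq_iff)
  ultimately show ?case unfolding w by (simp only:)
qed

lemma w_attained:
  assumes "g \<noteq> 0"
  shows "\<exists>a i. small a \<and> a \<noteq> 0 \<and> w g = w (a * f ^ i)"
  using assms
proof (induction g rule: poly_induct)
  case (digit a g)
  have "w (a + f * g) \<noteq> None" using digit(3) w_eq_None by blast
  moreover have "w (a + f * g) = u a \<or> w (a + f * g) = w (f * g)"
    using digit(1) by (simp add: w_digit vmin_def w_mult_f)
  ultimately consider "a \<noteq> 0" "w (a + f * g) = u a" | "g \<noteq> 0" "w (a + f * g) = w (f * g)"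
    using u_0 by (cases "a = 0"; cases "g = 0") auto
  then show ?case
  proof cases
    case 1
    then show ?thesis using digit(1) w_small by (intro exI[of _ a] exI[of _ 0]) simp
  next
    case 2
    then obtain b i where b: "small b" "b \<noteq> 0" "w g = w (b * f ^ i)" using digit(2) by blast
    have "w (f * g) = w (b * f ^ Suc i)"
      using w_mult_f[of g] w_mult_f[of "b * f ^ i"] b(3) by (simp add: mult_ac)
    then show ?thesis using 2 b by metis
  qed
qed simp

end

section \<open>Adjoining an element that realizes a cut\<close>

text \<open>
  \<open>below_shift G D a b k\<close> is the relation \<open>a < b + k * \<alpha>\<close> for an element \<open>\<alpha>\<close> that lies above \<open>D\<close> but
  below everything that exceeds \<open>D\<close>.  The multiples \<open>k * d\<close> are formed in \<open>G\<close> itself, so \<open>G\<close> may fail to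
  be divisible.
\<close>

definition below_shift :: "'g ogroup \<Rightarrow> 'g set \<Rightarrow> 'g \<Rightarrow> 'g \<Rightarrow> nat \<Rightarrow> bool" where
  "below_shift G D a b k \<longleftrightarrow> (\<exists>d\<in>D. ord_le G a (b \<otimes>\<^bsub>G\<^esub> d [^]\<^bsub>G\<^esub> k))"

text \<open>
  The group \<open>G \<oplus> \<int>\<alpha>\<close>, where \<open>(g, n)\<close> stands for \<open>g + n * \<alpha>\<close>, with the order dictated by \<open>below_shift\<close>.
\<close>

definition adjoin_cut :: "'g ogroup \<Rightarrow> 'g set \<Rightarrow> ('g \<times> int) ogroup" where
  "adjoin_cut G D =
     \<lparr>carrier = carrier G \<times> UNIV,
      mult = (\<lambda>(g, n) (h, m). (g \<otimes>\<^bsub>G\<^esub> h, n + m)), one = (\<one>\<^bsub>G\<^esub>, 0),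
      ord_le = (\<lambda>(g, n) (h, m).
        if n = m then ord_le G g h
        else if n < m then below_shift G D g h (nat (m - n))
        else \<not> below_shift G D h g (nat (n - m)))\<rparr>"

context ordered_abelian_group
begin

lemma ord_mult2:
  "\<lbrakk>a \<in> carrier G; b \<in> carrier G; c \<in> carrier G; d \<in> carrier G; ord_le G a b; ord_le G c d\<rbrakk>
    \<Longrightarrow> ord_le G (a \<otimes> c) (b \<otimes> d)"
  using ord_mult[of c d a] ord_mult[of a b d] ord_trans[of "a \<otimes> c" "a \<otimes> d" "b \<otimes> d"]
  by (simp add: m_comm)

lemma ord_mult_cancel:
  assumes "a \<in> carrier G" "b \<in> carrier G" "c \<in> carrier G" "ord_le G (c \<otimes> a) (c \<otimes> b)"
  shows "ord_le G a b"
  using ord_mult[of "c \<otimes> a" "c \<otimes> b" "inv c"] assms by (simp add: m_assoc[symmetric])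

lemma ord_pow: "\<lbrakk>a \<in> carrier G; b \<in> carrier G; ord_le G a b\<rbrakk> \<Longrightarrow> ord_le G (a [^] (k::nat)) (b [^] k)"
  by (induction k) (auto intro: ord_mult2 ord_refl)

context
  fixes D assumes D: "D \<subseteq> carrier G"
begin

abbreviation R where "R \<equiv> below_shift G D"

lemma below_shift_mono:
  assumes "a \<in> carrier G" "b \<in> carrier G" "d \<in> D" "e \<in> D" "ord_le G d e"
    and "ord_le G a (b \<otimes> d [^] (k::nat))"
  shows "ord_le G a (b \<otimes> e [^] k)"
proof -
  have "d \<in> carrier G" "e \<in> carrier G" using assms D by auto
  then have "ord_le G (b \<otimes> d [^] k) (b \<otimes> e [^] k)" using assms by (intro ord_mult ord_pow) auto
  then show ?thesis
    using ord_trans[of a "b \<otimes> d [^] k" "b \<otimes> e [^] k"] assms \<open>d \<in> carrier G\<close> \<open>e \<in> carrier G\<close> by simp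
qed

lemma below_shift_trans:
  assumes c: "a \<in> carrier G" "b \<in> carrier G" "c \<in> carrier G" and "R a b k" "R b c l"
  shows "R a c (k + l)"
proof -
  obtain d e where d: "d \<in> D" "ord_le G a (b \<otimes> d [^] k)" and e: "e \<in> D" "ord_le G b (c \<otimes> e [^] l)"
    using assms by (auto simp: below_shift_def)
  obtain m where m: "m \<in> D" "ord_le G d m" "ord_le G e m"
    using ord_total[of d e] ord_refl d(1) e(1) D by blast
  have mc: "m \<in> carrier G" using m D by auto
  have "ord_le G a (b \<otimes> m [^] k)" "ord_le G b (c \<otimes> m [^] l)"
    using below_shift_mono d e m c by blast+
  moreover have "ord_le G (m [^] k \<otimes> b) (m [^] k \<otimes> (c \<otimes> m [^] l))"
    using calculation mc c by (intro ord_mult) auto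
  moreover have "m [^] k \<otimes> (c \<otimes> m [^] l) = c \<otimes> m [^] (k + l)"
    using mc c by (simp add: nat_pow_mult[symmetric] m_ac)
  ultimately have "ord_le G a (c \<otimes> m [^] (k + l))"
    using ord_trans[of a "b \<otimes> m [^] k" "c \<otimes> m [^] (k + l)"] mc c by (simp add: m_comm)
  then show ?thesis using m by (auto simp: below_shift_def)
qed

lemma below_shift_le:
  "\<lbrakk>a \<in> carrier G; b \<in> carrier G; c \<in> carrier G; ord_le G a b; R b c k\<rbrakk> \<Longrightarrow> R a c k"
  "\<lbrakk>a \<in> carrier G; b \<in> carrier G; c \<in> carrier G; R a b k; ord_le G b c\<rbrakk> \<Longrightarrow> R a c k"
proof -
  assume *: "a \<in> carrier G" "b \<in> carrier G" "c \<in> carrier G"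
  {
    assume "ord_le G a b" "R b c k"
    then obtain d where d: "d \<in> D" "ord_le G b (c \<otimes> d [^] k)" by (auto simp: below_shift_def)
    then have "d \<in> carrier G" using D by auto
    then have "ord_le G a (c \<otimes> d [^] k)"
      using ord_trans[of a b "c \<otimes> d [^] k"] d * \<open>ord_le G a b\<close> by simp
    then show "R a c k" using d by (auto simp: below_shift_def)
  next
    assume "R a b k" "ord_le G b c"
    then obtain d where d: "d \<in> D" "ord_le G a (b \<otimes> d [^] k)" by (auto simp: below_shift_def)
    then have dc: "d \<in> carrier G" using D by auto
    then have "ord_le G (b \<otimes> d [^] k) (c \<otimes> d [^] k)"
      using * \<open>ord_le G b c\<close> by (intro ord_mult2 ord_refl) auto
    then have "ord_le G a (c \<otimes> d [^] k)"
      using ord_trans[of a "b \<otimes> d [^] k" "c \<otimes> d [^] k"] d * dc by simp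
    then show "R a c k" using d by (auto simp: below_shift_def)
  }
qed

text \<open>
  Contrapositive forms of transitivity: \<open>\<not> R c b l\<close> means \<open>b + l * \<alpha> < c\<close>, so that \<open>a < b + (k + l) * \<alpha>\<close>
  gives \<open>a < c + k * \<alpha>\<close>, and similarly for the second rule.
\<close>

lemma below_shift_diff:
  assumes c: "a \<in> carrier G" "b \<in> carrier G" "c \<in> carrier G"
  shows "\<lbrakk>R a b (k + l); \<not> R c b l\<rbrakk> \<Longrightarrow> R a c k"
    and "\<lbrakk>R a b (k + l); \<not> R a c l\<rbrakk> \<Longrightarrow> R c b k"
proof -
  assume "R a b (k + l)"
  then obtain d where d: "d \<in> D" "ord_le G a (b \<otimes> d [^] (k + l))" by (auto simp: below_shift_def)
  then have dc: "d \<in> carrier G" using D by auto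
  have eq: "b \<otimes> d [^] (k + l) = d [^] k \<otimes> (b \<otimes> d [^] l)" "b \<otimes> d [^] (k + l) = d [^] l \<otimes> (b \<otimes> d [^] k)"
    using dc c by (simp_all add: nat_pow_mult[symmetric] m_ac)
  {
    assume "\<not> R c b l"
    then have "\<not> ord_le G c (b \<otimes> d [^] l)" using d by (auto simp: below_shift_def)
    then have "ord_le G (b \<otimes> d [^] l) c" using ord_total[of c "b \<otimes> d [^] l"] dc c by auto
    then have "ord_le G (b \<otimes> d [^] (k + l)) (d [^] k \<otimes> c)"
      unfolding eq(1) using dc c by (intro ord_mult) auto
    then have "ord_le G a (c \<otimes> d [^] k)"
      using ord_trans[of a "b \<otimes> d [^] (k + l)" "c \<otimes> d [^] k"] d dc c by (simp add: m_comm)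
    then show "R a c k" using d by (auto simp: below_shift_def)
  next
    assume "\<not> R a c l"
    then have "\<not> ord_le G a (c \<otimes> d [^] l)" using d by (auto simp: below_shift_def)
    then have "ord_le G (c \<otimes> d [^] l) a" using ord_total[of a "c \<otimes> d [^] l"] dc c by auto
    then have "ord_le G (d [^] l \<otimes> c) (d [^] l \<otimes> (b \<otimes> d [^] k))"
      using ord_trans[of "c \<otimes> d [^] l" a "b \<otimes> d [^] (k + l)"] d dc c unfolding eq(2)
      by (simp add: m_comm)
    then have "ord_le G c (b \<otimes> d [^] k)" using ord_mult_cancel[of c "b \<otimes> d [^] k" "d [^] l"] dc c by simp
    then show "R c b k" using d by (auto simp: below_shift_def)
  }
qed

lemma below_shift_0: "\<lbrakk>a \<in> carrier G; b \<in> carrier G; R a b 0\<rbrakk> \<Longrightarrow> ord_le G a b"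
  by (auto simp: below_shift_def)

lemma below_shift_translate:
  assumes "a \<in> carrier G" "b \<in> carrier G" "c \<in> carrier G"
  shows "R (c \<otimes> a) (c \<otimes> b) k \<longleftrightarrow> R a b k"
proof -
  have "ord_le G (c \<otimes> a) (c \<otimes> b \<otimes> d [^] k) \<longleftrightarrow> ord_le G a (b \<otimes> d [^] k)" if "d \<in> D" for d
  proof -
    have "d \<in> carrier G" using that D by auto
    then show ?thesis
      using assms ord_mult[of a "b \<otimes> d [^] k" c] ord_mult_cancel[of a "b \<otimes> d [^] k" c]
      by (auto simp: m_assoc)
  qed
  then show ?thesis by (auto simp: below_shift_def)
qed

lemma adjoin_cut_simps:
  "carrier (adjoin_cut G D) = carrier G \<times> UNIV"
  "\<one>\<^bsub>adjoin_cut G D\<^esub> = (\<one>, 0)"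
  "(g, n) \<otimes>\<^bsub>adjoin_cut G D\<^esub> (h, m) = (g \<otimes> h, n + m)"
  "ord_le (adjoin_cut G D) (g, n) (h, m) \<longleftrightarrow>
     (if n = m then ord_le G g h
      else if n < m then R g h (nat (m - n)) else \<not> R h g (nat (n - m)))"
  by (simp_all add: adjoin_cut_def)

text \<open>
  The order is total and antisymmetric by construction; only transitivity needs work.  The cases are
  the possible orders of the three coefficients of \<open>\<alpha>\<close>.
\<close>

lemma adjoin_cut_trans:
  assumes c: "g \<in> carrier G" "h \<in> carrier G" "p \<in> carrier G"
    and "ord_le (adjoin_cut G D) (g, n) (h, m)" "ord_le (adjoin_cut G D) (h, m) (p, q)"
  shows "ord_le (adjoin_cut G D) (g, n) (p, q)"
proof -
  note [simp] = adjoin_cut_simps(4)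
  consider "n < m" "m < q" | "n < m" "m = q" | "n < m" "q < m" | "n = m" | "m < n" "m < q"
    | "m < n" "m = q" | "m < n" "q < m" by linarith
  then show ?thesis
  proof cases
    case 1
    then have "nat (q - n) = nat (m - n) + nat (q - m)" by simp
    then show ?thesis using below_shift_trans[OF c] assms(4,5) 1 by simp
  next
    case 2
    then show ?thesis using below_shift_le(2)[OF c] assms(4,5) by simp
  next
    case 3
    consider "n < q" | "n = q" | "q < n" by linarith
    then show ?thesis
    proof cases
      case a: 1
      then have "nat (m - n) = nat (q - n) + nat (m - q)" using 3 by simp
      then show ?thesis using below_shift_diff(1)[of g h p] c assms(4,5) 3 a by simp
    next
      case a: 2
      then show ?thesis
        using below_shift_diff(1)[of g h p 0 "nat (m - n)"] below_shift_0[of g p] c assms(4,5) 3 by simp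
    next
      case a: 3
      then have "nat (m - q) = nat (n - q) + nat (m - n)" using 3 by simp
      then show ?thesis using below_shift_trans[of p g h] c assms(4,5) 3 a by auto
    qed
  next
    case 4
    then show ?thesis
      using assms(4,5) ord_trans[OF c] below_shift_le(1)[OF c] below_shift_le(2)[of p g h] c
      by (auto split: if_splits)
  next
    case 5
    consider "n < q" | "n = q" | "q < n" by linarith
    then show ?thesis
    proof cases
      case a: 1
      then have "nat (q - m) = nat (q - n) + nat (n - m)" using 5 by simp
      then show ?thesis using below_shift_diff(2)[of h p g] c assms(4,5) 5 a by simp
    next
      case a: 2
      then show ?thesis
        using below_shift_diff(2)[of h p g 0 "nat (q - m)"] below_shift_0[of g p] c assms(4,5) 5 by simp
    next
      case a: 3
      then have "nat (n - m) = nat (q - m) + nat (n - q)" using 5 by simp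
      then show ?thesis using below_shift_trans[of h p g] c assms(4,5) 5 a by auto
    qed
  next
    case 6
    then show ?thesis using below_shift_le(1)[of h p g] c assms(4,5) by auto
  next
    case 7
    then have "nat (n - q) = nat (m - q) + nat (n - m)" by simp
    then show ?thesis using below_shift_diff(1)[of p g h] c assms(4,5) 7 by auto
  qed
qed

lemma adjoin_cut_ordered: "ordered_abelian_group (adjoin_cut G D)"
proof -
  have "comm_group (adjoin_cut G D)"
  proof (rule comm_groupI)
    fix x assume "x \<in> carrier (adjoin_cut G D)"
    then show "\<exists>y\<in>carrier (adjoin_cut G D). y \<otimes>\<^bsub>adjoin_cut G D\<^esub> x = \<one>\<^bsub>adjoin_cut G D\<^esub>"
      by (intro bexI[of _ "(inv (fst x), - snd x)"]; cases x) (auto simp: adjoin_cut_simps)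
  qed (auto simp: adjoin_cut_simps m_ac)
  moreover have "ordered_abelian_group_axioms (adjoin_cut G D)"
  proof
    fix a b c :: "'g \<times> int"
    obtain g n where a: "a = (g, n)" by (cases a)
    obtain h m where b: "b = (h, m)" by (cases b)
    obtain p q where c: "c = (p, q)" by (cases c)
    show "ord_le (adjoin_cut G D) a a" if "a \<in> carrier (adjoin_cut G D)"
      using that by (simp add: a adjoin_cut_simps ord_refl)
    show "a = b" if "a \<in> carrier (adjoin_cut G D)" "b \<in> carrier (adjoin_cut G D)"
      "ord_le (adjoin_cut G D) a b" "ord_le (adjoin_cut G D) b a"
      using that ord_antisym[of g h] by (auto simp: a b adjoin_cut_simps split: if_splits)
    show "ord_le (adjoin_cut G D) a c"
      if "a \<in> carrier (adjoin_cut G D)" "b \<in> carrier (adjoin_cut G D)"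
        "c \<in> carrier (adjoin_cut G D)" "ord_le (adjoin_cut G D) a b" "ord_le (adjoin_cut G D) b c"
      using that adjoin_cut_trans[of g h p n m q] unfolding a b c by (simp add: adjoin_cut_simps(1))
    show "ord_le (adjoin_cut G D) a b \<or> ord_le (adjoin_cut G D) b a"
      if "a \<in> carrier (adjoin_cut G D)" "b \<in> carrier (adjoin_cut G D)"
      using that ord_total[of g h] by (auto simp: a b adjoin_cut_simps)
    show "ord_le (adjoin_cut G D) (c \<otimes>\<^bsub>adjoin_cut G D\<^esub> a) (c \<otimes>\<^bsub>adjoin_cut G D\<^esub> b)"
      if "a \<in> carrier (adjoin_cut G D)" "b \<in> carrier (adjoin_cut G D)"
        "c \<in> carrier (adjoin_cut G D)" "ord_le (adjoin_cut G D) a b"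
      using that ord_mult[of g h p] below_shift_translate[of g h p] below_shift_translate[of h g p]
      by (auto simp: a b c adjoin_cut_simps split: if_splits)
  qed
  ultimately show ?thesis by (rule ordered_abelian_group.intro)
qed

lemma adjoin_cut_pow: "(\<one>, 1) [^]\<^bsub>adjoin_cut G D\<^esub> (n::nat) = (\<one>, int n)"
proof -
  interpret A: ordered_abelian_group "adjoin_cut G D" by (rule adjoin_cut_ordered)
  show ?thesis by (induction n) (simp_all add: adjoin_cut_simps)
qed

lemma adjoin_cut_embedding: "group_order_embedding G (adjoin_cut G D) (\<lambda>g. (g, 0))"
  by (simp add: group_order_embedding_def hom_def adjoin_cut_simps)

lemma adjoin_cut_lower: "d \<in> D \<Longrightarrow> ord_less (adjoin_cut G D) (d, 0) (\<one>, 1)"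
  using D by (auto simp: ord_less_def adjoin_cut_simps below_shift_def intro!: bexI[of _ d] ord_refl)

lemma adjoin_cut_upper:
  assumes "\<And>d. d \<in> D \<Longrightarrow> \<not> ord_le G e d" "e \<in> carrier G"
  shows "ord_less (adjoin_cut G D) (\<one>, 1) (e, 0)"
proof -
  have "d \<in> carrier G" if "d \<in> D" for d using that D by blast
  then show ?thesis using assms by (simp add: ord_less_def adjoin_cut_simps below_shift_def)
qed

end

end

section \<open>The residue field\<close>

locale field_valuation =
  fixes G :: "'g ogroup" and v :: "'f::field \<Rightarrow> 'g option"
  assumes valuation: "valuation G v"
begin

sublocale valuation_preorder "value_le G v"
  by (rule valuation_imp_preorder[OF valuation])

notation lt (infix "\<prec>" 50)
notation eqv (infix "\<approx>" 50)
abbreviation le (infix "\<preceq>" 50) where "a \<preceq> b \<equiv> value_le G v a b"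

abbreviation \<O> where "\<O> \<equiv> valuation_ring G v"
abbreviation \<M> where "\<M> \<equiv> valuation_ideal G v"
abbreviation F where "F \<equiv> residue_field G v"

definition residue :: "'f \<Rightarrow> 'f set" where
  "residue a = \<M> +>\<^bsub>\<O>\<^esub> a"

lemma v_one: "v 1 = Some \<one>\<^bsub>G\<^esub>"
  by (rule valuation_one[OF valuation])

lemma O_simps [simp]:
  "mult \<O> = (*)" "one \<O> = 1" "zero \<O> = 0" "add \<O> = (+)" "a \<in> carrier \<O> \<longleftrightarrow> 1 \<preceq> a"
  by (simp_all add: valuation_ring_def value_le_def v_one)

lemma in_M_iff [simp]: "a \<in> \<M> \<longleftrightarrow> 1 \<prec> a"
proof -
  have "vless G (v 1) (v a) \<longleftrightarrow> 1 \<preceq> a \<and> \<not> 1 \<approx> a"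
    by (simp add: vless_def value_le_def eqv_iff_value_eq[OF valuation])
  also have "\<dots> \<longleftrightarrow> 1 \<prec> a" using le_cases[of 1 a] by (auto simp: lt_def eqv_def)
  finally show ?thesis by (simp add: valuation_ideal_def v_one)
qed

lemma ge_one_mult: "1 \<preceq> a \<Longrightarrow> 1 \<preceq> b \<Longrightarrow> 1 \<preceq> a * b"
  using le_mult_mono[of 1 a 1 b] by simp

lemma unit_iff: "1 \<preceq> a \<Longrightarrow> a \<notin> \<M> \<longleftrightarrow> a \<approx> 1"
  by (auto simp: lt_def eqv_def)

lemma inverse_ge_one: "a \<approx> 1 \<Longrightarrow> 1 \<preceq> inverse a"
  using eqv_inverse[of a 1] by (simp add: eqv_def)

lemma cring_O: "cring \<O>"
proof (rule cringI)
  show "abelian_group \<O>"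
  proof (rule abelian_groupI)
    fix x assume "x \<in> carrier \<O>"
    then show "\<exists>y\<in>carrier \<O>. y \<oplus>\<^bsub>\<O>\<^esub> x = \<zero>\<^bsub>\<O>\<^esub>"
      by (intro bexI[of _ "- x"]) simp_all
  qed (auto intro: le_add)
  show "comm_monoid \<O>"
    by (rule comm_monoidI) (auto intro: ge_one_mult)
qed (simp add: distrib_right)

lemma a_inv_O: "1 \<preceq> a \<Longrightarrow> \<ominus>\<^bsub>\<O>\<^esub> a = - a"
proof -
  assume "1 \<preceq> a"
  interpret cring \<O> by (rule cring_O)
  show ?thesis by (rule minus_equality) (use \<open>1 \<preceq> a\<close> in simp_all)
qed

lemma ideal_M: "ideal \<M> \<O>"
proof (rule idealI)
  interpret cring \<O> by (rule cring_O)
  show "ring \<O>" by (rule ring_axioms)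
  show "subgroup \<M> (add_monoid \<O>)"
  proof (rule add.subgroupI)
    show "\<M> \<subseteq> carrier \<O>" by (auto intro: lt_imp_le)
    show "\<M> \<noteq> {}" using in_M_iff[of 0] by (metis empty_iff lt_zero_iff one_neq_zero)
    show "\<ominus>\<^bsub>\<O>\<^esub> a \<in> \<M>" if "a \<in> \<M>" for a
      using that lt_imp_le by (simp add: a_inv_O)
    show "a \<oplus>\<^bsub>\<O>\<^esub> b \<in> \<M>" if "a \<in> \<M>" "b \<in> \<M>" for a b
      using that by (simp add: lt_add)
  qed
  show "x \<otimes>\<^bsub>\<O>\<^esub> a \<in> \<M>" if "a \<in> \<M>" "x \<in> carrier \<O>" for a x
    using that le_lt_mult[of 1 x 1 a] by simp
  then show "a \<otimes>\<^bsub>\<O>\<^esub> x \<in> \<M>" if "a \<in> \<M>" "x \<in> carrier \<O>" for a x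
    using that by (simp add: mult.commute)
qed

lemma maximal_M: "maximalideal \<M> \<O>"
proof (rule maximalidealI)
  show "ideal \<M> \<O>" by (rule ideal_M)
  have "1 \<in> carrier \<O>" "1 \<notin> \<M>" by simp_all
  then show "carrier \<O> \<noteq> \<M>" by blast
  fix J assume J: "ideal J \<O>" "\<M> \<subseteq> J" "J \<subseteq> carrier \<O>"
  interpret J: ideal J \<O> by (rule J)
  show "J = \<M> \<or> J = carrier \<O>"
  proof (cases "J = \<M>")
    case False
    then obtain a where a: "a \<in> J" "a \<notin> \<M>" using J by blast
    then have "a \<approx> 1" using J unit_iff by auto
    then have "inverse a \<in> carrier \<O>" "a \<noteq> 0" using inverse_ge_one by auto
    then have "1 \<in> J" using J.I_l_closed[OF a(1), of "inverse a"] by simp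
    then show ?thesis using J.one_imp_carrier by simp
  qed simp
qed

lemma field_F: "field F"
proof -
  interpret maximalideal \<M> \<O> by (rule maximal_M)
  show ?thesis unfolding residue_field_def by (rule quotient_is_field[OF cring_O])
qed

lemma residue_hom: "ring_hom_ring \<O> F residue"
proof -
  interpret ideal \<M> \<O> by (rule ideal_M)
  have "residue = ((+>\<^bsub>\<O>\<^esub>) \<M>)" by (simp add: residue_def fun_eq_iff)
  then show ?thesis unfolding residue_field_def using rcos_ring_hom_ring by simp
qed

lemma residue_simps:
  "1 \<preceq> a \<Longrightarrow> residue a \<in> carrier F"
  "1 \<preceq> a \<Longrightarrow> 1 \<preceq> b \<Longrightarrow> residue (a * b) = residue a \<otimes>\<^bsub>F\<^esub> residue b"
  "1 \<preceq> a \<Longrightarrow> 1 \<preceq> b \<Longrightarrow> residue (a + b) = residue a \<oplus>\<^bsub>F\<^esub> residue b"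
  "residue 1 = \<one>\<^bsub>F\<^esub>"
  "residue 0 = \<zero>\<^bsub>F\<^esub>"
proof -
  interpret ring_hom_ring \<O> F residue by (rule residue_hom)
  show "1 \<preceq> a \<Longrightarrow> residue a \<in> carrier F" using hom_closed[of a] by simp
  show "1 \<preceq> a \<Longrightarrow> 1 \<preceq> b \<Longrightarrow> residue (a * b) = residue a \<otimes>\<^bsub>F\<^esub> residue b"
    using hom_mult[of a b] by simp
  show "1 \<preceq> a \<Longrightarrow> 1 \<preceq> b \<Longrightarrow> residue (a + b) = residue a \<oplus>\<^bsub>F\<^esub> residue b"
    using hom_add[of a b] by simp
  show "residue 1 = \<one>\<^bsub>F\<^esub>" using hom_one by simp
  show "residue 0 = \<zero>\<^bsub>F\<^esub>" using hom_zero by simp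
qed

lemma residue_eq_iff: "1 \<preceq> a \<Longrightarrow> 1 \<preceq> b \<Longrightarrow> residue a = residue b \<longleftrightarrow> 1 \<prec> a - b"
proof -
  assume ab: "1 \<preceq> a" "1 \<preceq> b"
  interpret ideal \<M> \<O> by (rule ideal_M)
  have "residue a = residue b \<longleftrightarrow> a \<ominus>\<^bsub>\<O>\<^esub> b \<in> \<M>"
    unfolding residue_def using ab by (intro quotient_eq_iff_same_a_r_cos[symmetric] ideal_M) simp_all
  also have "a \<ominus>\<^bsub>\<O>\<^esub> b = a - b"
    using ab by (simp add: a_minus_def a_inv_O)
  finally show ?thesis by simp
qed

lemma residue_eq_zero_iff: "1 \<preceq> a \<Longrightarrow> residue a = \<zero>\<^bsub>F\<^esub> \<longleftrightarrow> 1 \<prec> a"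
  using residue_eq_iff[of a 0] by (simp add: residue_simps(5))

lemma carrier_F: "carrier F = residue ` carrier \<O>"
  by (auto simp: residue_field_def FactRing_def A_RCOSETS_def' residue_def)

lemma residues_of_eq: "residues_of G v S = residue ` (S \<inter> carrier \<O>)"
  by (simp add: residues_of_def residue_def)

lemma residue_power: "1 \<preceq> a \<Longrightarrow> residue (a ^ n) = residue a [^]\<^bsub>F\<^esub> n \<and> 1 \<preceq> a ^ n"
proof -
  interpret F: field F by (rule field_F)
  assume a: "1 \<preceq> a"
  show ?thesis
  proof (induction n)
    case (Suc n)
    then have "residue (a ^ n * a) = residue a [^]\<^bsub>F\<^esub> n \<otimes>\<^bsub>F\<^esub> residue a"
      using a by (simp only: residue_simps)
    then show ?case using Suc a ge_one_mult[of a "a ^ n"] by (simp add: mult.commute)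
  qed (simp add: residue_simps)
qed

lemma residue_inverse: "a \<approx> 1 \<Longrightarrow> residue (inverse a) = inv\<^bsub>F\<^esub> residue a"
proof -
  interpret F: field F by (rule field_F)
  assume a: "a \<approx> 1"
  then have 1: "1 \<preceq> a" "1 \<preceq> inverse a" "a \<noteq> 0" using inverse_ge_one by (auto simp: eqv_def)
  then have "residue a \<otimes>\<^bsub>F\<^esub> residue (inverse a) = \<one>\<^bsub>F\<^esub>"
    using residue_simps(2)[of a "inverse a"] residue_simps(4) by simp
  then show ?thesis using F.comm_inv_char[of "residue a"] residue_simps(1) 1 by metis
qed

end

section \<open>Recognizing the three kinds of extensions\<close>

text \<open>
  The next two conditions imply that the extension is value-transcendental, respectively
  residue-transcendental.  They only mention the preorder, so they pass to equivalent valuations.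
  The first one says that \<open>v p\<close> is not torsion over \<open>v K\<close> and that \<open>v K[x]\<close> lies in \<open>v K + \<nat> * v p\<close>.
\<close>

definition adjoins_value :: "('k::field ratfun \<Rightarrow> 'k ratfun \<Rightarrow> bool) \<Rightarrow> bool" where
  "adjoins_value leq \<longleftrightarrow> (\<exists>p. p \<noteq> 0
     \<and> (\<forall>n c. n > 0 \<longrightarrow> \<not> valuation_preorder.eqv leq (p ^ n) (const c))
     \<and> (\<forall>q. q \<noteq> 0 \<longrightarrow> (\<exists>c i. valuation_preorder.eqv leq (of_poly q) (const c * p ^ i))))"

text \<open>
  A polynomial in \<open>t\<close> over \<open>K\<close> has at most the value of each of its coefficients, so the residue of
  \<open>t\<close> is transcendental; and every polynomial in \<open>x\<close> equals a polynomial in \<open>t\<close> up to higher value, so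
  this residue generates the residue field.
\<close>

definition adjoins_residue :: "('k::field ratfun \<Rightarrow> 'k ratfun \<Rightarrow> bool) \<Rightarrow> bool" where
  "adjoins_residue leq \<longleftrightarrow> (\<exists>t. leq 1 t
     \<and> (\<forall>c n i. i \<le> n \<longrightarrow> leq (\<Sum>i\<le>n. const (c i) * t ^ i) (const (c i)))
     \<and> (\<forall>q. q \<noteq> 0 \<longrightarrow> (\<exists>n c. valuation_preorder.lt leq (of_poly q)
                            (of_poly q - (\<Sum>i\<le>n. const (c i) * t ^ i)))))"

locale ratfun_valuation = field_valuation G v
  for G :: "'g ogroup" and v :: "'k::field ratfun \<Rightarrow> 'g option"
begin

text \<open>
  If \<open>p\<close> and \<open>q\<close> agree with constants up to higher value, so does \<open>p / q\<close>.  Hence every value and every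
  residue is that of a constant.
\<close>

lemma immediate_extI:
  assumes approx: "\<And>p. p \<noteq> 0 \<Longrightarrow> \<exists>c. of_poly p \<prec> of_poly p - const c"
  shows "immediate_ext G v"
proof -
  have approx': "\<exists>c. f \<prec> f - const c" if "f \<noteq> 0" for f
  proof -
    obtain p q where q: "q \<noteq> 0" "f = of_poly p / of_poly q" by (rule ratfun_cases)
    then have "p \<noteq> 0" using that by auto
    then obtain a b where ab: "of_poly p \<prec> of_poly p - const a" "of_poly q \<prec> of_poly q - const b"
      using approx q by meson
    then have eq: "of_poly p \<approx> const a" "of_poly q \<approx> const b" by (simp_all add: lt_diff_eqv)
    then have "b \<noteq> 0" "a \<noteq> 0" using q(1) \<open>p \<noteq> 0\<close> eqv_imp_zero_iff by fastforce+
    have "of_poly p * const b \<prec> (of_poly p - const a) * const b"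
      using ab \<open>b \<noteq> 0\<close> by (simp add: lt_mult_iff')
    moreover have "of_poly p * const b \<prec> const a * (of_poly q - const b)"
    proof -
      have "of_poly p * const b \<approx> const a * of_poly q" using eq eqv_sym by (intro eqv_mult) blast+
      also have "const a * of_poly q \<prec> const a * (of_poly q - const b)"
        using ab \<open>a \<noteq> 0\<close> by (simp add: lt_mult_iff)
      finally show ?thesis .
    qed
    ultimately have "of_poly p * const b \<prec> (of_poly p - const a) * const b - const a * (of_poly q - const b)"
      by (rule lt_diff)
    moreover define d where "d = inverse (of_poly q * const b)"
    moreover have "d \<noteq> 0" using q \<open>b \<noteq> 0\<close> by (simp add: d_def)
    ultimately have "of_poly p * const b * d
        \<prec> ((of_poly p - const a) * const b - const a * (of_poly q - const b)) * d"
      by (simp add: lt_mult_iff')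
    moreover have "of_poly p * const b * d = f" using \<open>b \<noteq> 0\<close> q by (simp add: d_def field_simps)
    moreover have "((of_poly p - const a) * const b - const a * (of_poly q - const b)) * d
        = f - const (a / b)"
      using \<open>b \<noteq> 0\<close> q by (simp add: d_def field_simps)
    ultimately show ?thesis by metis
  qed
  have "values_of v UNIV = values_of v (range const)"
  proof
    show "values_of v UNIV \<subseteq> values_of v (range const)"
    proof
      fix g assume "g \<in> values_of v UNIV"
      then obtain f where f: "v f = Some g" by (auto simp: values_of_def)
      then have "f \<noteq> 0" using valuationD(3)[OF valuation, of f] by auto
      then obtain c where "f \<approx> const c" using approx' lt_diff_eqv by meson
      then have "v (const c) = Some g" using f eqv_iff_value_eq[OF valuation] by metis
      then show "g \<in> values_of v (range const)" by (auto simp: values_of_def)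
    qed
  qed (auto simp: values_of_def)
  moreover have "carrier F = residues_of G v (range const)"
    unfolding carrier_F residues_of_eq
  proof
    show "residue ` carrier \<O> \<subseteq> residue ` (range const \<inter> carrier \<O>)"
    proof
      fix y assume "y \<in> residue ` carrier \<O>"
      then obtain f where f: "1 \<preceq> f" "y = residue f" by auto
      obtain c where c: "1 \<prec> f - const c" "1 \<preceq> const c"
      proof (cases "f = 0")
        case False
        then obtain c where "f \<prec> f - const c" using approx' by blast
        then show ?thesis using that[of c] f le_lt_trans[of 1 f] lt_diff_eqv[of f "const c"]
          le_eqv_trans[of 1 f] by blast
      qed (use that[of 0] in simp)
      then have "y = residue (const c)" using f residue_eq_iff by blast
      then show "y \<in> residue ` (range const \<inter> carrier \<O>)" using c by (auto intro!: imageI)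
    qed
  qed auto
  ultimately show ?thesis by (simp add: immediate_ext_def)
qed

text \<open>
  The quotient of the value groups is infinite cyclic, generated by the class of \<open>v p\<close>.
\<close>

lemma value_transcendentalI:
  assumes "adjoins_value (value_le G v)"
  shows "value_transcendental G v"
proof -
  obtain p where p: "p \<noteq> 0" and nontorsion: "\<And>n c. n > 0 \<Longrightarrow> \<not> p ^ n \<approx> const c"
    and span: "\<And>q. q \<noteq> 0 \<Longrightarrow> \<exists>c i. of_poly q \<approx> const c * p ^ i"
    using assms unfolding adjoins_value_def by auto
  define V where "V = value_group G v"
  define H where "H = values_of v (range const)"
  interpret V: ordered_abelian_group V unfolding V_def by (rule value_group_ordered[OF valuation])
  have V_simps: "carrier V = values_of v UNIV" "mult V = mult G" "one V = one G"
    by (simp_all add: V_def value_group_def)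
  have v_eq: "v a = v b \<longleftrightarrow> a \<approx> b" for a b using eqv_iff_value_eq[OF valuation] by blast
  have vmult: "v (a * b) = Some (g \<otimes>\<^bsub>V\<^esub> h)" if "v a = Some g" "v b = Some h" for a b g h
    using valuationD(4)[OF valuation, of a b] that by (simp add: V_simps)
  have vV: "g \<in> carrier V" if "v a = Some g" for a g
    using that by (auto simp: V_simps values_of_def)
  have vSome: "\<exists>g. v a = Some g" if "a \<noteq> 0" for a
    using valuationD(3)[OF valuation, of a] that by auto
  have vinv: "v (inverse a) = Some (inv\<^bsub>V\<^esub> g)" if a: "v a = Some g" for a g
  proof -
    have "a \<noteq> 0" using a valuationD(3)[OF valuation, of a] by auto
    then obtain h where h: "v (inverse a) = Some h" using vSome[of "inverse a"] by auto
    have "g \<otimes>\<^bsub>V\<^esub> h = \<one>\<^bsub>V\<^esub>" using vmult[OF a h] \<open>a \<noteq> 0\<close> v_one by (simp add: V_simps)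
    then show ?thesis using V.comm_inv_char vV a h by metis
  qed
  have H: "subgroup H V"
  proof (rule V.subgroupI)
    show "H \<subseteq> carrier V" by (auto simp: H_def V_simps values_of_def)
    show "H \<noteq> {}" using vSome[of "const 1"] by (auto simp: H_def values_of_def simp del: const_simps)
    show "inv\<^bsub>V\<^esub> g \<in> H" if g: "g \<in> H" for g
    proof -
      obtain c where "v (const c) = Some g" using g by (auto simp: H_def values_of_def)
      then have "v (const (inverse c)) = Some (inv\<^bsub>V\<^esub> g)" using vinv by simp
      then show ?thesis unfolding H_def values_of_def by blast
    qed
    show "g \<otimes>\<^bsub>V\<^esub> h \<in> H" if gh: "g \<in> H" "h \<in> H" for g h
    proof -
      obtain c d where "v (const c) = Some g" "v (const d) = Some h"
        using gh by (auto simp: H_def values_of_def)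
      then have "v (const (c * d)) = Some (g \<otimes>\<^bsub>V\<^esub> h)" using vmult by simp
      then show ?thesis unfolding H_def values_of_def by blast
    qed
  qed
  then have nH: "H \<lhd> V" by (rule V.subgroup_imp_normal)
  define W where "W = V Mod H"
  interpret Q: comm_group W unfolding W_def by (rule V.abelian_FactGroup[OF H])
  interpret \<pi>: group_hom V W "\<lambda>g. H #>\<^bsub>V\<^esub> g"
    using normal.r_coset_hom_Mod[OF nH, folded W_def]
    by (intro group_hom.intro group_hom_axioms.intro) (simp_all add: V.group_axioms Q.group_axioms)
  have coset_one: "H #>\<^bsub>V\<^esub> g = \<one>\<^bsub>W\<^esub> \<longleftrightarrow> g \<in> H" if "g \<in> carrier V" for g
  proof -
    have "H #>\<^bsub>V\<^esub> g = H \<longleftrightarrow> g \<in> H"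
      using V.coset_join1[OF _ that H] V.coset_join2[OF that H] by blast
    then show ?thesis by (simp add: W_def FactGroup_def)
  qed
  obtain \<beta> where \<beta>: "v p = Some \<beta>" using vSome p by blast
  have \<beta>V: "\<beta> \<in> carrier V" by (rule vV[OF \<beta>])
  have vpow: "v (p ^ n) = Some (\<beta> [^]\<^bsub>V\<^esub> n)" for n
  proof (induction n)
    case 0
    then show ?case by (simp add: v_one V_simps)
  next
    case (Suc n)
    then show ?case using vmult[OF Suc \<beta>] by (simp add: mult.commute)
  qed
  define t where "t = H #>\<^bsub>V\<^esub> \<beta>"
  have tQ: "t \<in> carrier W" using \<beta>V unfolding t_def by (rule \<pi>.hom_closed)
  have t_pow: "t [^]\<^bsub>W\<^esub> k = H #>\<^bsub>V\<^esub> (\<beta> [^]\<^bsub>V\<^esub> k)" for k :: int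
    unfolding t_def using \<beta>V by (simp add: \<pi>.hom_int_pow)
  have t_nontorsion_nat: "t [^]\<^bsub>W\<^esub> int n \<noteq> \<one>\<^bsub>W\<^esub>" if "n > 0" for n
  proof
    assume "t [^]\<^bsub>W\<^esub> int n = \<one>\<^bsub>W\<^esub>"
    then have "\<beta> [^]\<^bsub>V\<^esub> int n \<in> H" unfolding t_pow using coset_one \<beta>V by simp
    then have "\<beta> [^]\<^bsub>V\<^esub> n \<in> H" by (simp add: int_pow_int)
    then obtain c where "v (const c) = v (p ^ n)" unfolding vpow by (auto simp: H_def values_of_def)
    then show False using nontorsion[OF that, of c] v_eq by metis
  qed
  have t_nontorsion: "k = 0" if "t [^]\<^bsub>W\<^esub> k = \<one>\<^bsub>W\<^esub>" for k :: int
  proof (rule ccontr)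
    assume "k \<noteq> 0"
    then consider "k = int (nat k)" "nat k > 0" | "k = - int (nat (- k))" "nat (- k) > 0" by linarith
    then show False
    proof cases
      case 1
      then show ?thesis using t_nontorsion_nat[of "nat k"] that by simp
    next
      case 2
      then have "t [^]\<^bsub>W\<^esub> (- k) = \<one>\<^bsub>W\<^esub>"
        using that Q.int_pow_neg[OF tQ, of k] Q.inv_one by (simp only:)
      then show ?thesis using t_nontorsion_nat[of "nat (- k)"] 2 by simp
    qed
  qed
  have cyclic: "\<exists>k::int. s = t [^]\<^bsub>W\<^esub> k" if s: "s \<in> carrier W" for s
  proof -
    obtain g where g: "g \<in> carrier V" "s = H #>\<^bsub>V\<^esub> g"
      using s by (auto simp: W_def FactGroup_def RCOSETS_def)
    then obtain f where f: "v f = Some g" by (auto simp: V_simps values_of_def)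
    obtain q r where r: "r \<noteq> 0" "f = of_poly q / of_poly r" by (rule ratfun_cases)
    have "f \<noteq> 0" using f valuationD(3)[OF valuation, of f] by auto
    then have "q \<noteq> 0" using r by auto
    obtain c i where ci: "of_poly q \<approx> const c * p ^ i" using span[OF \<open>q \<noteq> 0\<close>] by blast
    obtain d j where dj: "of_poly r \<approx> const d * p ^ j" using span[OF \<open>r \<noteq> 0\<close>] by blast
    have cd: "c \<noteq> 0" "d \<noteq> 0" using eqv_imp_zero_iff[OF ci] eqv_imp_zero_iff[OF dj] \<open>q \<noteq> 0\<close> r by auto
    have "f \<approx> (const c * p ^ i) / (const d * p ^ j)" unfolding r by (intro eqv_divide ci dj)
    also have "(const c * p ^ i) / (const d * p ^ j) = const (c / d) * (p ^ i * inverse (p ^ j))"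
      using cd p by (simp add: field_simps)
    finally have vf: "v f = v (const (c / d) * (p ^ i * inverse (p ^ j)))" using v_eq by blast
    obtain h where h: "v (const (c / d)) = Some h" using vSome[of "const (c / d)"] cd by auto
    then have hH: "h \<in> H" unfolding H_def values_of_def by blast
    have "v (p ^ i * inverse (p ^ j)) = Some (\<beta> [^]\<^bsub>V\<^esub> (int i - int j))"
      using vmult[OF vpow vinv[OF vpow], of i j] \<beta>V
      by (simp add: V.int_pow_diff int_pow_int)
    then have "g = h \<otimes>\<^bsub>V\<^esub> \<beta> [^]\<^bsub>V\<^esub> (int i - int j)"
      using vmult[OF h] vf f by simp
    then have "s = (H #>\<^bsub>V\<^esub> h) \<otimes>\<^bsub>W\<^esub> t [^]\<^bsub>W\<^esub> (int i - int j)"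
      using vV[OF h] \<beta>V g(2) t_pow by simp
    also have "H #>\<^bsub>V\<^esub> h = \<one>\<^bsub>W\<^esub>" using coset_one vV[OF h] hH by blast
    finally have "s = t [^]\<^bsub>W\<^esub> (int i - int j)"
      using Q.l_one[OF Q.int_pow_closed[OF tQ]] by (simp only:)
    then show ?thesis by blast
  qed
  have "Z_independent W {t}"
    unfolding Z_independent_def
  proof (intro conjI allI impI ballI)
    show "{t} \<subseteq> carrier W" using tQ by simp
    fix T :: "'g set set" and m :: "'g set \<Rightarrow> int" and s
    assume T: "finite T \<and> T \<subseteq> {t} \<and> finprod W (\<lambda>t. t [^]\<^bsub>W\<^esub> m t) T = \<one>\<^bsub>W\<^esub>"
      and "s \<in> T"
    then have "T = {t}" "s = t" by auto
    have "finprod W (\<lambda>t. t [^]\<^bsub>W\<^esub> m t) {t} = t [^]\<^bsub>W\<^esub> m t \<otimes>\<^bsub>W\<^esub> finprod W (\<lambda>t. t [^]\<^bsub>W\<^esub> m t) {}"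
      using tQ by (intro Q.finprod_insert) auto
    also have "\<dots> = t [^]\<^bsub>W\<^esub> m t"
      unfolding Q.finprod_empty by (rule Q.r_one[OF Q.int_pow_closed[OF tQ]])
    finally have "t [^]\<^bsub>W\<^esub> m t = \<one>\<^bsub>W\<^esub>" using T unfolding \<open>T = {t}\<close> by (elim conjE) (rule trans[OF sym])
    then show "m s = 0" unfolding \<open>s = t\<close> by (rule t_nontorsion)
  qed
  moreover have "card S \<le> 1" if S: "finite S" "Z_independent W S" for S
  proof (rule ccontr)
    assume "\<not> card S \<le> 1"
    then obtain s1 s2 where s: "s1 \<in> S" "s2 \<in> S" "s1 \<noteq> s2"
      using card_le_Suc0_iff_eq[OF S(1)] by auto
    then have sQ: "s1 \<in> carrier W" "s2 \<in> carrier W"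
      using S(2) by (auto simp: Z_independent_def)
    then obtain a b :: int where ab: "s1 = t [^]\<^bsub>W\<^esub> a" "s2 = t [^]\<^bsub>W\<^esub> b"
      using cyclic by meson
    define m where "m s = (if s = s1 then b else - a)" for s
    have m: "m s1 = b" "m s2 = - a" using s(3) by (simp_all add: m_def)
    have "finprod W (\<lambda>s. s [^]\<^bsub>W\<^esub> m s) {s1, s2}
        = s1 [^]\<^bsub>W\<^esub> m s1 \<otimes>\<^bsub>W\<^esub> finprod W (\<lambda>s. s [^]\<^bsub>W\<^esub> m s) {s2}"
      using sQ s(3) by (intro Q.finprod_insert) auto
    also have "finprod W (\<lambda>s. s [^]\<^bsub>W\<^esub> m s) {s2}
        = s2 [^]\<^bsub>W\<^esub> m s2 \<otimes>\<^bsub>W\<^esub> finprod W (\<lambda>s. s [^]\<^bsub>W\<^esub> m s) {}"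
      using sQ by (intro Q.finprod_insert) auto
    also have "\<dots> = s2 [^]\<^bsub>W\<^esub> m s2"
      unfolding Q.finprod_empty by (rule Q.r_one[OF Q.int_pow_closed[OF sQ(2)]])
    finally have "finprod W (\<lambda>s. s [^]\<^bsub>W\<^esub> m s) {s1, s2}
        = s1 [^]\<^bsub>W\<^esub> b \<otimes>\<^bsub>W\<^esub> s2 [^]\<^bsub>W\<^esub> (- a)" unfolding m .
    also have "s1 [^]\<^bsub>W\<^esub> b \<otimes>\<^bsub>W\<^esub> s2 [^]\<^bsub>W\<^esub> (- a) = t [^]\<^bsub>W\<^esub> (a * b + b * (- a))"
      unfolding ab using tQ by (simp only: Q.int_pow_pow Q.int_pow_mult)
    also have "\<dots> = \<one>\<^bsub>W\<^esub>" by (simp add: mult.commute)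
    finally have one: "finprod W (\<lambda>s. s [^]\<^bsub>W\<^esub> m s) {s1, s2} = \<one>\<^bsub>W\<^esub>" .
    have "\<forall>s\<in>{s1, s2}. m s = 0"
      by (rule S(2)[unfolded Z_independent_def, THEN conjunct2, THEN spec, THEN spec, THEN mp])
        (use one s in simp)
    then have "b = 0" "a = 0" using m by auto
    then show False using ab s(3) by simp
  qed
  ultimately show ?thesis
    unfolding value_transcendental_def has_rational_rank_def V_def[symmetric] H_def[symmetric] W_def[symmetric]
    by (intro conjI exI[of _ "{t}"]) simp_all
qed


lemma residue_sum_of_consts:
  assumes t: "1 \<preceq> t" and c: "\<And>i. i \<le> n \<Longrightarrow> 1 \<preceq> const (c i)"
  defines "E \<equiv> generate_field F (residues_of G v (range const) \<union> {residue t})"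
  shows "residue (\<Sum>i\<le>n. const (c i) * t ^ i) \<in> E \<and> 1 \<preceq> (\<Sum>i\<le>n. const (c i) * t ^ i)"
  using c
proof (induction n)
  case 0
  have "residue (const (c 0)) \<in> residues_of G v (range const)"
    unfolding residues_of_eq using 0 by (intro imageI) simp
  then show ?case using 0 by (simp add: E_def generate_field.incl)
next
  case (Suc n)
  let ?S = "\<Sum>i\<le>n. const (c i) * t ^ i"
  have S: "residue ?S \<in> E" "1 \<preceq> ?S" using Suc by auto
  have c: "1 \<preceq> const (c (Suc n))" using Suc.prems by simp
  then have "residue (const (c (Suc n))) \<in> residues_of G v (range const)"
    unfolding residues_of_eq by (intro imageI) simp
  then have 1: "residue (const (c (Suc n))) \<in> E" by (simp add: E_def generate_field.incl)
  have 2: "residue (t ^ m) \<in> E" for m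
  proof (induction m)
    case 0
    then show ?case by (simp add: E_def residue_simps generate_field.one)
  next
    case (Suc m)
    have "residue t \<in> E" by (simp add: E_def generate_field.incl)
    then show ?case
      using Suc residue_power[OF t, of m] t by (simp add: E_def residue_simps(2) generate_field.eng_mult)
  qed
  have t': "1 \<preceq> t ^ Suc n" using residue_power[OF t] by blast
  have ct: "1 \<preceq> const (c (Suc n)) * t ^ Suc n" using ge_one_mult[OF c t'] .
  have "residue (const (c (Suc n)) * t ^ Suc n) \<in> E"
    using residue_simps(2)[OF c t'] 1 2[of "Suc n"] by (simp add: E_def generate_field.eng_mult del: power_Suc)
  then have "residue (?S + const (c (Suc n)) * t ^ Suc n) \<in> E"
    using residue_simps(3)[OF S(2) ct] S(1) by (simp add: E_def generate_field.eng_add del: power_Suc)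
  moreover have "1 \<preceq> ?S + const (c (Suc n)) * t ^ Suc n" using S(2) ct by (rule le_add)
  ultimately show ?case by simp
qed

lemma subfield_residues_of_const: "subfield (residues_of G v (range const)) F"
proof -
  interpret F: field F by (rule field_F)
  interpret residue: ring_hom_ring \<O> F residue by (rule residue_hom)
  have sub: "subring (range const \<inter> carrier \<O>) \<O>"
  proof (rule residue.R.subringI)
    show "\<one>\<^bsub>\<O>\<^esub> \<in> range const \<inter> carrier \<O>" using const_simps(2) by (metis IntI O_simps(2,5) le_refl rangeI)
    fix a b assume a: "a \<in> range const \<inter> carrier \<O>" and b: "b \<in> range const \<inter> carrier \<O>"
    then obtain c d where cd: "a = const c" "b = const d" by auto
    have "- a = const (- c)" "a * b = const (c * d)" "a + b = const (c + d)" by (simp_all add: cd)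
    then have "- a \<in> range const" "a * b \<in> range const" "a + b \<in> range const" by blast+
    then show "\<ominus>\<^bsub>\<O>\<^esub> a \<in> range const \<inter> carrier \<O>" "a \<otimes>\<^bsub>\<O>\<^esub> b \<in> range const \<inter> carrier \<O>"
      "a \<oplus>\<^bsub>\<O>\<^esub> b \<in> range const \<inter> carrier \<O>"
      using a b a_inv_O[of a] ge_one_mult[of a b] le_add[of 1 a b] by auto
  qed auto
  show ?thesis
    unfolding residues_of_eq
  proof (rule F.subfieldI')
    show "subring (residue ` (range const \<inter> carrier \<O>)) F"
      by (rule residue.img_is_subring[OF sub])
    fix k assume "k \<in> residue ` (range const \<inter> carrier \<O>) - {\<zero>\<^bsub>F\<^esub>}"
    then have "k \<in> residue ` (range const \<inter> carrier \<O>)" and k0: "k \<noteq> \<zero>\<^bsub>F\<^esub>" by blast+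
    then obtain f where "k = residue f" "f \<in> range const" "1 \<preceq> f" using O_simps(5) by blast
    then obtain c where c: "1 \<preceq> const c" "k = residue (const c)" by blast
    then have "\<not> 1 \<prec> const c" using residue_eq_zero_iff k0 by blast
    then have "const c \<approx> 1" using unit_iff c(1) by auto
    then have "1 \<preceq> const (inverse c)" "inv\<^bsub>F\<^esub> k = residue (const (inverse c))"
      using inverse_ge_one[of "const c"] residue_inverse[of "const c"] c by simp_all
    then show "inv\<^bsub>F\<^esub> k \<in> residue ` (range const \<inter> carrier \<O>)" by (auto simp del: const_inverse)
  qed
qed

text \<open>
  Polynomials over the residue field are lists with the leading coefficient first; their values at
  the residue of \<open>t\<close> lift to polynomials in \<open>t\<close> over \<open>K\<close>.
\<close>

lemma eval_residue:
  assumes t: "1 \<preceq> t" and p: "set p \<subseteq> residues_of G v (range const)"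
  shows "\<exists>c. (\<forall>i. 1 \<preceq> const (c i)) \<and> (p \<noteq> [] \<longrightarrow> hd p = residue (const (c (length p - 1))))
      \<and> ring.eval F p (residue t) = residue (\<Sum>i<length p. const (c i) * t ^ i)"
proof -
  interpret F: field F by (rule field_F)
  show ?thesis
    using p
  proof (induction p)
    case Nil
    show ?case by (intro exI[of _ "\<lambda>_. 1"]) (simp add: residue_simps)
  next
    case (Cons a p)
    then obtain c where c: "\<forall>i. 1 \<preceq> const (c i)"
      "F.eval p (residue t) = residue (\<Sum>i<length p. const (c i) * t ^ i)" by auto
    obtain d where d: "a = residue (const d)" "1 \<preceq> const d"
      using Cons.prems by (auto simp: residues_of_eq)
    define c' where "c' = c(length p := d)"
    have tn: "1 \<preceq> t ^ length p" "residue (t ^ length p) = residue t [^]\<^bsub>F\<^esub> length p"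
      using residue_power[OF t] by blast+
    have S: "1 \<preceq> (\<Sum>i<length p. const (c i) * t ^ i)"
      using c residue_power[OF t] by (intro le_sum ge_one_mult) auto
    have "F.eval (a # p) (residue t)
        = a \<otimes>\<^bsub>F\<^esub> residue t [^]\<^bsub>F\<^esub> length p \<oplus>\<^bsub>F\<^esub> F.eval p (residue t)" by simp
    also have "\<dots> = residue (const d * t ^ length p + (\<Sum>i<length p. const (c i) * t ^ i))"
      using d tn S c ge_one_mult[OF d(2) tn(1)] by (simp add: residue_simps)
    also have "const d * t ^ length p + (\<Sum>i<length p. const (c i) * t ^ i)
        = (\<Sum>i<length (a # p). const (c' i) * t ^ i)"
      by (simp add: c'_def add.commute)
    finally have "F.eval (a # p) (residue t) = residue (\<Sum>i<length (a # p). const (c' i) * t ^ i)" .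
    moreover have "\<forall>i. 1 \<preceq> const (c' i)" using c d by (simp add: c'_def)
    moreover have "hd (a # p) = residue (const (c' (length (a # p) - 1)))" by (simp add: c'_def d)
    ultimately show ?case by blast
  qed
qed

text \<open>
  The residue of \<open>t\<close> is a transcendence basis that even generates the residue field: numerator and
  denominator of a unit can be divided by a common constant so as to become units, and then their
  residues are polynomials in the residue of \<open>t\<close>.
\<close>

lemma residue_transcendentalI:
  assumes "adjoins_residue (value_le G v)"
  shows "residue_transcendental G v"
proof -
  obtain t where t: "1 \<preceq> t"
    and indep: "\<And>c n i. i \<le> n \<Longrightarrow> (\<Sum>i\<le>n. const (c i) * t ^ i) \<preceq> const (c i)"
    and span: "\<And>q. q \<noteq> 0 \<Longrightarrow> \<exists>n c. of_poly q \<prec> of_poly q - (\<Sum>i\<le>n. const (c i) * t ^ i)"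
    using assms unfolding adjoins_residue_def by auto
  define k where "k = residues_of G v (range const)"
  define \<tau> where "\<tau> = residue t"
  define E where "E = generate_field F (k \<union> {\<tau>})"
  interpret F: field F by (rule field_F)
  have \<tau>F: "\<tau> \<in> carrier F" unfolding \<tau>_def by (rule residue_simps(1)[OF t])
  have k: "subfield k F" unfolding k_def by (rule subfield_residues_of_const)
  then have kF: "k \<subseteq> carrier F" by (rule subfieldE(3))
  then have E: "subfield E F" unfolding E_def using \<tau>F by (intro F.generate_field_is_subfield) auto
  have gen_k: "generate_field F k = k"
    using F.generate_field_min_subfield1[OF kF k] generate_field.incl[of _ k F] by blast
  have "F.transcendental k \<tau>"
  proof -
    have "a_kernel (univ_poly F k) F (\<lambda>p. F.eval p \<tau>) = {[]}"
    proof
      show "a_kernel (univ_poly F k) F (\<lambda>p. F.eval p \<tau>) \<subseteq> {[]}"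
      proof
        fix p assume "p \<in> a_kernel (univ_poly F k) F (\<lambda>p. F.eval p \<tau>)"
        then have p: "p \<in> carrier (univ_poly F k)" "F.eval p \<tau> = \<zero>\<^bsub>F\<^esub>"
          by (auto simp: a_kernel_def')
        show "p \<in> {[]}"
        proof (rule ccontr)
          assume "p \<notin> {[]}"
          then have ne: "p \<noteq> []" "set p \<subseteq> k" "hd p \<noteq> \<zero>\<^bsub>F\<^esub>"
            using p(1) by (auto simp: univ_poly_def polynomial_def)
          then obtain c where c: "\<And>i. 1 \<preceq> const (c i)" "hd p = residue (const (c (length p - 1)))"
            "F.eval p \<tau> = residue (\<Sum>i<length p. const (c i) * t ^ i)"
            using eval_residue[OF t, of p] unfolding k_def \<tau>_def by auto
          obtain m where m: "length p = Suc m" using ne by (cases p) auto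
          let ?S = "\<Sum>i\<le>m. const (c i) * t ^ i"
          have "1 \<preceq> ?S" using c(1) residue_power[OF t] by (intro le_sum ge_one_mult) auto
          moreover have "residue ?S = \<zero>\<^bsub>F\<^esub>" using c(3) p(2) by (simp add: m lessThan_Suc_atMost)
          ultimately have "1 \<prec> ?S" using residue_eq_zero_iff by blast
          then have "1 \<prec> const (c m)" using indep[of m m c] lt_le_trans by blast
          then have "hd p = \<zero>\<^bsub>F\<^esub>" using c(2) m residue_eq_zero_iff[OF c(1)] by simp
          then show False using ne by simp
        qed
      qed
    qed (auto simp: a_kernel_def' univ_poly_def polynomial_def)
    then show ?thesis
      using F.trivial_ker_imp_transcendental[OF subfieldE(1)[OF k] \<tau>F] by (simp add: over_def)
  qed
  moreover have "y \<in> E" if y: "y \<in> carrier F" for y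
  proof -
    obtain f where f: "1 \<preceq> f" "y = residue f" using y carrier_F by auto
    show ?thesis
    proof (cases "1 \<prec> f")
      case True
      then have "y = \<zero>\<^bsub>F\<^esub>" using f residue_eq_zero_iff by blast
      then show ?thesis unfolding E_def using F.zero_in_generate by blast
    next
      case False
      have f1: "f \<approx> 1" using False f unit_iff by auto
      obtain q r where qr: "r \<noteq> 0" "f = of_poly q / of_poly r" by (rule ratfun_cases)
      have "f \<noteq> 0" using f1 by auto
      then have "q \<noteq> 0" using qr by auto
      have scale: "\<exists>c. c \<noteq> 0 \<and> of_poly p \<approx> const c" if p: "p \<noteq> 0" for p
      proof -
        obtain n c where c: "of_poly p \<prec> of_poly p - (\<Sum>i\<le>n. const (c i) * t ^ i)"
          using span[OF p] by blast
        let ?S = "\<Sum>i\<le>n. const (c i) * t ^ i"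
        have S: "of_poly p \<approx> ?S" by (rule lt_diff_eqv[OF c])
        obtain i where i: "i \<le> n" "const (c i) * t ^ i \<preceq> ?S"
          by (rule least_term[of "{..n}" "\<lambda>i. const (c i) * t ^ i"]) auto
        have "const (c i) \<preceq> const (c i) * t ^ i"
          using le_mult[of 1 "t ^ i" "const (c i)"] residue_power[OF t, of i] by simp
        then have "const (c i) \<approx> ?S" using i indep[of i n c] le_trans unfolding eqv_def by blast
        then have *: "of_poly p \<approx> const (c i)" using S eqv_sym eqv_trans by blast
        then show ?thesis using p eqv_imp_zero_iff[OF *] by (intro exI[of _ "c i"]) auto
      qed
      have in_E: "residue (of_poly p / const a) \<in> E" "of_poly p / const a \<approx> 1"
        if p: "p \<noteq> 0" and "a \<noteq> 0" and pa: "of_poly p \<approx> const a" for p a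
      proof -
        obtain n c where c: "of_poly p \<prec> of_poly p - (\<Sum>i\<le>n. const (c i) * t ^ i)"
          using span[OF p] by blast
        let ?S = "\<Sum>i\<le>n. const (c i) * t ^ i" and ?S' = "\<Sum>i\<le>n. const (c i / a) * t ^ i"
        have S': "?S' = ?S / const a" by (simp add: sum_divide_distrib)
        have S: "?S \<approx> const a" using lt_diff_eqv[OF c] pa eqv_sym eqv_trans by blast
        have "1 \<preceq> const (c i / a)" if "i \<le> n" for i
        proof -
          have "const a \<preceq> const (c i)"
            using eqv_le_trans[OF eqv_sym[OF S] indep[OF that]] .
          then have "const a * inverse (const a) \<preceq> const (c i) * inverse (const a)"
            using \<open>a \<noteq> 0\<close> by (simp only: le_mult_iff' nonzero_imp_inverse_nonzero const_eq_0_iff not_False_eq_True)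
          then show ?thesis using \<open>a \<noteq> 0\<close> by (simp add: divide_inverse)
        qed
        then have SE: "residue ?S' \<in> E" "1 \<preceq> ?S'"
          using residue_sum_of_consts[OF t, of n "\<lambda>i. c i / a"] unfolding E_def k_def \<tau>_def by blast+
        show 1: "of_poly p / const a \<approx> 1"
          using eqv_divide[OF pa eqv_refl[of "const a"]] \<open>a \<noteq> 0\<close> by simp
        have "const a * inverse (const a) \<prec> (of_poly p - ?S) * inverse (const a)"
          using eqv_lt_trans[OF eqv_sym[OF pa] c] \<open>a \<noteq> 0\<close> by (subst lt_mult_iff') simp_all
        then have "1 \<prec> of_poly p / const a - ?S'"
          using \<open>a \<noteq> 0\<close> unfolding S' by (simp add: divide_inverse algebra_simps)
        then have "residue (of_poly p / const a) = residue ?S'"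
          using residue_eq_iff SE(2) 1 unfolding eqv_def by blast
        then show "residue (of_poly p / const a) \<in> E" using SE by simp
      qed
      obtain a where a: "a \<noteq> 0" "of_poly r \<approx> const a" using scale[OF qr(1)] by blast
      have "f * of_poly r \<approx> 1 * const a" by (intro eqv_mult f1 a)
      then have q: "of_poly q \<approx> const a" using qr by simp
      let ?q = "of_poly q / const a" and ?r = "of_poly r / const a"
      note qE = in_E[OF \<open>q \<noteq> 0\<close> a(1) q] and rE = in_E[OF qr(1) a]
      have "f = ?q * inverse ?r" using a qr by (simp add: field_simps)
      then have "y = residue ?q \<otimes>\<^bsub>F\<^esub> inv\<^bsub>F\<^esub> residue ?r"
        using f residue_simps(2)[of ?q "inverse ?r"] residue_inverse[OF rE(2)] inverse_ge_one[OF rE(2)]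
          qE(2) unfolding eqv_def by simp
      moreover have "residue ?r \<noteq> \<zero>\<^bsub>F\<^esub>"
        using rE(2) residue_eq_zero_iff[of ?r] unfolding eqv_def lt_def by blast
      ultimately show ?thesis
        using qE(1) rE(1) unfolding E_def by (auto intro: generate_field.eng_mult generate_field.m_inv)
    qed
  qed
  then have "F.algebraic E y" if "y \<in> carrier F" for y
    using F.algebraic_self[OF subfieldE(1)[OF E], of y] that by (simp add: over_def)
  ultimately have "transcendence_basis F k {\<tau>}"
    using \<tau>F gen_k unfolding transcendence_basis_def E_def by simp
  then show ?thesis
    unfolding residue_transcendental_def has_transcendence_degree_def k_def
    by (intro exI[of _ "{\<tau>}"]) simp
qed

end

section \<open>Pseudo-convergence\<close>

text \<open>
  Along the filter \<open>F\<close> the elements of \<open>K\<close> approach each other, in the sense of the valuation, more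
  closely than they approach any given \<open>a \<in> K\<close>: this is the filter form of a pseudo-convergent family
  without limit in \<open>K\<close>.  The embedding \<open>emb\<close> makes the same lemmas available for \<open>K\<close> itself, before any
  extension has been constructed, and for \<open>K(x)\<close>.
\<close>

locale pseudo_limit = valuation_preorder le
  for le :: "'l::field \<Rightarrow> 'l \<Rightarrow> bool" (infix "\<preceq>" 50) +
  fixes emb :: "'k::field \<Rightarrow> 'l" and F :: "'k filter"
  assumes emb_add [simp]: "emb (a + b) = emb a + emb b"
    and emb_mult [simp]: "emb (a * b) = emb a * emb b"
    and emb_eq_0_iff [simp]: "emb a = 0 \<longleftrightarrow> a = 0"
    and F_nonbot: "F \<noteq> bot"
    and F_pseudo: "\<exists>P. eventually P F \<and> (\<forall>c d. P c \<longrightarrow> P d \<longrightarrow> emb (d - a) \<prec> emb (d - c))"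
begin

notation lt (infix "\<prec>" 50)
notation eqv (infix "\<approx>" 50)

lemma emb_0 [simp]: "emb 0 = 0" by simp

lemma emb_1 [simp]: "emb 1 = 1"
proof -
  have "emb 1 * emb 1 = emb 1 * 1" by (simp flip: emb_mult)
  then show ?thesis by (subst (asm) mult_cancel_left) simp
qed

lemma emb_minus [simp]: "emb (- a) = - emb a"
proof -
  have "emb a + emb (- a) = 0" by (simp flip: emb_add)
  then show ?thesis by (simp add: eq_neg_iff_add_eq_0 add.commute)
qed

lemma emb_diff [simp]: "emb (a - b) = emb a - emb b"
  using emb_add[of a "- b"] by simp

lemma emb_power [simp]: "emb (a ^ n) = emb a ^ n"
  by (induction n) simp_all

definition ev :: "'k poly \<Rightarrow> 'l \<Rightarrow> 'l" where
  "ev p x = poly (map_poly emb p) x"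

lemma ev_simps [simp]:
  "ev 0 x = 0" "ev (pCons a p) x = emb a + x * ev p x"
  by (simp_all add: ev_def map_poly_pCons)

lemma ev_emb [simp]: "ev p (emb c) = emb (poly p c)"
  by (induction p) simp_all

text \<open>
  The polynomials \<open>H i\<close> are the Hasse derivatives of \<open>p\<close>.  They are built by Horner's rule, which works in
  every characteristic.
\<close>

lemma taylor:
  assumes deg: "Polynomial.degree p > 0"
  obtains H :: "nat \<Rightarrow> 'k poly" where
    "\<And>c y. ev p (emb c + y) = emb (poly p c) + (\<Sum>i\<in>{1..Polynomial.degree p}. emb (poly (H i) c) * y ^ i)"
    "\<And>i. i > 0 \<Longrightarrow> Polynomial.degree (H i) < Polynomial.degree p"
    "H (Polynomial.degree p) = [:Polynomial.lead_coeff p:]"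
proof -
  have "\<exists>H :: nat \<Rightarrow> 'k poly.
      (\<forall>c y. ev p (emb c + y) = (\<Sum>i\<le>n. emb (poly (H i) c) * y ^ i))
      \<and> H 0 = p \<and> (\<forall>i. Polynomial.degree (H i) \<le> n - i) \<and> H n = [:Polynomial.coeff p n:]
      \<and> (\<forall>i>n. H i = 0)"
    if "Polynomial.degree p \<le> n" for n
    using that
  proof (induction p arbitrary: n)
    case 0
    then show ?case by (intro exI[of _ "\<lambda>_. 0"]) simp
  next
    case (pCons a p)
    show ?case
    proof (cases n)
      case 0
      then have "p = 0" using pCons.prems by (cases "p = 0") simp_all
      then show ?thesis using 0 by (intro exI[of _ "\<lambda>i. if i = 0 then [:a:] else 0"]) simp
    next
      case (Suc m)
      have "Polynomial.degree p \<le> m" using pCons.prems Suc by (cases "p = 0") simp_all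
      then obtain H :: "nat \<Rightarrow> 'k poly" where
        H: "\<And>c y. ev p (emb c + y) = (\<Sum>i\<le>m. emb (poly (H i) c) * y ^ i)"
          "H 0 = p" "\<And>i. Polynomial.degree (H i) \<le> m - i" "H m = [:Polynomial.coeff p m:]"
          "\<And>i. i > m \<Longrightarrow> H i = 0"
        using pCons.IH by blast
      define H' where "H' i = (case i of 0 \<Rightarrow> pCons a p | Suc j \<Rightarrow> pCons 0 (H i) + H j)" for i
      have "ev (pCons a p) (emb c + y) = (\<Sum>i\<le>n. emb (poly (H' i) c) * y ^ i)" for c y
      proof -
        have "(\<Sum>i\<le>n. emb (poly (H' i) c) * y ^ i)
            = emb (poly (pCons a p) c) + (\<Sum>i\<le>m. emb (poly (pCons 0 (H (Suc i)) + H i) c) * y ^ Suc i)"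
          unfolding Suc by (subst sum.atMost_Suc_shift) (simp add: H'_def)
        also have "(\<Sum>i\<le>m. emb (poly (pCons 0 (H (Suc i)) + H i) c) * y ^ Suc i)
            = emb c * (\<Sum>i\<le>m. emb (poly (H (Suc i)) c) * y ^ Suc i) + y * (\<Sum>i\<le>m. emb (poly (H i) c) * y ^ i)"
          by (simp add: sum.distrib sum_distrib_left algebra_simps)
        also have "(\<Sum>i\<le>m. emb (poly (H (Suc i)) c) * y ^ Suc i)
            = (\<Sum>i\<le>Suc m. emb (poly (H i) c) * y ^ i) - emb (poly p c)"
          by (subst sum.atMost_Suc_shift) (simp add: H(2))
        also have "(\<Sum>i\<le>Suc m. emb (poly (H i) c) * y ^ i) = (\<Sum>i\<le>m. emb (poly (H i) c) * y ^ i)"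
          by (simp add: H(5))
        finally show ?thesis unfolding ev_simps H(1) by (simp add: algebra_simps)
      qed
      moreover have "Polynomial.degree (H' i) \<le> n - i" for i
      proof (cases i)
        case 0
        then show ?thesis using pCons.prems by (simp add: H'_def)
      next
        case i: (Suc j)
        have "Polynomial.degree (pCons 0 (H i)) \<le> m - j"
        proof (cases "H i = 0")
          case False
          then have "i \<le> m" using H(5)[of i] by (meson not_le_imp_less)
          then show ?thesis using H(3)[of i] i False by simp
        qed simp
        then show ?thesis
          using H(3)[of j] Suc i by (simp add: H'_def Polynomial.degree_add_le)
      qed
      moreover have "H' n = [:Polynomial.coeff (pCons a p) n:]" using Suc H(4) H(5)[of n] by (simp add: H'_def)
      moreover have "\<forall>i>n. H' i = 0"
        using Suc H(5) by (auto simp: H'_def split: nat.split)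
      moreover have "H' 0 = pCons a p" by (simp add: H'_def)
      ultimately show ?thesis by blast
    qed
  qed
  then obtain H :: "nat \<Rightarrow> 'k poly" where
    H: "\<And>c y. ev p (emb c + y) = (\<Sum>i\<le>Polynomial.degree p. emb (poly (H i) c) * y ^ i)"
      "H 0 = p" "\<And>i. Polynomial.degree (H i) \<le> Polynomial.degree p - i"
      "H (Polynomial.degree p) = [:Polynomial.lead_coeff p:]"
    by blast
  show ?thesis
  proof (rule that)
    show "ev p (emb c + y) = emb (poly p c)
        + (\<Sum>i\<in>{1..Polynomial.degree p}. emb (poly (H i) c) * y ^ i)" for c y
    proof -
      have "{..Polynomial.degree p} = insert 0 {1..Polynomial.degree p}" by auto
      then show ?thesis by (simp add: H(1,2))
    qed
    show "Polynomial.degree (H i) < Polynomial.degree p" if "i > 0" for i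
      using H(3)[of i] that deg by linarith
  qed (use H in simp)
qed

text \<open>
  Two elements far out in \<open>F\<close> are closer to each other than to \<open>c\<close>, so they have the same distance
  from \<open>c\<close>.
\<close>

lemma radius_exists: "\<exists>e. e \<noteq> 0 \<and> (\<forall>\<^sub>F d in F. emb (d - c) \<approx> emb e)"
proof -
  obtain P where P: "eventually P F" "\<And>b d. P b \<Longrightarrow> P d \<Longrightarrow> emb (d - c) \<prec> emb (d - b)"
    using F_pseudo by blast
  obtain b where b: "P b" using eventually_happens'[OF F_nonbot P(1)] by blast
  have *: "emb (d - c) \<approx> emb (b - c)" if "P d" for d
  proof -
    have "emb (d - b) = emb (d - c) - emb (b - c)" by simp
    then show ?thesis using lt_diff_eqv[of "emb (d - c)" "emb (b - c)"] P(2)[OF b that] by (simp only:)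
  qed
  show ?thesis
  proof (intro exI[of _ "b - c"] conjI)
    show "b - c \<noteq> 0" using lt_imp_nonzero[OF P(2)[OF b b]] by (simp del: emb_diff)
    show "\<forall>\<^sub>F d in F. emb (d - c) \<approx> emb (b - c)"
      using P(1) by (rule eventually_mono) (rule *)
  qed
qed

definition rad :: "'k \<Rightarrow> 'k" where
  "rad c = (SOME e. e \<noteq> 0 \<and> (\<forall>\<^sub>F d in F. emb (d - c) \<approx> emb e))"

lemma rad_nonzero: "rad c \<noteq> 0" and rad: "\<forall>\<^sub>F d in F. emb (d - c) \<approx> emb (rad c)"
  using someI_ex[OF radius_exists[of c]] by (simp_all add: rad_def)

lemma rad_increasing: "\<forall>\<^sub>F c in F. emb (rad a) \<prec> emb (rad c)"
proof -
  obtain P where P: "eventually P F" "\<And>b d. P b \<Longrightarrow> P d \<Longrightarrow> emb (d - a) \<prec> emb (d - b)"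
    using F_pseudo by blast
  have "emb (rad a) \<prec> emb (rad c)" if "P c" for c
  proof -
    have "\<forall>\<^sub>F d in F. P d \<and> emb (d - a) \<approx> emb (rad a) \<and> emb (d - c) \<approx> emb (rad c)"
      by (intro eventually_conj P(1) rad)
    then obtain d where d: "P d" "emb (d - a) \<approx> emb (rad a)" "emb (d - c) \<approx> emb (rad c)"
      using eventually_happens'[OF F_nonbot] by blast
    have "emb (rad a) \<approx> emb (d - a)" using d(2) by (rule eqv_sym)
    also have "emb (d - a) \<prec> emb (d - c)" using P(2)[OF that d(1)] .
    also have "emb (d - c) \<approx> emb (rad c)" by (rule d(3))
    finally show ?thesis .
  qed
  then show ?thesis by (rule eventually_mono[OF P(1)])
qed

definition limit :: "'l \<Rightarrow> bool" where
  "limit x \<longleftrightarrow> (\<forall>a. \<forall>\<^sub>F c in F. emb (c - a) \<prec> x - emb c)"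

lemma limit_rad:
  assumes "limit x"
  shows "x - emb c \<approx> emb (rad c)"
proof -
  have "\<forall>\<^sub>F d in F. emb (d - c) \<prec> x - emb d \<and> emb (d - c) \<approx> emb (rad c)"
    using assms rad[of c] unfolding limit_def by (simp add: eventually_conj)
  then obtain d where d: "emb (d - c) \<prec> x - emb d" "emb (d - c) \<approx> emb (rad c)"
    using eventually_happens'[OF F_nonbot] by blast
  have "x - emb c = emb (d - c) + (x - emb d)" by simp
  also have "\<dots> \<approx> emb (d - c)" by (rule lt_add_eqv[OF d(1)])
  also have "\<dots> \<approx> emb (rad c)" by (rule d(2))
  finally show ?thesis .
qed

lemma limitI:
  assumes "\<And>c. x - emb c \<approx> emb (rad c)"
  shows "limit x"
  unfolding limit_def
proof
  fix a
  show "\<forall>\<^sub>F c in F. emb (c - a) \<prec> x - emb c"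
    using rad[of a] rad_increasing[of a]
  proof eventually_elim
    case (elim c)
    show ?case by (rule eqv_lt_trans[OF elim(1) lt_eqv_trans[OF elim(2) eqv_sym[OF assms]]])
  qed
qed

text \<open>
  The value of \<open>p\<close> is eventually constant along \<open>F\<close>.
\<close>

definition fixed :: "'k poly \<Rightarrow> bool" where
  "fixed p \<longleftrightarrow> (\<exists>e. \<forall>\<^sub>F c in F. emb (poly p c) \<approx> emb e)"

text \<open>
  If a monomial of lower degree is not larger than one of higher degree at some radius, then it is
  strictly smaller at all larger radii.  So any two of the monomials are eventually comparable, always
  in the same way and strictly, and one monomial is eventually the smallest.
\<close>

lemma dominant_index:
  assumes "finite I" "I \<noteq> {}" "\<forall>i\<in>I. e i \<noteq> 0"
  shows "\<exists>h\<in>I. \<forall>\<^sub>F c in F. \<forall>j\<in>I - {h}. emb (e h * rad c ^ h) \<prec> emb (e j * rad c ^ j)"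
proof -
  have compare: "(\<forall>\<^sub>F c in F. emb (e i * rad c ^ i) \<prec> emb (e j * rad c ^ j))
      \<or> (\<forall>\<^sub>F c in F. emb (e j * rad c ^ j) \<prec> emb (e i * rad c ^ i))"
    if "i < j" and e: "e i \<noteq> 0" "e j \<noteq> 0" for i j
  proof (cases "\<exists>b. emb (e i * rad b ^ i) \<preceq> emb (e j * rad b ^ j)")
    case True
    then obtain b where b: "emb (e i * rad b ^ i) \<preceq> emb (e j * rad b ^ j)" by blast
    have ji: "x ^ j = x ^ i * x ^ (j - i)" for x :: 'l
      using \<open>i < j\<close> by (simp flip: power_add)
    have b': "emb (e i) \<preceq> emb (e j) * emb (rad b) ^ (j - i)"
      using b le_mult_iff[of "emb (rad b) ^ i" "emb (e i)" "emb (e j) * emb (rad b) ^ (j - i)"]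
        rad_nonzero[of b] by (simp add: ji mult_ac)
    have "emb (e i * rad c ^ i) \<prec> emb (e j * rad c ^ j)" if c: "emb (rad b) \<prec> emb (rad c)" for c
    proof -
      have "emb (e j) * emb (rad b) ^ (j - i) \<prec> emb (e j) * emb (rad c) ^ (j - i)"
        using lt_power[OF c, of "j - i"] \<open>i < j\<close> e by (simp add: lt_mult_iff)
      with b' have "emb (e i) \<prec> emb (e j) * emb (rad c) ^ (j - i)" by (rule le_lt_trans)
      then have "emb (rad c) ^ i * emb (e i) \<prec> emb (rad c) ^ i * (emb (e j) * emb (rad c) ^ (j - i))"
        using rad_nonzero[of c] by (simp add: lt_mult_iff)
      then show ?thesis by (simp add: ji mult_ac)
    qed
    then have "\<forall>\<^sub>F c in F. emb (e i * rad c ^ i) \<prec> emb (e j * rad c ^ j)"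
      by (rule eventually_mono[OF rad_increasing[of b]])
    then show ?thesis ..
  qed (simp add: lt_def)
  show ?thesis
    using assms
  proof (induction rule: finite_ne_induct)
    case (insert i I)
    then obtain h where h: "h \<in> I"
      "\<forall>\<^sub>F c in F. \<forall>j\<in>I - {h}. emb (e h * rad c ^ h) \<prec> emb (e j * rad c ^ j)"
      by auto
    have "i \<noteq> h" using h insert by auto
    then consider "\<forall>\<^sub>F c in F. emb (e h * rad c ^ h) \<prec> emb (e i * rad c ^ i)"
      | "\<forall>\<^sub>F c in F. emb (e i * rad c ^ i) \<prec> emb (e h * rad c ^ h)"
      using compare[of i h] compare[of h i] insert.prems h(1) \<open>i \<noteq> h\<close>
      by (cases "i < h") auto
    then show ?case
    proof cases
      case 1
      with h(2) have "\<forall>\<^sub>F c in F. \<forall>j\<in>insert i I - {h}. emb (e h * rad c ^ h) \<prec> emb (e j * rad c ^ j)"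
        by eventually_elim blast
      then show ?thesis using h(1) by blast
    next
      case 2
      with h(2) have "\<forall>\<^sub>F c in F. \<forall>j\<in>insert i I - {i}. emb (e i * rad c ^ i) \<prec> emb (e j * rad c ^ j)"
      proof eventually_elim
        case (elim c)
        show ?case
        proof
          fix j assume j: "j \<in> insert i I - {i}"
          show "emb (e i * rad c ^ i) \<prec> emb (e j * rad c ^ j)"
          proof (cases "j = h")
            case False
            then have "emb (e h * rad c ^ h) \<prec> emb (e j * rad c ^ j)" using elim(1) j by blast
            with elim(2) show ?thesis by (rule lt_trans)
          qed (use elim(2) in simp)
        qed
      qed
      then show ?thesis by blast
    qed
  qed auto
qed

text \<open>
  The Taylor coefficients of \<open>p\<close> have lower degree, hence eventually constant values, and by
  \<open>dominant_index\<close> one term of the expansion of \<open>p (c + y) - p c\<close> determines its value.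
\<close>

lemma increment:
  assumes deg: "Polynomial.degree p > 0"
    and lower: "\<forall>q. Polynomial.degree q < Polynomial.degree p \<longrightarrow> fixed q"
  shows "\<exists>h e. h > 0 \<and> e \<noteq> 0 \<and>
    (\<forall>\<^sub>F c in F. \<forall>y. y \<approx> emb (rad c) \<longrightarrow> ev p (emb c + y) - emb (poly p c) \<approx> emb (e * rad c ^ h))"
proof -
  let ?n = "Polynomial.degree p"
  obtain H :: "nat \<Rightarrow> 'k poly" where
    H: "\<And>c y. ev p (emb c + y) = emb (poly p c) + (\<Sum>i\<in>{1..?n}. emb (poly (H i) c) * y ^ i)"
      "\<And>i. i > 0 \<Longrightarrow> Polynomial.degree (H i) < ?n"
      "H ?n = [:Polynomial.lead_coeff p:]"
    by (rule taylor[OF deg]) (rule that; assumption)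
  have "\<exists>e. \<forall>\<^sub>F c in F. emb (poly (H i) c) \<approx> emb e" if "i > 0" for i
    using lower[rule_format, OF H(2)[OF that]] by (simp add: fixed_def)
  note ex = this
  define e where "e i = (SOME e. \<forall>\<^sub>F c in F. emb (poly (H i) c) \<approx> emb e)" for i
  have e: "\<forall>\<^sub>F c in F. emb (poly (H i) c) \<approx> emb (e i)" if "i > 0" for i
    unfolding e_def by (rule someI_ex[OF ex[OF that]])
  define I where "I = {i \<in> {1..?n}. e i \<noteq> 0}"
  have "e ?n \<noteq> 0"
  proof
    assume "e ?n = 0"
    moreover have "p \<noteq> 0" using deg by auto
    ultimately show False using e[OF deg] F_nonbot by (simp add: H(3) eventually_False)
  qed
  then have "?n \<in> I" using deg by (simp add: I_def)
  then have I: "finite I" "I \<noteq> {}" "\<forall>i\<in>I. e i \<noteq> 0" by (auto simp: I_def)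
  obtain h where h: "h \<in> I"
    "\<forall>\<^sub>F c in F. \<forall>j\<in>I - {h}. emb (e h * rad c ^ h) \<prec> emb (e j * rad c ^ j)"
    using dominant_index[where e = e, OF I] by (elim bexE) (rule that; assumption)
  have "\<forall>\<^sub>F c in F. \<forall>i\<in>{1..?n}. emb (poly (H i) c) \<approx> emb (e i)"
    by (intro eventually_ball_finite) (simp_all add: e)
  with h(2) have "\<forall>\<^sub>F c in F. \<forall>y. y \<approx> emb (rad c) \<longrightarrow> ev p (emb c + y) - emb (poly p c) \<approx> emb (e h * rad c ^ h)"
  proof eventually_elim
    case (elim c)
    show ?case
    proof (intro allI impI)
      fix y assume y: "y \<approx> emb (rad c)"
      have eqv_term: "emb (poly (H i) c) * y ^ i \<approx> emb (e i * rad c ^ i)" if "i \<in> {1..?n}" for i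
        using eqv_mult[OF _ eqv_power[OF y], of "emb (poly (H i) c)" "emb (e i)" i] elim(2) that by simp
      have hI: "h \<in> {1..?n}" "e h \<noteq> 0" using h(1) by (auto simp: I_def)
      have ne: "emb (e h * rad c ^ h) \<noteq> 0" using hI rad_nonzero[of c] by simp
      have "(\<Sum>i\<in>{1..?n}. emb (poly (H i) c) * y ^ i) \<approx> emb (poly (H h) c) * y ^ h"
      proof (rule dominant_sum)
        show "emb (poly (H h) c) * y ^ h \<noteq> 0"
          using eqv_imp_zero_iff[OF eqv_term[OF hI(1)]] ne by blast
        fix j assume j: "j \<in> {1..?n}" "j \<noteq> h"
        have "emb (e h * rad c ^ h) \<prec> emb (e j * rad c ^ j)"
        proof (cases "e j = 0")
          case False
          then have "j \<in> I - {h}" using j by (simp add: I_def)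
          then show ?thesis using elim(1) by (elim bspec[rotated])
        qed (use ne in simp)
        then show "emb (poly (H h) c) * y ^ h \<prec> emb (poly (H j) c) * y ^ j"
          by (rule eqv_lt_trans[OF eqv_term[OF hI(1)] lt_eqv_trans[OF _ eqv_sym[OF eqv_term[OF j(1)]]]])
      qed (use hI in auto)
      then show "ev p (emb c + y) - emb (poly p c) \<approx> emb (e h * rad c ^ h)"
        using eqv_trans[OF _ eqv_term[OF hI(1)]] by (simp only: H(1) add_diff_cancel_left')
    qed
  qed
  moreover have "h > 0" "e h \<noteq> 0" using h(1) by (auto simp: I_def)
  ultimately show ?thesis by (intro exI[of _ h] exI[of _ "e h"] conjI)
qed

lemma fixed_const: "Polynomial.degree p = 0 \<Longrightarrow> fixed p"
  by (elim degree_eq_zeroE) (auto simp: fixed_def intro!: exI[of _ "Polynomial.coeff p 0"])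

lemma increment_in_field:
  assumes "\<forall>y. y \<approx> emb (rad c) \<longrightarrow> ev p (emb c + y) - emb (poly p c) \<approx> z"
  shows "\<forall>\<^sub>F d in F. emb (poly p d) - emb (poly p c) \<approx> z"
  using rad[of c]
proof eventually_elim
  case (elim d)
  have "emb c + emb (d - c) = emb d" by simp
  then show ?case using assms[rule_format, OF elim] by (simp only: ev_emb)
qed

text \<open>
  The increments of \<open>p\<close> are nonzero, so \<open>p\<close> cannot vanish eventually.
\<close>

lemma fixed_nonzero:
  assumes "p \<noteq> 0" "\<forall>q. Polynomial.degree q < Polynomial.degree p \<longrightarrow> fixed q"
  shows "\<exists>\<^sub>F c in F. poly p c \<noteq> 0"
proof (cases "Polynomial.degree p = 0")
  case True
  then show ?thesis using assms(1) F_nonbot by (auto simp: frequently_def elim!: degree_eq_zeroE)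
next
  case False
  then have deg: "Polynomial.degree p > 0" by simp
  obtain h e where he: "e \<noteq> 0"
    "\<forall>\<^sub>F c in F. \<forall>y. y \<approx> emb (rad c) \<longrightarrow> ev p (emb c + y) - emb (poly p c) \<approx> emb (e * rad c ^ h)"
    using increment[OF deg assms(2)] by (elim exE conjE) (rule that; assumption)
  show ?thesis
    unfolding frequently_def
  proof
    assume "\<forall>\<^sub>F c in F. \<not> poly p c \<noteq> 0"
    then have Z: "\<forall>\<^sub>F c in F. poly p c = 0" by simp
    obtain c where c: "poly p c = 0"
      "\<forall>y. y \<approx> emb (rad c) \<longrightarrow> ev p (emb c + y) - emb (poly p c) \<approx> emb (e * rad c ^ h)"
      using eventually_happens'[OF F_nonbot eventually_conj[OF Z he(2)]] by blast
    obtain d where "poly p d = 0" "emb (poly p d) - emb (poly p c) \<approx> emb (e * rad c ^ h)"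
      using eventually_happens'[OF F_nonbot eventually_conj[OF Z increment_in_field[OF c(2)]]] by blast
    then show False using c he(1) rad_nonzero[of c] by simp
  qed
qed

text \<open>
  Increments \<open>p d - p c\<close> with \<open>c\<close> and \<open>d\<close> far out have at least the eventual value of \<open>p\<close>.  Since the value of
  the increments depends strictly monotonically on \<open>c\<close>, that of \<open>p x - p c\<close> eventually exceeds it.
\<close>

lemma fixed_approx:
  assumes "p \<noteq> 0" and lower: "\<forall>q. Polynomial.degree q < Polynomial.degree p \<longrightarrow> fixed q"
    and "fixed p" and x: "limit x"
  shows "\<forall>\<^sub>F c in F. ev p x \<prec> ev p x - emb (poly p c)"
proof (cases "Polynomial.degree p = 0")
  case True
  then show ?thesis using assms(1) by (auto elim!: degree_eq_zeroE)
next
  case False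
  then have deg: "Polynomial.degree p > 0" by simp
  obtain h e where he: "h > 0" "e \<noteq> 0"
    "\<forall>\<^sub>F c in F. \<forall>y. y \<approx> emb (rad c) \<longrightarrow> ev p (emb c + y) - emb (poly p c) \<approx> emb (e * rad c ^ h)"
    using increment[OF deg lower] by (elim exE conjE) (rule that; assumption)
  obtain z where z: "\<forall>\<^sub>F c in F. emb (poly p c) \<approx> emb z" using \<open>fixed p\<close> by (auto simp: fixed_def)
  obtain b where b: "emb (poly p b) \<approx> emb z"
    "\<forall>y. y \<approx> emb (rad b) \<longrightarrow> ev p (emb b + y) - emb (poly p b) \<approx> emb (e * rad b ^ h)"
    using eventually_happens'[OF F_nonbot eventually_conj[OF z he(3)]] by blast
  obtain d where d: "emb (poly p d) \<approx> emb z" "emb (poly p d) - emb (poly p b) \<approx> emb (e * rad b ^ h)"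
    using eventually_happens'[OF F_nonbot eventually_conj[OF z increment_in_field[OF b(2)]]] by blast
  have "emb z \<preceq> emb (poly p d) - emb (poly p b)"
    using b(1) d(1) by (intro le_diff) (auto simp: eqv_def)
  then have zb: "emb z \<preceq> emb (e * rad b ^ h)" using d(2) by (rule le_eqv_trans)
  show ?thesis
    using z he(3) rad_increasing[of b]
  proof eventually_elim
    case (elim c)
    have "emb (e * rad b ^ h) \<prec> emb (e * rad c ^ h)"
      using lt_power[OF elim(3) he(1)] he(2) by (simp add: lt_mult_iff)
    with zb have 1: "emb z \<prec> emb (e * rad c ^ h)" by (rule le_lt_trans)
    have "ev p (emb c + (x - emb c)) - emb (poly p c) \<approx> emb (e * rad c ^ h)"
      using elim(2) limit_rad[OF x] by blast
    then have 2: "ev p x - emb (poly p c) \<approx> emb (e * rad c ^ h)" by simp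
    have 3: "emb z \<prec> ev p x - emb (poly p c)" by (rule lt_eqv_trans[OF 1 eqv_sym[OF 2]])
    have "emb (poly p c) \<prec> ev p x - emb (poly p c)" by (rule eqv_lt_trans[OF elim(1) 3])
    then have "ev p x \<approx> emb (poly p c)" using lt_add_eqv[of "emb (poly p c)" "ev p x - emb (poly p c)"] by simp
    then have "ev p x \<approx> emb z" using elim(1) by (rule eqv_trans)
    then show ?case using 3 by (rule eqv_lt_trans)
  qed
qed

text \<open>
  If \<open>p c\<close> and the increments starting at \<open>c\<close> had different values, the smaller of the two would be the
  value of \<open>p d\<close> for all later \<open>d\<close>, and \<open>p\<close> would have an eventually constant value.
\<close>

lemma nonfixed_growth:
  assumes lower: "\<forall>q. Polynomial.degree q < Polynomial.degree p \<longrightarrow> fixed q" and "\<not> fixed p"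
  obtains h e where "h > 0" "e \<noteq> 0" "\<forall>\<^sub>F c in F. emb (poly p c) \<approx> emb (e * rad c ^ h)"
    "\<And>x. limit x \<Longrightarrow> \<forall>\<^sub>F c in F. emb (poly p c) \<preceq> ev p x"
proof -
  have deg: "Polynomial.degree p > 0" using \<open>\<not> fixed p\<close> fixed_const by blast
  obtain h e where he: "h > 0" "e \<noteq> 0"
    "\<forall>\<^sub>F c in F. \<forall>y. y \<approx> emb (rad c) \<longrightarrow> ev p (emb c + y) - emb (poly p c) \<approx> emb (e * rad c ^ h)"
    using increment[OF deg lower] by (elim exE conjE) (rule that; assumption)
  have *: "emb (poly p c) \<approx> emb (e * rad c ^ h)"
    if c: "\<forall>y. y \<approx> emb (rad c) \<longrightarrow> ev p (emb c + y) - emb (poly p c) \<approx> emb (e * rad c ^ h)" for c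
  proof (rule ccontr)
    assume "\<not> ?thesis"
    then consider "emb (poly p c) \<prec> emb (e * rad c ^ h)" | "emb (e * rad c ^ h) \<prec> emb (poly p c)"
      using lt_or_eqv_or_gt by blast
    then have "fixed p"
    proof cases
      case 1
      have "\<forall>\<^sub>F d in F. emb (poly p d) \<approx> emb (poly p c)"
        using increment_in_field[OF c]
      proof eventually_elim
        case (elim d)
        have "emb (poly p c) \<prec> emb (poly p d) - emb (poly p c)"
          by (rule lt_eqv_trans[OF 1 eqv_sym[OF elim]])
        then show ?case
          using lt_add_eqv[of "emb (poly p c)" "emb (poly p d) - emb (poly p c)"] by simp
      qed
      then show ?thesis by (auto simp: fixed_def)
    next
      case 2
      have "\<forall>\<^sub>F d in F. emb (poly p d) \<approx> emb (e * rad c ^ h)"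
        using increment_in_field[OF c]
      proof eventually_elim
        case (elim d)
        have "emb (poly p d) - emb (poly p c) \<prec> emb (poly p c)" by (rule eqv_lt_trans[OF elim 2])
        then have "emb (poly p d) \<approx> emb (poly p d) - emb (poly p c)"
          using lt_add_eqv[of "emb (poly p d) - emb (poly p c)" "emb (poly p c)"] by simp
        then show ?case using elim by (rule eqv_trans)
      qed
      then show ?thesis unfolding fixed_def by (rule exI)
    qed
    then show False using \<open>\<not> fixed p\<close> by simp
  qed
  show ?thesis
  proof (rule that[OF he(1,2)])
    show "\<forall>\<^sub>F c in F. emb (poly p c) \<approx> emb (e * rad c ^ h)"
      using he(3) by (rule eventually_mono) (rule *)
    fix x assume x: "limit x"
    show "\<forall>\<^sub>F c in F. emb (poly p c) \<preceq> ev p x"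
      using he(3)
    proof eventually_elim
      case (elim c)
      have "ev p (emb c + (x - emb c)) - emb (poly p c) \<approx> emb (e * rad c ^ h)"
        using elim limit_rad[OF x] by blast
      then have "ev p x - emb (poly p c) \<approx> emb (e * rad c ^ h)" by simp
      with *[OF elim] have "emb (poly p c) \<approx> ev p x - emb (poly p c)"
        using eqv_trans[OF _ eqv_sym] by blast
      then have "emb (poly p c) \<preceq> ev p x - emb (poly p c)" by (simp add: eqv_def)
      then have "emb (poly p c) \<preceq> (ev p x - emb (poly p c)) + emb (poly p c)" by (intro le_add) simp_all
      then show ?case by simp
    qed
  qed
qed

end

section \<open>Approximation types\<close>

context field_valuation
begin

lemma v_eq_iff: "v a = v b \<longleftrightarrow> a \<approx> b"
  using eqv_iff_value_eq[OF valuation] by blast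

lemma vless_iff: "vless G (v a) (v b) \<longleftrightarrow> a \<prec> b"
  using le_cases[of a b] by (auto simp: vless_def v_eq_iff value_le_def[symmetric] lt_def eqv_def)

lemma in_values_iff: "\<gamma> \<in> Some ` values_of v UNIV \<longleftrightarrow> (\<exists>d. d \<noteq> 0 \<and> \<gamma> = v d)"
proof
  assume "\<gamma> \<in> Some ` values_of v UNIV"
  then obtain d g where "\<gamma> = Some g" "v d = Some g" by (auto simp: values_of_def)
  then show "\<exists>d. d \<noteq> 0 \<and> \<gamma> = v d" using valuationD(3)[OF valuation, of d] by (intro exI[of _ d]) auto
next
  assume "\<exists>d. d \<noteq> 0 \<and> \<gamma> = v d"
  then obtain d where d: "d \<noteq> 0" "\<gamma> = v d" by blast
  then obtain g where "v d = Some g" using valuationD(3)[OF valuation, of d] by auto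
  then show "\<gamma> \<in> Some ` values_of v UNIV" using d by (auto simp: values_of_def)
qed

lemma v_0: "v 0 = None"
  using valuationD(3)[OF valuation, of 0] by simp

lemma closed_ball_eq: "closed_ball G v (v d) c = (ClosedBall, v d, {a. d \<preceq> a - c})"
  by (simp add: closed_ball_def value_le_def)

lemma open_ball_eq: "open_ball G v (v d) c = (OpenBall, v d, {a. d \<prec> a - c})"
  by (simp add: open_ball_def vless_iff)

lemma closed_recenter: "d \<preceq> c - b \<Longrightarrow> {a. d \<preceq> a - c} = {a. d \<preceq> a - b}"
  using le_add[of d "_ - c" "c - b"] le_diff[of d "_ - b" "c - b"] by force

lemma open_recenter: "d \<prec> c - b \<Longrightarrow> {a. d \<prec> a - c} = {a. d \<prec> a - b}"
  using lt_add[of d "_ - c" "c - b"] lt_diff[of d "_ - b" "c - b"] by force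

end

text \<open>
  Radii are represented by field elements: \<open>cl d\<close> and \<open>op d\<close> are the closed and the open ball of radius
  \<open>v d\<close>, empty if the type has no such ball.
\<close>

locale approx_type = field_valuation G v
  for G :: "'g ogroup" and v :: "'k::field \<Rightarrow> 'g option" +
  fixes A :: "('k, 'g) ball set"
  assumes nontrivial: "A \<in> nontrivial_types G v"
begin

definition cl :: "'k \<Rightarrow> 'k set" where "cl d = closed_at A (v d)"
definition op :: "'k \<Rightarrow> 'k set" where "op d = open_at A (v d)"

lemma type_A: "approximation_type G v A" and None_supp: "None \<notin> supp A"
  using nontrivial by (simp_all add: nontrivial_types_def)

lemma mem_closed:
  assumes "(ClosedBall, \<gamma>, B) \<in> A" "c \<in> B"
  shows "\<exists>d. d \<noteq> 0 \<and> \<gamma> = v d \<and> B = {a. d \<preceq> a - c}"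
proof -
  have "(ClosedBall, \<gamma>, B) \<in> balls G v" using type_A assms(1) unfolding approximation_type_def by blast
  then obtain b where b: "(ClosedBall, \<gamma>, B) = closed_ball G v \<gamma> b" "\<gamma> \<in> insert None (Some ` values_of v UNIV)"
    by (auto simp: balls_def closed_ball_def open_ball_def)
  have "\<gamma> \<in> supp A" using assms(1) unfolding supp_def by blast
  then have "\<gamma> \<noteq> None" using None_supp by metis
  then obtain d where d: "d \<noteq> 0" "\<gamma> = v d" using b(2) in_values_iff by blast
  then have B: "B = {a. d \<preceq> a - b}" using b(1) closed_ball_eq by simp
  then have "B = {a. d \<preceq> a - c}" using closed_recenter[of d c b] assms(2) by simp
  then show ?thesis using d by blast
qed

lemma mem_open:
  assumes "(OpenBall, \<gamma>, B) \<in> A"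
  shows "\<exists>d b. d \<noteq> 0 \<and> \<gamma> = v d \<and> B = {a. d \<prec> a - b}"
proof -
  have "(OpenBall, \<gamma>, B) \<in> balls G v" using type_A assms(1) unfolding approximation_type_def by blast
  then obtain b where b: "(OpenBall, \<gamma>, B) = open_ball G v \<gamma> b" "\<gamma> \<in> Some ` values_of v UNIV"
    by (auto simp: balls_def closed_ball_def open_ball_def)
  then obtain d where d: "d \<noteq> 0" "\<gamma> = v d" using in_values_iff by blast
  then have "B = {a. d \<prec> a - b}" using b(1) open_ball_eq by simp
  then show ?thesis using d by blast
qed

lemma cl_iff: "c \<in> cl d \<longleftrightarrow> closed_ball G v (v d) c \<in> A"
proof
  assume "c \<in> cl d"
  then obtain B where B: "(ClosedBall, v d, B) \<in> A" "c \<in> B" by (auto simp: cl_def closed_at_def)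
  then obtain e where "v d = v e" "B = {a. e \<preceq> a - c}" using mem_closed by blast
  then show "closed_ball G v (v d) c \<in> A" using B closed_ball_eq[of e c] by simp
next
  assume "closed_ball G v (v d) c \<in> A"
  then show "c \<in> cl d"
    unfolding closed_ball_eq cl_def closed_at_def by (intro UnionI[of "{a. d \<preceq> a - c}"]) auto
qed

lemma op_iff: "c \<in> op d \<longleftrightarrow> open_ball G v (v d) c \<in> A"
proof
  assume "c \<in> op d"
  then obtain B where B: "(OpenBall, v d, B) \<in> A" "c \<in> B" by (auto simp: op_def open_at_def)
  then obtain e b where e: "v d = v e" "B = {a. e \<prec> a - b}" using mem_open by blast
  then have "B = {a. e \<prec> a - c}" using open_recenter[of e c b] B(2) by simp
  then show "open_ball G v (v d) c \<in> A" using B e open_ball_eq[of e c] by simp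
next
  assume o: "open_ball G v (v d) c \<in> A"
  then obtain e b where "e \<noteq> 0" "v d = v e" using mem_open unfolding open_ball_eq by blast
  then have "d \<noteq> 0" using v_eq_iff by auto
  then show "c \<in> op d"
    using o unfolding open_ball_eq op_def open_at_def by (intro UnionI[of "{a. d \<prec> a - c}"]) auto
qed

lemma cl_nonzero: "c \<in> cl d \<Longrightarrow> d \<noteq> 0"
proof -
  assume "c \<in> cl d"
  then have "(ClosedBall, v d, {a. d \<preceq> a - c}) \<in> A" unfolding cl_iff closed_ball_eq .
  from mem_closed[OF this, of c] obtain e where "e \<noteq> 0" "v d = v e" by auto
  then show "d \<noteq> 0" using v_eq_iff by auto
qed

lemma comparable: "(k, \<gamma>, B) \<in> A \<Longrightarrow> (k', \<gamma>', B') \<in> A \<Longrightarrow> B \<subseteq> B' \<or> B' \<subseteq> B"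
  using type_A unfolding approximation_type_def by blast

lemma cl_ball:
  assumes c: "c \<in> cl d"
  shows "b \<in> cl d \<longleftrightarrow> d \<preceq> b - c"
proof
  assume "b \<in> cl d"
  then have "{a. d \<preceq> a - b} \<subseteq> {a. d \<preceq> a - c} \<or> {a. d \<preceq> a - c} \<subseteq> {a. d \<preceq> a - b}"
    using c comparable unfolding cl_iff closed_ball_eq by blast
  moreover have "b \<in> {a. d \<preceq> a - b}" "c \<in> {a. d \<preceq> a - c}" by simp_all
  ultimately have "d \<preceq> b - c \<or> d \<preceq> c - b" by blast
  then show "d \<preceq> b - c" by (simp add: minus_commute_le)
next
  assume "d \<preceq> b - c"
  then show "b \<in> cl d" using c closed_recenter[of d b c] unfolding cl_iff closed_ball_eq by simp
qed

lemma op_cl: "c \<in> op d \<Longrightarrow> c \<in> cl d"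
  using type_A unfolding approximation_type_def op_iff cl_iff by blast

lemma op_ball:
  assumes c: "c \<in> op d"
  shows "b \<in> op d \<longleftrightarrow> d \<prec> b - c"
proof
  have d: "d \<noteq> 0" using cl_nonzero[OF op_cl[OF c]] .
  assume "b \<in> op d"
  then have "{a. d \<prec> a - b} \<subseteq> {a. d \<prec> a - c} \<or> {a. d \<prec> a - c} \<subseteq> {a. d \<prec> a - b}"
    using c comparable unfolding op_iff open_ball_eq by blast
  moreover have "b \<in> {a. d \<prec> a - b}" "c \<in> {a. d \<prec> a - c}" using d by simp_all
  ultimately have "d \<prec> b - c \<or> d \<prec> c - b" by blast
  then show "d \<prec> b - c" by (simp add: minus_commute_lt)
next
  assume "d \<prec> b - c"
  then show "b \<in> op d" using c open_recenter[of d b c] unfolding op_iff open_ball_eq by simp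
qed

lemma cl_down: "c \<in> cl d \<Longrightarrow> e \<prec> d \<Longrightarrow> c \<in> op e"
proof -
  assume c: "c \<in> cl d" and "e \<prec> d"
  then have "e \<noteq> 0" by (simp add: lt_imp_nonzero)
  then obtain g where g: "v e = Some g" "g \<in> values_of v UNIV" using in_values_iff[of "v e"] by auto
  then have "vless G (Some g) (v d)" using \<open>e \<prec> d\<close> vless_iff[of e d] by simp
  moreover have "\<forall>\<gamma> c. closed_ball G v \<gamma> c \<in> A \<or> open_ball G v \<gamma> c \<in> A \<longrightarrow>
          (\<forall>\<beta>\<in>values_of v UNIV. vless G (Some \<beta>) \<gamma> \<longrightarrow>
             closed_ball G v (Some \<beta>) c \<in> A \<and> open_ball G v (Some \<beta>) c \<in> A)"
    using type_A unfolding approximation_type_def by blast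
  ultimately have "open_ball G v (Some g) c \<in> A" using c g(2) unfolding cl_iff by blast
  then show "c \<in> op e" unfolding op_iff g(1) .
qed

lemma cl_cong: "d \<approx> e \<Longrightarrow> cl d = cl e" and op_cong: "d \<approx> e \<Longrightarrow> op d = op e"
  by (simp_all add: cl_def op_def v_eq_iff[symmetric])

lemma cl_mono: "c \<in> cl d \<Longrightarrow> e \<preceq> d \<Longrightarrow> c \<in> cl e"
  using cl_down[of c d e] op_cl cl_cong le_cases[of e d] by blast

lemma supp_iff: "v d \<in> supp A \<longleftrightarrow> cl d \<noteq> {}"
proof
  assume "v d \<in> supp A"
  then obtain B where B: "(ClosedBall, v d, B) \<in> A" by (auto simp: supp_def)
  then have "(ClosedBall, v d, B) \<in> balls G v" using type_A unfolding approximation_type_def by blast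
  then obtain b where "B = {a. vle G (v d) (v (a - b))}"
    by (auto simp: balls_def closed_ball_def open_ball_def)
  then have "b \<in> B" by (simp add: v_0)
  then have "b \<in> cl d" using B by (auto simp: cl_def closed_at_def)
  then show "cl d \<noteq> {}" by blast
qed (auto simp: cl_def closed_at_def supp_def)

lemma supp_eq: "supp A = v ` {d. cl d \<noteq> {}}"
proof
  show "supp A \<subseteq> v ` {d. cl d \<noteq> {}}"
  proof
    fix \<gamma> assume g: "\<gamma> \<in> supp A"
    then obtain B where B: "(ClosedBall, \<gamma>, B) \<in> A" by (auto simp: supp_def)
    then have "(ClosedBall, \<gamma>, B) \<in> balls G v" using type_A unfolding approximation_type_def by blast
    then have "\<gamma> \<in> insert None (Some ` values_of v UNIV)"
      by (auto simp: balls_def closed_ball_def open_ball_def)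
    then obtain d where "\<gamma> = v d" using in_values_iff[of \<gamma>] v_0 by (metis insertE)
    then show "\<gamma> \<in> v ` {d. cl d \<noteq> {}}" using g supp_iff by blast
  qed
qed (use supp_iff in blast)

lemma ball_cases:
  assumes "(k, \<gamma>, B) \<in> A"
  obtains d c where "k = ClosedBall" "c \<in> cl d" "\<gamma> = v d" "B = cl d"
  | d c where "k = OpenBall" "c \<in> op d" "\<gamma> = v d" "B = op d"
proof (cases k)
  case ClosedBall
  then have "\<gamma> \<in> supp A" using assms by (auto simp: supp_def)
  then obtain d where d: "\<gamma> = v d" using supp_eq by auto
  have "(ClosedBall, \<gamma>, B) \<in> balls G v" using type_A assms ClosedBall unfolding approximation_type_def by blast
  then obtain b where "B = {a. vle G (v d) (v (a - b))}"
    using d by (auto simp: balls_def closed_ball_def open_ball_def)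
  then have B: "B = {a. d \<preceq> a - b}" by (simp add: value_le_def)
  then have "(ClosedBall, v d, {a. d \<preceq> a - b}) \<in> A" using assms d ClosedBall by simp
  then have b: "b \<in> cl d" unfolding cl_iff closed_ball_eq .
  then have "B = cl d" using cl_ball[OF b] B by blast
  then show ?thesis using that(1) ClosedBall b d by blast
next
  case OpenBall
  then obtain d b where d: "\<gamma> = v d" and B: "B = {a. d \<prec> a - b}" using mem_open assms by blast
  then have "(OpenBall, v d, {a. d \<prec> a - b}) \<in> A" using assms d OpenBall by simp
  then have b: "b \<in> op d" unfolding op_iff open_ball_eq .
  then have "B = op d" using op_ball[OF b] B by blast
  then show ?thesis using that(2) OpenBall b d by blast
qed

lemma cl_in_A: "c \<in> cl d \<Longrightarrow> (ClosedBall, v d, cl d) \<in> A"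
proof -
  assume c: "c \<in> cl d"
  then have "cl d = {a. d \<preceq> a - c}" using cl_ball by blast
  then show ?thesis using c unfolding cl_iff closed_ball_eq by simp
qed

lemma op_in_A: "c \<in> op d \<Longrightarrow> (OpenBall, v d, op d) \<in> A"
proof -
  assume c: "c \<in> op d"
  then have "op d = {a. d \<prec> a - c}" using op_ball by blast
  then show ?thesis using c unfolding op_iff open_ball_eq by simp
qed

lemma inter_iff: "c \<in> inter A \<longleftrightarrow> (\<forall>d. cl d \<noteq> {} \<longrightarrow> c \<in> cl d) \<and> (\<forall>d. op d \<noteq> {} \<longrightarrow> c \<in> op d)"
proof
  assume "c \<in> inter A"
  then have c: "c \<in> B" if "(k, \<gamma>, B) \<in> A" for k \<gamma> B using that by (auto simp: inter_def)
  then show "(\<forall>d. cl d \<noteq> {} \<longrightarrow> c \<in> cl d) \<and> (\<forall>d. op d \<noteq> {} \<longrightarrow> c \<in> op d)"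
    using cl_in_A op_in_A by blast
next
  assume c: "(\<forall>d. cl d \<noteq> {} \<longrightarrow> c \<in> cl d) \<and> (\<forall>d. op d \<noteq> {} \<longrightarrow> c \<in> op d)"
  have "c \<in> B" if "(k, \<gamma>, B) \<in> A" for k \<gamma> B
    using that by (rule ball_cases) (use c in blast)+
  then show "c \<in> inter A" by (auto simp: inter_def)
qed

end

text \<open>
  A non-trivial type is recovered from the balls \<open>cl d\<close> and \<open>op d\<close>, since by \<open>ball_cases\<close> each of its
  members is one of them.
\<close>

lemma approx_type_eqI:
  assumes "approx_type G v A" "approx_type G v A'"
    and cl: "\<And>d. approx_type.cl v A d = approx_type.cl v A' d"
    and op: "\<And>d. approx_type.op v A d = approx_type.op v A' d"
  shows "A = A'"
proof -
  have *: "B \<subseteq> B'" if "approx_type G v B" "approx_type G v B'"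
    "\<And>d. approx_type.cl v B d = approx_type.cl v B' d" "\<And>d. approx_type.op v B d = approx_type.op v B' d" for B B'
  proof
    interpret B: approx_type G v B by (rule that(1))
    interpret B': approx_type G v B' by (rule that(2))
    fix ball assume ball: "ball \<in> B"
    obtain k \<gamma> S where kgS: "ball = (k, \<gamma>, S)" by (cases ball)
    have "(k, \<gamma>, S) \<in> B" using ball kgS by simp
    then have "(k, \<gamma>, S) \<in> B'"
      by (rule B.ball_cases) (use B'.cl_in_A B'.op_in_A that(3,4) in auto)
    then show "ball \<in> B'" using kgS by simp
  qed
  show ?thesis using *[of A A'] *[of A' A] assms by auto
qed

section \<open>The approximation type of the variable\<close>

text \<open>
  All that is used of an extension is that it orders the constants as \<open>v0\<close> does.
\<close>

locale extension_of = base: field_valuation G0 v0 + ratfun_valuation G v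
  for G0 :: "'g ogroup" and v0 :: "'k::field \<Rightarrow> 'g option"
    and G :: "'h ogroup" and v :: "'k ratfun \<Rightarrow> 'h option" +
  assumes const_le: "const a \<preceq> const b \<longleftrightarrow> value_le G0 v0 a b"
begin

lemma const_lt: "const a \<prec> const b \<longleftrightarrow> base.lt a b"
  by (simp add: lt_def base.lt_def const_le)

lemma const_eqv: "const a \<approx> const b \<longleftrightarrow> base.eqv a b"
  by (simp add: eqv_def base.eqv_def const_le)

definition near_closed :: "'k \<Rightarrow> 'k set" where
  "near_closed d = {c. const d \<preceq> ratX - const c}"

definition near_open :: "'k \<Rightarrow> 'k set" where
  "near_open d = {c. const d \<prec> ratX - const c}"

lemma appr_eq:
  "appr v0 G v = {(ClosedBall, v0 d, near_closed d) | d. near_closed d \<noteq> {}}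
     \<union> {(OpenBall, v0 d, near_open d) | d. near_open d \<noteq> {}}"
proof -
  have o: "{c. vless G (v (const d)) (v (ratX - const c))} = near_open d" for d
    by (simp add: near_open_def vless_iff)
  have c: "{c. vle G (v (const d)) (v (ratX - const c))} = near_closed d" for d
    by (simp add: near_closed_def value_le_def)
  have z: "d \<noteq> 0" if "near_open d \<noteq> {}" for d
    using that by (auto simp: near_open_def)
  have 1: "{(ClosedBall, v0 d, B) | d B. B = near_closed d \<and> B \<noteq> {}}
      = {(ClosedBall, v0 d, near_closed d) | d. near_closed d \<noteq> {}}" by auto
  have 2: "{(OpenBall, v0 d, B) | d B. d \<noteq> 0 \<and> B = near_open d \<and> B \<noteq> {}}
      = {(OpenBall, v0 d, near_open d) | d. near_open d \<noteq> {}}" using z by auto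
  show ?thesis unfolding appr_def o c 1 2 ..
qed

lemma near_closed_ball: "c \<in> near_closed d \<Longrightarrow> near_closed d = {a. value_le G0 v0 d (a - c)}"
proof -
  assume c: "c \<in> near_closed d"
  have "a \<in> near_closed d \<longleftrightarrow> const d \<preceq> const (a - c)" for a
    using c le_diff[of "const d" "ratX - const c" "ratX - const a"]
      le_diff[of "const d" "ratX - const c" "const (a - c)"] by (auto simp: near_closed_def)
  then show ?thesis unfolding const_le by blast
qed

lemma near_open_ball: "c \<in> near_open d \<Longrightarrow> near_open d = {a. base.lt d (a - c)}"
proof -
  assume c: "c \<in> near_open d"
  have "a \<in> near_open d \<longleftrightarrow> const d \<prec> const (a - c)" for a
    using c lt_diff[of "const d" "ratX - const c" "ratX - const a"]
      lt_diff[of "const d" "ratX - const c" "const (a - c)"] by (auto simp: near_open_def)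
  then show ?thesis unfolding const_lt by blast
qed

lemma ratX_neq_const: "ratX \<noteq> const c"
proof
  assume "ratX = const c"
  then have "of_poly [:- c, 1:] = 0" by (simp only: of_poly_linear) simp
  then show False by (simp only: of_poly_eq_0_iff) simp
qed

lemma near_cong: "base.eqv d e \<Longrightarrow> near_closed d = near_closed e"
  "base.eqv d e \<Longrightarrow> near_open d = near_open e"
proof -
  assume "base.eqv d e"
  then have *: "const d \<approx> const e" unfolding const_eqv .
  show "near_closed d = near_closed e"
    using eqv_le_trans[OF *] eqv_le_trans[OF eqv_sym[OF *]] by (auto simp: near_closed_def)
  show "near_open d = near_open e"
    using eqv_lt_trans[OF *] eqv_lt_trans[OF eqv_sym[OF *]] by (auto simp: near_open_def)
qed

lemma closed_in_appr: "closed_ball G0 v0 \<gamma> c \<in> appr v0 G v \<longleftrightarrow> (\<exists>d. \<gamma> = v0 d \<and> c \<in> near_closed d)"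
proof
  assume "closed_ball G0 v0 \<gamma> c \<in> appr v0 G v"
  then obtain d where d: "closed_ball G0 v0 \<gamma> c = (ClosedBall, v0 d, near_closed d)"
    unfolding appr_eq closed_ball_def by auto
  then have "\<gamma> = v0 d" by (simp add: closed_ball_def)
  moreover have "c \<in> near_closed d" using d unfolding \<open>\<gamma> = v0 d\<close> base.closed_ball_eq by auto
  ultimately show "\<exists>d. \<gamma> = v0 d \<and> c \<in> near_closed d" by blast
next
  assume "\<exists>d. \<gamma> = v0 d \<and> c \<in> near_closed d"
  then obtain d where d: "\<gamma> = v0 d" "c \<in> near_closed d" by blast
  then have "closed_ball G0 v0 \<gamma> c = (ClosedBall, v0 d, near_closed d)"
    using near_closed_ball[OF d(2)] by (simp only: d(1) base.closed_ball_eq)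
  then show "closed_ball G0 v0 \<gamma> c \<in> appr v0 G v" unfolding appr_eq using d by blast
qed

lemma open_in_appr: "open_ball G0 v0 \<gamma> c \<in> appr v0 G v \<longleftrightarrow> (\<exists>d. \<gamma> = v0 d \<and> c \<in> near_open d)"
proof
  assume "open_ball G0 v0 \<gamma> c \<in> appr v0 G v"
  then obtain d where d: "open_ball G0 v0 \<gamma> c = (OpenBall, v0 d, near_open d)" "near_open d \<noteq> {}"
    unfolding appr_eq open_ball_def by auto
  then have "\<gamma> = v0 d" by (simp add: open_ball_def)
  have "d \<noteq> 0" using d(2) by (auto simp: near_open_def)
  then have "c \<in> near_open d" using d(1) unfolding \<open>\<gamma> = v0 d\<close> base.open_ball_eq by auto
  then show "\<exists>d. \<gamma> = v0 d \<and> c \<in> near_open d" using \<open>\<gamma> = v0 d\<close> by blast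
next
  assume "\<exists>d. \<gamma> = v0 d \<and> c \<in> near_open d"
  then obtain d where d: "\<gamma> = v0 d" "c \<in> near_open d" by blast
  then have "open_ball G0 v0 \<gamma> c = (OpenBall, v0 d, near_open d)"
    using near_open_ball[OF d(2)] by (simp only: d(1) base.open_ball_eq)
  then show "open_ball G0 v0 \<gamma> c \<in> appr v0 G v" unfolding appr_eq using d by blast
qed

lemma near_total: "const d \<preceq> const e \<Longrightarrow> near_closed e \<subseteq> near_closed d \<and> near_open e \<subseteq> near_open d
    \<and> near_open e \<subseteq> near_closed d"
  using le_trans[of "const d" "const e"] le_lt_trans[of "const d" "const e"]
    lt_imp_le[of "const e"] unfolding near_closed_def near_open_def by blast

lemma near_open_closed: "const d \<prec> const e \<Longrightarrow> near_closed e \<subseteq> near_open d"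
  using lt_le_trans[of "const d" "const e"] unfolding near_closed_def near_open_def by blast

text \<open>
  The balls around \<open>x\<close> are decreasing in the radius, and at equal radius the open ball lies in the
  closed one.
\<close>

lemma near_comparable:
  assumes "S \<in> {near_closed d, near_open d}" "T \<in> {near_closed e, near_open e}"
  shows "S \<subseteq> T \<or> T \<subseteq> S"
proof -
  consider "const d \<prec> const e" | "const d \<approx> const e" | "const e \<prec> const d"
    using lt_or_eqv_or_gt by blast
  then show ?thesis
  proof cases
    case 1
    then show ?thesis using assms near_open_closed[OF 1] near_total[OF lt_imp_le[OF 1]] by auto
  next
    case 2
    then have "near_closed d = near_closed e" "near_open d = near_open e"
      using near_cong unfolding const_eqv by blast+
    then show ?thesis using assms near_total[OF le_refl, of e] by auto
  next
    case 3
    then show ?thesis using assms near_open_closed[OF 3] near_total[OF lt_imp_le[OF 3]] by auto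
  qed
qed

lemma nontrivial_appr: "appr v0 G v \<in> nontrivial_types G0 v0"
proof -
  have "approximation_type G0 v0 (appr v0 G v)"
    unfolding approximation_type_def
  proof (intro conjI allI impI ballI)
    show "appr v0 G v \<subseteq> balls G0 v0"
    proof
      fix ball assume "ball \<in> appr v0 G v"
      then consider d c where "ball = (ClosedBall, v0 d, near_closed d)" "c \<in> near_closed d"
        | d c where "ball = (OpenBall, v0 d, near_open d)" "c \<in> near_open d"
        unfolding appr_eq by blast
      then show "ball \<in> balls G0 v0"
      proof cases
        case 1
        then have "ball = closed_ball G0 v0 (v0 d) c" using near_closed_ball base.closed_ball_eq by simp
        moreover have "v0 d \<in> insert None (Some ` values_of v0 UNIV)"
          using base.in_values_iff[of "v0 d"] base.v_0 by (cases "d = 0") auto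
        ultimately show ?thesis unfolding balls_def by blast
      next
        case 2
        then have "ball = open_ball G0 v0 (v0 d) c" using near_open_ball base.open_ball_eq by simp
        moreover have "d \<noteq> 0" using 2 by (auto simp: near_open_def)
        then have "v0 d \<in> Some ` values_of v0 UNIV" using base.in_values_iff[of "v0 d"] by blast
        ultimately show ?thesis unfolding balls_def by blast
      qed
    qed
    show "case x of (_, _, B) \<Rightarrow> \<forall>(_, _, B')\<in>appr v0 G v. B \<subseteq> B' \<or> B' \<subseteq> B"
      if x: "x \<in> appr v0 G v" for x
    proof -
      have "snd (snd x) \<subseteq> snd (snd y) \<or> snd (snd y) \<subseteq> snd (snd x)" if y: "y \<in> appr v0 G v" for y
      proof -
        have "\<exists>d. snd (snd z) \<in> {near_closed d, near_open d}" if "z \<in> appr v0 G v" for z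
          using that unfolding appr_eq by (elim UnE CollectE exE conjE) auto
        then show ?thesis using near_comparable x y by meson
      qed
      then show ?thesis by (fastforce simp: case_prod_beta)
    qed
    fix \<gamma> c
    assume "closed_ball G0 v0 \<gamma> c \<in> appr v0 G v \<or> open_ball G0 v0 \<gamma> c \<in> appr v0 G v"
    then obtain d where d: "\<gamma> = v0 d" "c \<in> near_closed d"
      unfolding closed_in_appr open_in_appr using near_total[OF le_refl] by blast
    fix \<beta> assume "\<beta> \<in> values_of v0 UNIV" "vless G0 (Some \<beta>) \<gamma>"
    then obtain e where "v0 e = Some \<beta>" by (auto simp: values_of_def)
    then have e: "Some \<beta> = v0 e" by simp
    have "const e \<prec> const d"
      using \<open>vless G0 (Some \<beta>) \<gamma>\<close> unfolding d(1) e base.vless_iff const_lt .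
    then have "c \<in> near_open e" using near_open_closed d(2) by blast
    then show "closed_ball G0 v0 (Some \<beta>) c \<in> appr v0 G v" "open_ball G0 v0 (Some \<beta>) c \<in> appr v0 G v"
      unfolding closed_in_appr open_in_appr using near_total[OF le_refl] e by blast+
  next
    fix \<gamma> c assume "open_ball G0 v0 \<gamma> c \<in> appr v0 G v"
    then show "closed_ball G0 v0 \<gamma> c \<in> appr v0 G v"
      unfolding closed_in_appr open_in_appr using near_total[OF le_refl] by blast
  qed
  moreover have "None \<notin> supp (appr v0 G v)"
  proof
    assume "None \<in> supp (appr v0 G v)"
    then obtain d where d: "None = v0 d" "near_closed d \<noteq> {}" unfolding appr_eq supp_def by auto
    then have "d = 0" using valuationD(3)[OF base.valuation, of d] by metis
    then show False using d(2) ratX_neq_const by (auto simp: near_closed_def)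
  qed
  ultimately show ?thesis by (simp add: nontrivial_types_def)
qed

sublocale appr: approx_type G0 v0 "appr v0 G v"
  by unfold_locales (rule nontrivial_appr)

lemma appr_cl: "appr.cl d = near_closed d"
proof -
  have "c \<in> appr.cl d \<longleftrightarrow> c \<in> near_closed d" for c
    unfolding appr.cl_iff closed_in_appr using near_cong(1) base.v_eq_iff by blast
  then show ?thesis by blast
qed

lemma appr_op: "appr.op d = near_open d"
proof -
  have "c \<in> appr.op d \<longleftrightarrow> c \<in> near_open d" for c
    unfolding appr.op_iff open_in_appr using near_cong(2) base.v_eq_iff by blast
  then show ?thesis by blast
qed

lemma appr_eqI:
  assumes "approx_type G0 v0 A"
    and "\<And>c d. c \<in> approx_type.cl v0 A d \<longleftrightarrow> const d \<preceq> ratX - const c"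
    and "\<And>c d. c \<in> approx_type.op v0 A d \<longleftrightarrow> const d \<prec> ratX - const c"
  shows "appr v0 G v = A"
  by (rule approx_type_eqI[OF appr.approx_type_axioms assms(1)])
    (use assms(2,3) in \<open>auto simp: appr_cl appr_op near_closed_def near_open_def\<close>)

end

lemma extension_imp_extension_of:
  assumes "valuation G0 v0" "extension G0 v0 G v"
  shows "extension_of G0 v0 G v"
proof -
  have "valuation G v" using assms(2) by (simp add: extension_def)
  then show ?thesis
    using assms extension_value_le[OF assms] by unfold_locales
qed

lemma appr_cong:
  assumes "extension_of G0 v0 G v" "extension_of G0 v0 H w" "value_le G v = value_le H w"
  shows "appr v0 G v = appr v0 H w"
proof -
  interpret v: extension_of G0 v0 G v by (rule assms)
  interpret w: extension_of G0 v0 H w by (rule assms)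
  have lt: "v.lt = w.lt" by (simp add: fun_eq_iff v.lt_def w.lt_def assms(3))
  show ?thesis
    by (rule v.appr_eqI[OF w.appr.approx_type_axioms])
      (simp_all add: w.appr_cl w.appr_op w.near_closed_def w.near_open_def assms(3) lt)
qed

section \<open>Immediate approximation types\<close>

locale immediate_approx = approx_type G v A
  for G :: "'g ogroup" and v :: "'k::field \<Rightarrow> 'g option" and A :: "('k, 'g) ball set" +
  assumes nonempty: "A \<noteq> {}" and inter_empty: "inter A = {}"
begin

lemma cl_exists: "\<exists>d. cl d \<noteq> {}"
proof -
  obtain ball where "ball \<in> A" using nonempty by blast
  then obtain k \<gamma> B where "(k, \<gamma>, B) \<in> A" by (cases ball) blast
  then show ?thesis by (rule ball_cases) (use op_cl in blast)+
qed

text \<open>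
  A smallest ball would be the intersection of all of them, which is empty.
\<close>

lemma no_max:
  assumes d: "cl d \<noteq> {}"
  shows "\<exists>e. cl e \<noteq> {} \<and> d \<prec> e"
proof (rule ccontr)
  assume "\<not> ?thesis"
  then have max: "e \<preceq> d" if "cl e \<noteq> {}" for e using that unfolding lt_def by blast
  obtain c where c: "c \<in> cl d" "op d \<noteq> {} \<Longrightarrow> c \<in> op d"
    using d op_cl by (cases "op d = {}") blast+
  have "c \<in> cl e" if "cl e \<noteq> {}" for e using cl_mono[OF c(1) max[OF that]] .
  moreover have "c \<in> op e" if e: "op e \<noteq> {}" for e
  proof -
    have "e \<preceq> d" using max[of e] e op_cl by blast
    then consider "e \<prec> d" | "e \<approx> d" using le_cases by blast
    then show ?thesis
    proof cases
      case 1
      then show ?thesis using cl_down c(1) by blast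
    next
      case 2
      then show ?thesis using op_cong c(2) e by blast
    qed
  qed
  ultimately have "c \<in> inter A" unfolding inter_iff by blast
  then show False using inter_empty by simp
qed

lemma excluded: "\<exists>e. cl e \<noteq> {} \<and> a \<notin> cl e"
proof -
  have "a \<notin> inter A" using inter_empty by simp
  then consider d where "cl d \<noteq> {}" "a \<notin> cl d" | d where "op d \<noteq> {}" "a \<notin> op d"
    unfolding inter_iff by blast
  then show ?thesis
  proof cases
    case 2
    then have "cl d \<noteq> {}" using op_cl by blast
    then obtain e where "cl e \<noteq> {}" "d \<prec> e" using no_max by blast
    then show ?thesis using cl_down 2(2) by blast
  qed blast
qed

text \<open>
  The closed balls of an immediate type form a filter base of nonempty sets.
\<close>

definition filt :: "'k filter" where
  "filt = (INF d\<in>{d. cl d \<noteq> {}}. principal (cl d))"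

lemma eventually_filt: "eventually P filt \<longleftrightarrow> (\<exists>d. cl d \<noteq> {} \<and> (\<forall>c\<in>cl d. P c))"
proof -
  have "eventually P filt \<longleftrightarrow> (\<exists>d\<in>{d. cl d \<noteq> {}}. eventually P (principal (cl d)))"
    unfolding filt_def
  proof (rule eventually_INF_base)
    show "{d. cl d \<noteq> {}} \<noteq> {}" using cl_exists by blast
    fix a b assume ab: "a \<in> {d. cl d \<noteq> {}}" "b \<in> {d. cl d \<noteq> {}}"
    have "\<exists>x\<in>{d. cl d \<noteq> {}}. cl x \<subseteq> cl a \<and> cl x \<subseteq> cl b"
    proof (cases "a \<preceq> b")
      case True
      then have "cl b \<subseteq> cl a" using cl_mono by blast
      then show ?thesis using ab by blast
    next
      case False
      then have "cl a \<subseteq> cl b" using cl_mono le_total[of a b] by blast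
      then show ?thesis using ab by blast
    qed
    then show "\<exists>x\<in>{d. cl d \<noteq> {}}. principal (cl x) \<le> inf (principal (cl a)) (principal (cl b))"
      by (simp add: inf_principal)
  qed
  then show ?thesis by (simp add: eventually_principal)
qed

lemma eventually_cl: "cl d \<noteq> {} \<Longrightarrow> \<forall>\<^sub>F c in filt. c \<in> cl d"
  unfolding eventually_filt by blast

text \<open>
  Given \<open>a\<close>, take a ball of the type that does not contain it: its points are closer to each other
  than to \<open>a\<close>.
\<close>

lemma pseudo_limit_filt:
  fixes emb :: "'k \<Rightarrow> 'l::field"
  assumes le': "valuation_preorder le'"
    and emb: "\<And>a b. emb (a + b) = emb a + emb b" "\<And>a b. emb (a * b) = emb a * emb b"
      "\<And>a. emb a = 0 \<longleftrightarrow> a = 0"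
    and mono: "\<And>a b. le' (emb a) (emb b) \<longleftrightarrow> a \<preceq> b"
  shows "pseudo_limit le' emb filt"
proof -
  interpret L: valuation_preorder le' by (rule le')
  have lt_iff: "L.lt (emb a) (emb b) \<longleftrightarrow> a \<prec> b" for a b by (simp add: L.lt_def lt_def mono)
  show ?thesis
  proof
    show "filt \<noteq> bot"
      unfolding eventually_False[symmetric] eventually_filt by blast
    fix a
    obtain e where e: "cl e \<noteq> {}" "a \<notin> cl e" using excluded by blast
    have "d - a \<prec> d - c" if "c \<in> cl e" "d \<in> cl e" for c d
    proof -
      have "d - a \<prec> e" using cl_ball[OF that(2), of a] e(2) unfolding lt_def by (simp add: minus_commute_le)
      also have "e \<preceq> d - c" using cl_ball[OF that(1), of d] that(2) by simp
      finally show ?thesis .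
    qed
    then show "\<exists>P. eventually P filt \<and> (\<forall>c d. P c \<longrightarrow> P d \<longrightarrow> L.lt (emb (d - a)) (emb (d - c)))"
      unfolding lt_iff using eventually_cl[OF e(1)] by (intro exI[of _ "\<lambda>c. c \<in> cl e"]) blast
  qed (rule emb)+
qed

sublocale base: pseudo_limit "value_le G v" id filt
  by (rule pseudo_limit_filt) (simp_all add: valuation_preorder_axioms)

lemma base_fixed: "base.fixed p \<longleftrightarrow> fixes_value v A p"
proof -
  have "fixes_value v A p \<longleftrightarrow> (\<exists>d. cl d \<noteq> {} \<and> (\<forall>c\<in>cl d. \<forall>c'\<in>cl d. poly p c \<approx> poly p c'))"
    unfolding fixes_value_def supp_eq cl_def[symmetric] v_eq_iff by (auto simp: cl_def[symmetric])
  also have "\<dots> \<longleftrightarrow> (\<exists>e d. cl d \<noteq> {} \<and> (\<forall>c\<in>cl d. poly p c \<approx> e))"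
  proof
    assume "\<exists>d. cl d \<noteq> {} \<and> (\<forall>c\<in>cl d. \<forall>c'\<in>cl d. poly p c \<approx> poly p c')"
    then obtain d c' where "c' \<in> cl d" "\<forall>c\<in>cl d. \<forall>c'\<in>cl d. poly p c \<approx> poly p c'" by blast
    then show "\<exists>e d. cl d \<noteq> {} \<and> (\<forall>c\<in>cl d. poly p c \<approx> e)"
      by (intro exI[of _ "poly p c'"] exI[of _ d]) blast
  next
    assume "\<exists>e d. cl d \<noteq> {} \<and> (\<forall>c\<in>cl d. poly p c \<approx> e)"
    then obtain e d where d: "cl d \<noteq> {}" "\<And>c. c \<in> cl d \<Longrightarrow> poly p c \<approx> e" by blast
    show "\<exists>d. cl d \<noteq> {} \<and> (\<forall>c\<in>cl d. \<forall>c'\<in>cl d. poly p c \<approx> poly p c')"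
    proof (intro exI[of _ d] conjI ballI)
      fix c c' assume "c \<in> cl d" "c' \<in> cl d"
      then show "poly p c \<approx> poly p c'" using d(2)[of c] eqv_sym[OF d(2)[of c']] eqv_trans[of "poly p c" e "poly p c'"] by blast
    qed (rule d)
  qed
  also have "\<dots> \<longleftrightarrow> base.fixed p"
    unfolding base.fixed_def eventually_filt by simp
  finally show ?thesis by simp
qed

text \<open>A point of \<open>K\<close> at which \<open>p\<close> has its eventual value.\<close>

definition pt :: "'k poly \<Rightarrow> 'k" where
  "pt p = (SOME b. \<forall>\<^sub>F c in filt. poly p c \<approx> poly p b)"

lemma pt:
  assumes "base.fixed p"
  shows "\<forall>\<^sub>F c in filt. poly p c \<approx> poly p (pt p)"
proof -
  obtain e where e: "\<forall>\<^sub>F c in filt. poly p c \<approx> e" using assms by (auto simp: base.fixed_def)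
  obtain b where b: "poly p b \<approx> e" using eventually_happens'[OF base.F_nonbot e] by blast
  have "\<forall>\<^sub>F c in filt. poly p c \<approx> poly p b"
    by (rule eventually_mono[OF e]) (rule eqv_trans[OF _ eqv_sym[OF b]])
  then show ?thesis unfolding pt_def by (rule someI)
qed

abbreviation eventual :: "'k poly \<Rightarrow> 'k" where
  "eventual p \<equiv> poly p (pt p)"

definition below_fixed :: "'k poly \<Rightarrow> bool" where
  "below_fixed p \<longleftrightarrow> (\<forall>q. Polynomial.degree q < Polynomial.degree p \<longrightarrow> base.fixed q)"

lemma eventual_nonzero:
  assumes "base.fixed p" "below_fixed p" "p \<noteq> 0"
  shows "eventual p \<noteq> 0"
proof
  assume 0: "eventual p = 0"
  have "\<forall>\<^sub>F c in filt. \<not> poly p c \<noteq> 0"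
    using pt[OF assms(1)] unfolding 0 by simp
  then show False
    using base.fixed_nonzero[OF assms(3)] assms(2) unfolding frequently_def below_fixed_def by blast
qed

lemma base_rad: "\<forall>\<^sub>F d in filt. d - c \<approx> base.rad c"
  using base.rad[of c] by simp

lemma linear_fixed: "Polynomial.degree p \<le> 1 \<Longrightarrow> base.fixed p"
proof -
  assume "Polynomial.degree p \<le> 1"
  then consider "Polynomial.degree p = 0" | "Polynomial.degree p = 1" by linarith
  then show ?thesis
  proof cases
    case 1
    then show ?thesis by (rule base.fixed_const)
  next
    case 2
    then obtain a b where p: "p = [:a, b:]" "b \<noteq> 0" by (metis degree1_coeffs)
    have "poly p c \<approx> b * base.rad (- a / b)" if "c - (- a / b) \<approx> base.rad (- a / b)" for c
    proof -
      have "poly p c = b * (c - (- a / b))" using p by (simp add: field_simps)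
      then show ?thesis using eqv_mult[OF eqv_refl that, of b] by simp
    qed
    then have "\<forall>\<^sub>F c in filt. poly p c \<approx> b * base.rad (- a / b)"
      by (rule eventually_mono[OF base_rad])
    then show ?thesis unfolding base.fixed_def by auto
  qed
qed

end

locale immediate_extension = extension_of G0 v0 G v + base: immediate_approx G0 v0 A
  for G0 :: "'g ogroup" and v0 :: "'k::field \<Rightarrow> 'g option"
    and G :: "'h ogroup" and v :: "'k ratfun \<Rightarrow> 'h option" and A :: "('k, 'g) ball set"
begin

sublocale X: pseudo_limit "value_le G v" const base.filt
  by (rule base.pseudo_limit_filt) (simp_all add: valuation_preorder_axioms const_le)

lemma X_fixed: "X.fixed p \<longleftrightarrow> base.base.fixed p"
  unfolding X.fixed_def base.base.fixed_def const_eqv by simp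

lemma X_ev: "X.ev p ratX = of_poly p"
  by (induction p) (simp_all add: of_poly_pCons)

lemma X_rad: "const (X.rad c) \<approx> const (base.base.rad c)"
proof -
  have "\<forall>\<^sub>F d in base.filt. const (d - c) \<approx> const (X.rad c) \<and> base.eqv (d - c) (base.base.rad c)"
    using X.rad[of c] base.base_rad[of c] by (rule eventually_conj)
  then obtain d where d: "const (d - c) \<approx> const (X.rad c)" "base.eqv (d - c) (base.base.rad c)"
    using eventually_happens'[OF X.F_nonbot] by blast
  then show ?thesis using eqv_trans[OF eqv_sym] unfolding const_eqv[symmetric] by blast
qed

lemma limitI_rad:
  assumes "\<And>c. ratX - const c \<approx> const (base.base.rad c)"
  shows "X.limit ratX"
  by (rule X.limitI) (rule eqv_trans[OF assms eqv_sym[OF X_rad]])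

text \<open>
  Both directions compare \<open>x\<close> with a point \<open>b\<close> far out in the filter, for which \<open>b - c\<close> and \<open>x - c\<close> have the
  same value.  If \<open>v d\<close> exceeds the support, \<open>v (x - c) \<ge> v d\<close> would put \<open>c\<close> into all balls of the type.
\<close>

lemma limit_imp_appr:
  assumes x: "X.limit ratX"
  shows "appr v0 G v = A"
proof (rule appr_eqI[OF base.approx_type_axioms])
  have near: "\<forall>\<^sub>F b in base.filt. const (b - c) \<approx> ratX - const c" for c
    using X.rad[of c] by (rule eventually_mono) (rule eqv_trans[OF _ eqv_sym[OF X.limit_rad[OF x]]])
  have cl1: "const d \<preceq> ratX - const c" if c: "c \<in> base.cl d" for c d
  proof -
    have "\<forall>\<^sub>F b in base.filt. b \<in> base.cl d \<and> const (b - c) \<approx> ratX - const c"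
      using near[of c] base.eventually_cl[of d] c by (intro eventually_conj) auto
    then obtain b where b: "b \<in> base.cl d" "const (b - c) \<approx> ratX - const c"
      using eventually_happens'[OF X.F_nonbot] by blast
    then have "const d \<preceq> const (b - c)" using base.cl_ball[OF c] unfolding const_le by blast
    then show ?thesis using b(2) by (rule le_eqv_trans)
  qed
  have in_cl: "c \<in> base.cl d" if d: "base.cl d \<noteq> {}" "const d \<preceq> ratX - const c" for c d
  proof -
    have "\<forall>\<^sub>F b in base.filt. b \<in> base.cl d \<and> const (b - c) \<approx> ratX - const c"
      using near[of c] base.eventually_cl[OF d(1)] by (intro eventually_conj)
    then obtain b where b: "b \<in> base.cl d" "const (b - c) \<approx> ratX - const c"
      using eventually_happens'[OF X.F_nonbot] by blast
    then have "const d \<preceq> const (b - c)" using le_eqv_trans[OF d(2) eqv_sym] by blast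
    then show ?thesis using base.cl_ball[OF b(1)] base.minus_commute_le unfolding const_le by blast
  qed
  have cl2: "c \<in> base.cl d" if d: "const d \<preceq> ratX - const c" for c d
  proof (cases "base.cl d = {}")
    case True
    obtain e where e: "base.cl e \<noteq> {}" "c \<notin> base.cl e" using base.excluded by blast
    have "const e \<preceq> const d"
      using base.cl_mono[of _ e d] e(1) True le_total[of "const e" "const d"] unfolding const_le by blast
    then have "const e \<preceq> ratX - const c" using d by (rule le_trans)
    then show ?thesis using in_cl e by blast
  qed (use in_cl d in blast)
  show "c \<in> base.cl d \<longleftrightarrow> const d \<preceq> ratX - const c" for c d
    using cl1 cl2 by blast
  show "c \<in> base.op d \<longleftrightarrow> const d \<prec> ratX - const c" for c d
  proof
    assume c: "c \<in> base.op d"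
    then obtain e where e: "base.cl e \<noteq> {}" "base.lt d e" using base.no_max base.op_cl by blast
    have "\<forall>\<^sub>F b in base.filt. b \<in> base.cl e \<and> const (b - c) \<approx> ratX - const c"
      using near[of c] base.eventually_cl[OF e(1)] by (intro eventually_conj)
    then obtain b where b: "b \<in> base.cl e" "const (b - c) \<approx> ratX - const c"
      using eventually_happens'[OF X.F_nonbot] by blast
    have "b \<in> base.op d" using base.cl_down[OF b(1) e(2)] .
    then have "const d \<prec> const (b - c)" using base.op_ball[OF c] unfolding const_lt by blast
    then show "const d \<prec> ratX - const c" using b(2) by (rule lt_eqv_trans)
  next
    assume d: "const d \<prec> ratX - const c"
    then have "c \<in> base.cl d" using cl2 lt_imp_le by blast
    then obtain e where e: "base.cl e \<noteq> {}" "base.lt d e" using base.no_max by blast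
    have "\<forall>\<^sub>F b in base.filt. b \<in> base.cl e \<and> const (b - c) \<approx> ratX - const c"
      using near[of c] base.eventually_cl[OF e(1)] by (intro eventually_conj)
    then obtain b where b: "b \<in> base.cl e" "const (b - c) \<approx> ratX - const c"
      using eventually_happens'[OF X.F_nonbot] by blast
    have "b \<in> base.op d" using base.cl_down[OF b(1) e(2)] .
    moreover have "const d \<prec> const (b - c)" using d eqv_sym[OF b(2)] by (rule lt_eqv_trans)
    ultimately show "c \<in> base.op d" using base.op_ball base.minus_commute_lt unfolding const_lt by blast
  qed
qed

text \<open>
  Choose a ball of the type that excludes \<open>a\<close>; its points \<open>c\<close> are closer to \<open>x\<close> than to \<open>a\<close>.
\<close>

lemma appr_imp_limit:
  assumes A: "appr v0 G v = A"
  shows "X.limit ratX"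
  unfolding X.limit_def
proof
  fix a
  obtain e where e: "base.cl e \<noteq> {}" "a \<notin> base.cl e" using base.excluded by blast
  have "const (c - a) \<prec> ratX - const c" if c: "c \<in> base.cl e" for c
  proof -
    have "const (c - a) \<prec> const e"
      using base.cl_ball[OF c, of a] e(2) unfolding const_lt base.lt_def by (simp add: base.minus_commute_le)
    also have "const e \<preceq> ratX - const c" using c appr_cl[of e] unfolding A near_closed_def by blast
    finally show ?thesis .
  qed
  then show "\<forall>\<^sub>F c in base.filt. const (c - a) \<prec> ratX - const c"
    by (rule eventually_mono[OF base.eventually_cl[OF e(1)]])
qed

lemma below_fixed_X: "base.below_fixed p \<Longrightarrow> \<forall>q. Polynomial.degree q < Polynomial.degree p \<longrightarrow> X.fixed q"
  unfolding base.below_fixed_def X_fixed .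

lemma fixed_approx_const:
  assumes "X.limit ratX" "p \<noteq> 0" "base.base.fixed p" "base.below_fixed p"
  shows "\<exists>c. of_poly p \<prec> of_poly p - const c"
proof -
  have "\<forall>\<^sub>F c in base.filt. of_poly p \<prec> of_poly p - const (poly p c)"
    using X.fixed_approx[OF assms(2) below_fixed_X[OF assms(4)] _ assms(1)] assms(3)
    unfolding X_ev X_fixed by blast
  then show ?thesis using eventually_happens'[OF X.F_nonbot] by blast
qed

lemma fixed_eqv_const:
  assumes "X.limit ratX" "base.base.fixed p" "base.below_fixed p"
  shows "of_poly p \<approx> const (base.eventual p)"
proof (cases "p = 0")
  case False
  have "\<forall>\<^sub>F c in base.filt. of_poly p \<prec> of_poly p - const (poly p c)"
    using X.fixed_approx[OF False below_fixed_X[OF assms(3)] _ assms(1)] assms(2)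
    unfolding X_ev X_fixed by blast
  then have "\<forall>\<^sub>F c in base.filt. of_poly p \<prec> of_poly p - const (poly p c)
      \<and> base.eqv (poly p c) (base.eventual p)"
    using base.pt[OF assms(2)] by (rule eventually_conj)
  then obtain c where c: "of_poly p \<prec> of_poly p - const (poly p c)" "base.eqv (poly p c) (base.eventual p)"
    using eventually_happens'[OF X.F_nonbot] by blast
  then show ?thesis using eqv_trans[OF lt_diff_eqv] unfolding const_eqv[symmetric] by blast
qed simp

end

section \<open>Extensions given by a key polynomial\<close>

locale key_extension = extension_of G0 v0 G v + key: key_polynomial G u f \<beta>
  for G0 :: "'g ogroup" and v0 :: "'k::field \<Rightarrow> 'g option"
    and G :: "'h ogroup" and v :: "'k ratfun \<Rightarrow> 'h option"
    and u :: "'k poly \<Rightarrow> 'h option" and f :: "'k poly" and \<beta> :: 'h +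
  assumes v_w: "v (of_poly p) = key_val G u f \<beta> p"
begin

lemma eqv_poly_iff: "of_poly p \<approx> of_poly q \<longleftrightarrow> key_val G u f \<beta> p = key_val G u f \<beta> q"
  using v_eq_iff[of "of_poly p" "of_poly q"] by (simp only: v_w)

lemma le_poly_iff: "of_poly p \<preceq> of_poly q \<longleftrightarrow> vle G (key_val G u f \<beta> p) (key_val G u f \<beta> q)"
  by (simp only: value_le_def v_w)

lemma adjoins_value:
  assumes small: "\<And>a. key.small a \<Longrightarrow> a \<noteq> 0 \<Longrightarrow> \<exists>c. of_poly a \<approx> const c"
    and nontorsion: "\<And>n c. n > 0 \<Longrightarrow> \<not> of_poly f ^ n \<approx> const c"
  shows "adjoins_value (value_le G v)"
  unfolding adjoins_value_def
proof (intro exI[of _ "of_poly f"] conjI allI impI)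
  show "of_poly f \<noteq> 0" using key.f_nonzero by simp
  show "\<not> of_poly f ^ n \<approx> const c" if "n > 0" for n c by (rule nontorsion[OF that])
  fix q :: "'k poly" assume "q \<noteq> 0"
  then obtain a i where a: "key.small a" "a \<noteq> 0" "key_val G u f \<beta> q = key_val G u f \<beta> (a * f ^ i)"
    using key.w_attained by blast
  obtain c where c: "of_poly a \<approx> const c" using small[OF a(1,2)] by blast
  have "of_poly q \<approx> of_poly (a * f ^ i)" using a(3) eqv_poly_iff by blast
  also have "of_poly (a * f ^ i) = of_poly a * of_poly f ^ i" by simp
  also have "of_poly a * of_poly f ^ i \<approx> const c * of_poly f ^ i" by (intro eqv_mult c eqv_refl)
  finally show "\<exists>c i. of_poly q \<approx> const c * of_poly f ^ i" by blast
qed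

lemma v_f: "v (of_poly f) = Some \<beta>"
proof -
  have "key_val G u f \<beta> 1 = Some \<one>\<^bsub>G\<^esub>" using v_w[of 1] v_one by simp
  then show ?thesis using key.w_mult_f[of 1] key.beta by (simp add: v_w)
qed

lemma term_value: "key.small a \<Longrightarrow> vadd G (u a) (Some (\<beta> [^]\<^bsub>G\<^esub> i)) = v (of_poly a * of_poly f ^ i)"
  using valuationD(4)[OF valuation, of "of_poly a" "of_poly f ^ i"]
    valuation_power[OF valuation v_f, of i] by (simp add: v_w key.w_small)

lemma sum_min:
  fixes c :: "nat \<Rightarrow> 'k"
  defines "S n \<equiv> (\<Sum>i\<le>n. const (c i) * of_poly f ^ i)"
  shows "is_vmin G (v (S n)) ((\<lambda>i. v (const (c i) * of_poly f ^ i)) ` {..n})"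
proof -
  have small: "key.small [:c i:]" for i using key.deg_f by simp
  have "S n = of_poly (\<Sum>i\<le>n. [:c i:] * f ^ i)"
    by (simp only: S_def of_poly_sum of_poly_simps of_poly_power of_poly_const)
  moreover have "vadd G (u [:c i:]) (Some (\<beta> [^]\<^bsub>G\<^esub> i)) = v (const (c i) * of_poly f ^ i)" for i
    using term_value[OF small, of i i] by (simp only: of_poly_const)
  ultimately show ?thesis using key.w_sum[of n "\<lambda>i. [:c i:]"] small by (simp only: v_w)
qed

lemma sum_le_term:
  assumes "i \<le> n"
  shows "(\<Sum>i\<le>n. const (c i) * of_poly f ^ i) \<preceq> const (c i) * of_poly f ^ i"
  using sum_min[of c n] assms unfolding is_vmin_def value_le_def by blast

text \<open>
  As \<open>f\<close> and the constant \<open>d\<close> have the same value, \<open>f / d\<close> is a unit.  Replacing each digit of \<open>q\<close> by a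
  constant turns the \<open>f\<close>-adic expansion of \<open>q\<close> into a polynomial in \<open>f / d\<close>.
\<close>

lemma adjoins_residue:
  assumes d: "v (const d) = Some \<beta>"
    and approx: "\<And>a. key.small a \<Longrightarrow> a \<noteq> 0 \<Longrightarrow> \<exists>c. of_poly a \<prec> of_poly a - const c"
  shows "adjoins_residue (value_le G v)"
proof -
  define t where "t = of_poly f / const d"
  have d0: "d \<noteq> 0" using d v_0 by auto
  have "of_poly f \<approx> const d" using d v_f v_eq_iff by metis
  then have t1: "t \<approx> 1" using eqv_divide[OF _ eqv_refl, of "of_poly f" "const d" "const d"] d0 by (simp add: t_def)
  have dt: "const d * t = of_poly f" using d0 by (simp add: t_def)
  show ?thesis
    unfolding adjoins_residue_def
  proof (intro exI[of _ t] conjI allI impI)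
    show "1 \<preceq> t" using t1 by (simp add: eqv_def)
    fix c :: "nat \<Rightarrow> 'k" and n i :: nat assume i: "i \<le> n"
    have *: "const (c i) * t ^ i = const (c i / d ^ i) * of_poly f ^ i" for i
      using d0 by (simp add: t_def power_divide)
    have "(\<Sum>i\<le>n. const (c i) * t ^ i) \<preceq> const (c i) * t ^ i"
      unfolding * by (rule sum_le_term[OF i])
    also have "const (c i) * t ^ i \<approx> const (c i) * 1 ^ i"
      by (intro eqv_mult eqv_power t1 eqv_refl)
    finally show "(\<Sum>i\<le>n. const (c i) * t ^ i) \<preceq> const (c i)" by simp
  next
    have "\<exists>n c. of_poly q \<prec> of_poly q - (\<Sum>i\<le>n. const (c i) * t ^ i)
        \<or> q = 0 \<and> (\<Sum>i\<le>n. const (c i) * t ^ i) = 0" for q :: "'k poly"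
    proof (induction q rule: key.poly_induct)
      case zero
      show ?case by (intro exI[of _ 0] exI[of _ "\<lambda>_. 0"]) simp
    next
      case (digit a g)
      obtain n c where nc: "of_poly g \<prec> of_poly g - (\<Sum>i\<le>n. const (c i) * t ^ i)
        \<or> g = 0 \<and> (\<Sum>i\<le>n. const (c i) * t ^ i) = 0"
        using digit(2) by blast
      define S where "S = (\<Sum>i\<le>n. const (c i) * t ^ i)"
      obtain e where e: "of_poly a \<prec> of_poly a - const e \<or> a = 0 \<and> e = 0"
        using approx[OF digit(1)] by (cases "a = 0") auto
      define c' where "c' i = (case i of 0 \<Rightarrow> e | Suc j \<Rightarrow> d * c j)" for i
      have S': "(\<Sum>i\<le>Suc n. const (c' i) * t ^ i) = const e + of_poly f * S"
      proof -
        have "(\<Sum>i\<le>Suc n. const (c' i) * t ^ i) = const e + (\<Sum>i\<le>n. const d * t * (const (c i) * t ^ i))"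
          by (subst sum.atMost_Suc_shift) (simp add: c'_def mult_ac)
        then show ?thesis by (simp only: S_def dt sum_distrib_left)
      qed
      show ?case
      proof (cases "a + f * g = 0")
        case True
        then show ?thesis by (intro exI[of _ 0] exI[of _ "\<lambda>_. 0"]) simp
      next
        case False
        have q0: "of_poly (a + f * g) \<noteq> 0" using False by (simp only: of_poly_eq_0_iff not_False_eq_True)
        have 1: "of_poly (a + f * g) \<prec> of_poly a - const e"
          using e
        proof
          assume "of_poly a \<prec> of_poly a - const e"
          moreover have "of_poly (a + f * g) \<preceq> of_poly a"
            unfolding le_poly_iff using key.w_digit_le(1)[OF digit(1)] key.w_small[OF digit(1)] by simp
          ultimately show ?thesis using le_lt_trans by blast
        qed (use q0 in simp)
        have 2: "of_poly (a + f * g) \<prec> of_poly f * (of_poly g - S)"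
          using nc unfolding S_def[symmetric]
        proof
          assume "of_poly g \<prec> of_poly g - S"
          then have "of_poly f * of_poly g \<prec> of_poly f * (of_poly g - S)"
            using key.f_nonzero by (simp add: lt_mult_iff)
          moreover have "of_poly (a + f * g) \<preceq> of_poly (f * g)"
            unfolding le_poly_iff key.w_mult_f by (rule key.w_digit_le(2)[OF digit(1)])
          ultimately show ?thesis using le_lt_trans[of "of_poly (a + f * g)" "of_poly (f * g)"] by simp
        qed (use q0 in simp)
        have "of_poly (a + f * g) - (\<Sum>i\<le>Suc n. const (c' i) * t ^ i)
            = (of_poly a - const e) + of_poly f * (of_poly g - S)"
          unfolding S' by (simp add: algebra_simps)
        then have "of_poly (a + f * g) \<prec> of_poly (a + f * g) - (\<Sum>i\<le>Suc n. const (c' i) * t ^ i)"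
          using lt_add[OF 1 2] by (simp only:)
        then show ?thesis by blast
      qed
    qed
    then show "\<exists>n c. of_poly q \<prec> of_poly q - (\<Sum>i\<le>n. const (c i) * t ^ i)" if "q \<noteq> 0" for q :: "'k poly"
      using that by blast
  qed
qed

end

lemma embedding_value:
  assumes v0: "valuation G0 v0" and emb: "group_order_embedding (value_group G0 v0) G \<iota>"
  shows "map_option \<iota> (v0 a) \<in> insert None (Some ` carrier G)"
    and "map_option \<iota> (v0 a) = None \<longleftrightarrow> a = 0"
    and "map_option \<iota> (v0 (a * b)) = vadd G (map_option \<iota> (v0 a)) (map_option \<iota> (v0 b))"
    and "vle G (map_option \<iota> (v0 a)) (map_option \<iota> (v0 b)) \<longleftrightarrow> value_le G0 v0 a b"
proof -
  have car: "g \<in> carrier (value_group G0 v0)" if "v0 c = Some g" for c g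
    using that by (auto simp: value_group_def values_of_def)
  have hom: "\<iota> \<in> carrier (value_group G0 v0) \<rightarrow> carrier G"
    "\<And>g h. g \<in> carrier (value_group G0 v0) \<Longrightarrow> h \<in> carrier (value_group G0 v0) \<Longrightarrow>
      \<iota> (g \<otimes>\<^bsub>G0\<^esub> h) = \<iota> g \<otimes>\<^bsub>G\<^esub> \<iota> h"
    "\<And>g h. g \<in> carrier (value_group G0 v0) \<Longrightarrow> h \<in> carrier (value_group G0 v0) \<Longrightarrow>
      ord_le G (\<iota> g) (\<iota> h) \<longleftrightarrow> ord_le G0 g h"
    using emb by (auto simp: group_order_embedding_def hom_def value_group_def)
  show "map_option \<iota> (v0 a) \<in> insert None (Some ` carrier G)"
    using car[of a] hom(1) by (cases "v0 a") auto
  show "map_option \<iota> (v0 a) = None \<longleftrightarrow> a = 0"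
    using valuationD(3)[OF v0, of a] by simp
  show "map_option \<iota> (v0 (a * b)) = vadd G (map_option \<iota> (v0 a)) (map_option \<iota> (v0 b))"
    unfolding valuationD(4)[OF v0] using car[of a] car[of b] hom(2)
    by (cases "v0 a"; cases "v0 b") simp_all
  show "vle G (map_option \<iota> (v0 a)) (map_option \<iota> (v0 b)) \<longleftrightarrow> value_le G0 v0 a b"
    unfolding value_le_def using car[of a] car[of b] hom(3) by (cases "v0 a"; cases "v0 b") simp_all
qed

lemma id_embedding: "valuation G0 v0 \<Longrightarrow> group_order_embedding (value_group G0 v0) G0 id"
proof -
  assume v0: "valuation G0 v0"
  have "g \<in> carrier G0" if "v0 a = Some g" for a g using valuationD(2)[OF v0, of a] that by auto
  then show ?thesis by (auto simp: group_order_embedding_def hom_def value_group_def values_of_def)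
qed

lemma key_extension_exists:
  fixes v0 :: "'k::field \<Rightarrow> 'g option" and G :: "'h ogroup"
  assumes v0: "valuation G0 v0" and emb: "group_order_embedding (value_group G0 v0) G \<iota>"
    and key: "key_polynomial G u f \<beta>" and u: "\<And>c. u [:c:] = map_option \<iota> (v0 c)"
  shows "\<exists>v. extension G0 v0 G v \<and> key_extension G0 v0 G v u f \<beta> \<and> (\<forall>c. v (const c) = map_option \<iota> (v0 c))"
proof -
  interpret key: key_polynomial G u f \<beta> by (rule key)
  obtain v :: "'k ratfun \<Rightarrow> 'h option" where v: "valuation G v" "\<And>p. v (of_poly p) = key_val G u f \<beta> p"
    using poly_valuation_extends[OF key.poly_valuation_w] by blast
  have c: "v (const c) = map_option \<iota> (v0 c)" for c
  proof -
    have "key.small [:c:]" using key.deg_f by simp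
    then show ?thesis using v(2)[of "[:c:]"] key.w_small u by simp
  qed
  have ext: "extension G0 v0 G v" unfolding extension_def using v(1) emb c by blast
  have "key_extension G0 v0 G v u f \<beta>"
    using extension_imp_extension_of[OF v0 ext] key v(2)
    by (intro key_extension.intro key_extension_axioms.intro)
  then show ?thesis using ext c by blast
qed

section \<open>Monomial valuations\<close>

text \<open>
  The digits with respect to \<open>x - b\<close> are constants, and their products never produce a carry.
\<close>

lemma key_polynomial_linear:
  fixes v0 :: "'k::field \<Rightarrow> 'g option"
  assumes v0: "valuation G0 v0" and emb: "group_order_embedding (value_group G0 v0) G \<iota>"
    and G: "ordered_abelian_group G" and \<alpha>: "\<alpha> \<in> carrier G"
  shows "key_polynomial G (\<lambda>a. map_option \<iota> (v0 (Polynomial.coeff a 0))) [:- b, 1:] \<alpha>"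
proof -
  interpret ordered_abelian_group G by (rule G)
  interpret K: valuation_preorder "value_le G0 v0" by (rule valuation_imp_preorder[OF v0])
  note e = embedding_value[OF v0 emb]
  have lt: "Polynomial.degree a < Polynomial.degree [:- b, 1:] \<longleftrightarrow> Polynomial.degree a = 0" for a
    by simp
  show ?thesis
  proof (intro key_polynomial.intro key_polynomial_axioms.intro G, unfold lt)
    show "0 < Polynomial.degree [:- b, 1:]" by simp
    show "\<alpha> \<in> carrier G" by (rule \<alpha>)
    fix a c :: "'k poly"
    show "map_option \<iota> (v0 (Polynomial.coeff a 0)) \<in> insert None (Some ` carrier G)" by (rule e(1))
    show "(map_option \<iota> (v0 (Polynomial.coeff a 0)) = None) = (a = 0)" if "Polynomial.degree a = 0"
      using that unfolding e(2) by (elim degree_eq_zeroE) simp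
    assume deg: "Polynomial.degree a = 0" "Polynomial.degree c = 0"
    show "vle G (map_option \<iota> (v0 (Polynomial.coeff a 0))) (map_option \<iota> (v0 (Polynomial.coeff (a + c) 0)))
        \<or> vle G (map_option \<iota> (v0 (Polynomial.coeff c 0))) (map_option \<iota> (v0 (Polynomial.coeff (a + c) 0)))"
      unfolding e(4) using K.le_total K.le_add1 by (metis Polynomial.coeff_add add.commute)
    have deg': "Polynomial.degree (a * c) = 0"
      using deg by (elim degree_eq_zeroE) simp
    then have "(a * c) mod [:- b, 1:] = a * c" "(a * c) div [:- b, 1:] = 0"
      by (simp_all add: mod_poly_less div_poly_less)
    moreover have "Polynomial.coeff (a * c) 0 = Polynomial.coeff a 0 * Polynomial.coeff c 0"
      by (simp add: coeff_mult)
    ultimately show "map_option \<iota> (v0 (Polynomial.coeff ((a * c) mod [:- b, 1:]) 0))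
        = vadd G (map_option \<iota> (v0 (Polynomial.coeff a 0))) (map_option \<iota> (v0 (Polynomial.coeff c 0)))"
      "vle G (vadd G (map_option \<iota> (v0 (Polynomial.coeff a 0))) (map_option \<iota> (v0 (Polynomial.coeff c 0))))
        (vadd G (Some \<alpha>) (map_option \<iota> (v0 (Polynomial.coeff ((a * c) div [:- b, 1:]) 0))))"
      using valuationD(3)[OF v0, of 0] by (simp_all add: e(3) vadd_None)
  qed
qed

lemma monomial_valuation_exists:
  fixes v0 :: "'k::field \<Rightarrow> 'g option" and G :: "'h ogroup"
  assumes v0: "valuation G0 v0" and emb: "group_order_embedding (value_group G0 v0) G \<iota>"
    and G: "ordered_abelian_group G" and \<alpha>: "\<alpha> \<in> carrier G"
  shows "\<exists>v. monomial_valuation v0 G \<iota> b \<alpha> v \<and> extension G0 v0 G v \<and> (\<forall>c. v (const c) = map_option \<iota> (v0 c))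
    \<and> key_extension G0 v0 G v (\<lambda>a. map_option \<iota> (v0 (Polynomial.coeff a 0))) [:- b, 1:] \<alpha>"
proof -
  let ?u = "\<lambda>a. map_option \<iota> (v0 (Polynomial.coeff a 0))"
  obtain v where v: "extension G0 v0 G v" "key_extension G0 v0 G v ?u [:- b, 1:] \<alpha>"
    "\<forall>c. v (const c) = map_option \<iota> (v0 c)"
    using key_extension_exists[OF v0 emb key_polynomial_linear[OF assms]] by auto
  interpret key_extension G0 v0 G v ?u "[:- b, 1:]" \<alpha> by (rule v(2))
  have "monomial_valuation v0 G \<iota> b \<alpha> v"
    unfolding monomial_valuation_def
  proof (intro conjI allI)
    show "valuation G v" by (rule valuation)
    fix c :: "nat \<Rightarrow> 'k" and n
    have "vadd G (map_option \<iota> (v0 (c i))) (Some (\<alpha> [^]\<^bsub>G\<^esub> i)) = v (const (c i) * (ratX - const b) ^ i)" for i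
      using term_value[of "[:c i:]" i] by (simp only: of_poly_const of_poly_linear) simp
    then show "is_vmin G (v (\<Sum>i\<le>n. const (c i) * (ratX - const b) ^ i))
        ((\<lambda>i. vadd G (map_option \<iota> (v0 (c i))) (Some (\<alpha> [^]\<^bsub>G\<^esub> i))) ` {..n})"
      using sum_min[of c n] by (simp only: of_poly_linear)
  qed
  then show ?thesis using v by blast
qed

lemma poly_linear_expansion:
  fixes p :: "'k::field poly"
  shows "\<exists>n c. p = (\<Sum>i\<le>n. [:c i:] * [:- b, 1:] ^ i)"
proof (induction "Polynomial.degree p" arbitrary: p)
  case 0
  then obtain a where "p = [:a:]" by (metis degree_eq_zeroE)
  then show ?case by (intro exI[of _ 0] exI[of _ "\<lambda>_. a"]) simp
next
  case (Suc m)
  have "Polynomial.degree (synthetic_div p b) = m" using Suc(2) by (simp add: degree_synthetic_div)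
  then obtain n c where nc: "synthetic_div p b = (\<Sum>i\<le>n. [:c i:] * [:- b, 1:] ^ i)" using Suc(1) by blast
  define c' where "c' i = (case i of 0 \<Rightarrow> poly p b | Suc j \<Rightarrow> c j)" for i
  have "p = [:- b, 1:] * synthetic_div p b + [:poly p b:]" by (rule synthetic_div_correct'[symmetric])
  also have "\<dots> = [:poly p b:] + (\<Sum>i\<le>n. [:- b, 1:] * ([:c i:] * [:- b, 1:] ^ i))"
    by (simp only: nc sum_distrib_left add.commute)
  also have "\<dots> = (\<Sum>i\<le>Suc n. [:c' i:] * [:- b, 1:] ^ i)"
    by (subst sum.atMost_Suc_shift) (simp add: c'_def mult_ac del: mult_pCons_left mult_pCons_right)
  finally show ?case by blast
qed

text \<open>
  Every polynomial is a polynomial in \<open>x - b\<close>, so its value is prescribed, and with it the value of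
  quotients.
\<close>

lemma monomial_valuation_unique:
  fixes v0 :: "'k::field \<Rightarrow> 'g option" and G :: "'h ogroup"
  assumes v0: "valuation G0 v0" and emb: "group_order_embedding (value_group G0 v0) G \<iota>"
    and \<alpha>: "\<alpha> \<in> carrier G"
    and v: "monomial_valuation v0 G \<iota> b \<alpha> v" and w: "monomial_valuation v0 G \<iota> b \<alpha> w"
  shows "v = w"
proof
  have val: "valuation G v" "valuation G w" using v w by (simp_all add: monomial_valuation_def)
  interpret ordered_abelian_group G by (rule valuationD(1)[OF val(1)])
  have poly: "v (of_poly p) = w (of_poly p)" for p
  proof -
    obtain n c where p: "p = (\<Sum>i\<le>n. [:c i:] * [:- b, 1:] ^ i)" using poly_linear_expansion by blast
    then have *: "of_poly p = (\<Sum>i\<le>n. const (c i) * (ratX - const b) ^ i)"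
      by (simp only: of_poly_sum of_poly_simps of_poly_power of_poly_const of_poly_linear)
    let ?S = "(\<lambda>i. vadd G (map_option \<iota> (v0 (c i))) (Some (\<alpha> [^]\<^bsub>G\<^esub> i))) ` {..n}"
    have "vadd G (map_option \<iota> (v0 (c i))) (Some (\<alpha> [^]\<^bsub>G\<^esub> i)) \<in> vals" for i
      by (rule vadd_closed[OF embedding_value(1)[OF v0 emb]]) (use \<alpha> in simp)
    then have "?S \<subseteq> vals" by (intro image_subsetI)
    moreover have "is_vmin G (v (of_poly p)) ?S" "is_vmin G (w (of_poly p)) ?S"
      unfolding * using v w unfolding monomial_valuation_def by blast+
    ultimately show ?thesis by (rule is_vmin_unique)
  qed
  fix f :: "'k ratfun"
  obtain p q where q: "q \<noteq> 0" "f = of_poly p / of_poly q" by (rule ratfun_cases)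
  obtain g where g: "v (of_poly q) = Some g" "g \<in> carrier G"
    using valuationD(2,3)[OF val(1), of "of_poly q"] q(1) by auto
  have p: "of_poly p = of_poly q * f" using q by simp
  show "v f = w f"
  proof (rule vadd_cancel_eq[OF valuationD(2)[OF val(1)] valuationD(2)[OF val(2)] g(2)])
    show "vadd G (Some g) (v f) = vadd G (Some g) (w f)"
      using poly[of p] poly[of q] g(1) valuationD(4)[OF val(1), of "of_poly q" f]
        valuationD(4)[OF val(2), of "of_poly q" f] unfolding p by simp
  qed
qed

text \<open>
  In terms of the preorder alone, so that the property can be transported to another value group.
\<close>

lemma monomial_valuation_iff:
  assumes "valuation G v" "\<And>c. v (const c) = map_option \<iota> (v0 c)" "v (ratX - const b) = Some \<alpha>"
  shows "monomial_valuation v0 G \<iota> b \<alpha> v \<longleftrightarrow>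
    (\<forall>c n. (\<exists>j\<le>n. valuation_preorder.eqv (value_le G v) (\<Sum>i\<le>n. const (c i) * (ratX - const b) ^ i) (const (c j) * (ratX - const b) ^ j))
      \<and> (\<forall>j\<le>n. value_le G v (\<Sum>i\<le>n. const (c i) * (ratX - const b) ^ i) (const (c j) * (ratX - const b) ^ j)))"
proof -
  have "vadd G (map_option \<iota> (v0 a)) (Some (\<alpha> [^]\<^bsub>G\<^esub> i)) = v (const a * (ratX - const b) ^ i)" for a i
    using valuationD(4)[OF assms(1), of "const a" "(ratX - const b) ^ i"]
      valuation_power[OF assms(1,3), of i] assms(2) by simp
  then have *: "is_vmin G y ((\<lambda>i. vadd G (map_option \<iota> (v0 (c i))) (Some (\<alpha> [^]\<^bsub>G\<^esub> i))) ` {..n})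
      \<longleftrightarrow> (\<exists>j\<le>n. y = v (const (c j) * (ratX - const b) ^ j))
        \<and> (\<forall>j\<le>n. vle G y (v (const (c j) * (ratX - const b) ^ j)))" for y c and n :: nat
    by (simp only: is_vmin_def image_iff ball_simps Bex_def Ball_def atMost_iff) blast
  show ?thesis
    unfolding monomial_valuation_def * eqv_iff_value_eq[OF assms(1)] value_le_def
    by (simp only: assms(1) simp_thms)
qed

locale linear_key_extension =
  key_extension G0 v0 G v "\<lambda>a. map_option \<iota> (v0 (Polynomial.coeff a 0))" "[:- b, 1:]" \<alpha>
  for G0 :: "'g ogroup" and v0 :: "'k::field \<Rightarrow> 'g option"
    and G :: "'h ogroup" and v :: "'k ratfun \<Rightarrow> 'h option" and \<iota> b \<alpha>
begin

lemma small_imp_const: "key.small a \<Longrightarrow> \<exists>c. of_poly a = const c"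
  by (auto elim!: degree_eq_zeroE)

text \<open>
  Together with the ultrametric inequality this says that \<open>v (x - c)\<close> is the minimum of \<open>v (x - b)\<close> and
  \<open>v (b - c)\<close>.
\<close>

lemma distance:
  "ratX - const c \<preceq> ratX - const b" "ratX - const c \<preceq> const (b - c)"
proof -
  define e where "e i = (if i = 0 then b - c else 1)" for i :: nat
  have "(\<Sum>i\<le>1. const (e i) * of_poly [:- b, 1:] ^ i) = ratX - const c"
    by (simp add: e_def of_poly_linear[unfolded minus_pCons])
  then show "ratX - const c \<preceq> ratX - const b" "ratX - const c \<preceq> const (b - c)"
    using sum_le_term[of 1 1 e] sum_le_term[of 0 1 e] by (simp_all add: e_def)
qed

lemma le_distance: "const d \<preceq> ratX - const c \<longleftrightarrow> const d \<preceq> ratX - const b \<and> const d \<preceq> const (b - c)"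
proof
  assume "const d \<preceq> ratX - const c"
  then show "const d \<preceq> ratX - const b \<and> const d \<preceq> const (b - c)" using distance[of c] le_trans by blast
next
  assume "const d \<preceq> ratX - const b \<and> const d \<preceq> const (b - c)"
  then show "const d \<preceq> ratX - const c" using le_add[of "const d" "ratX - const b" "const (b - c)"] by simp
qed

lemma lt_distance: "const d \<prec> ratX - const c \<longleftrightarrow> const d \<prec> ratX - const b \<and> const d \<prec> const (b - c)"
proof
  assume "const d \<prec> ratX - const c"
  then show "const d \<prec> ratX - const b \<and> const d \<prec> const (b - c)" using distance[of c] lt_le_trans by blast
next
  assume "const d \<prec> ratX - const b \<and> const d \<prec> const (b - c)"
  then show "const d \<prec> ratX - const c" using lt_add[of "const d" "ratX - const b" "const (b - c)"] by simp
qed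

text \<open>
  Since \<open>b\<close> lies in every ball of \<open>A\<close>, the balls are centered at \<open>b\<close> and differ only in radius.  By
  \<open>distance\<close> the same holds for the type of \<open>x\<close>, and a radius occurs in it iff \<open>v (x - b)\<close> is larger.
\<close>

lemma appr_value_extending:
  assumes A: "approx_type G0 v0 A" and b: "b \<in> inter A"
    and open_nonempty: "\<And>d. approx_type.cl v0 A d \<noteq> {} \<Longrightarrow> approx_type.op v0 A d \<noteq> {}"
    and lower: "\<And>d. approx_type.cl v0 A d \<noteq> {} \<Longrightarrow> const d \<prec> ratX - const b"
    and upper: "\<And>d. d \<noteq> 0 \<Longrightarrow> approx_type.cl v0 A d = {} \<Longrightarrow> ratX - const b \<prec> const d"
  shows "appr v0 G v = A"
proof -
  interpret A: approx_type G0 v0 A by (rule A)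
  have supp: "A.cl d \<noteq> {}" if "const d \<preceq> ratX - const b" for d
  proof
    assume "A.cl d = {}"
    moreover have "d \<noteq> 0"
    proof
      assume "d = 0"
      then have "ratX - const b = 0" using that by simp
      then show False using ratX_neq_const[of b] by simp
    qed
    ultimately have "ratX - const b \<prec> const d" by (rule upper[rotated])
    then show False using that by (simp add: lt_def)
  qed
  have b_cl: "b \<in> A.cl d" if "A.cl d \<noteq> {}" for d
    using b[unfolded A.inter_iff, THEN conjunct1, rule_format, OF that] .
  have b_op: "b \<in> A.op d" if "A.op d \<noteq> {}" for d
    using b[unfolded A.inter_iff, THEN conjunct2, rule_format, OF that] .
  show ?thesis
  proof (rule appr_eqI[OF A])
    fix c d
    show "c \<in> A.cl d \<longleftrightarrow> const d \<preceq> ratX - const c"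
    proof
      assume c: "c \<in> A.cl d"
      then have bd: "b \<in> A.cl d" using b_cl by blast
      have "const d \<preceq> ratX - const b" using lt_imp_le[OF lower[of d]] c by blast
      moreover have "const d \<preceq> const (b - c)" using A.cl_ball[OF c] bd unfolding const_le by blast
      ultimately show "const d \<preceq> ratX - const c" using le_distance[of d c] by blast
    next
      assume "const d \<preceq> ratX - const c"
      then have d: "const d \<preceq> ratX - const b" "value_le G0 v0 d (b - c)"
        using le_distance[of d c] unfolding const_le by blast+
      have "b \<in> A.cl d" by (rule b_cl[OF supp[OF d(1)]])
      then show "c \<in> A.cl d" using A.cl_ball[of b d c] d(2) base.minus_commute_le by blast
    qed
    show "c \<in> A.op d \<longleftrightarrow> const d \<prec> ratX - const c"
    proof
      assume c: "c \<in> A.op d"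
      then have bd: "b \<in> A.op d" using b_op by blast
      have "const d \<prec> ratX - const b" using lower[of d] A.op_cl[OF c] by blast
      moreover have "const d \<prec> const (b - c)" using A.op_ball[OF c] bd unfolding const_lt by blast
      ultimately show "const d \<prec> ratX - const c" using lt_distance[of d c] by blast
    next
      assume "const d \<prec> ratX - const c"
      then have d: "const d \<prec> ratX - const b" "base.lt d (b - c)"
        using lt_distance[of d c] unfolding const_lt by blast+
      have "b \<in> A.op d" by (rule b_op[OF open_nonempty[OF supp[OF lt_imp_le[OF d(1)]]]])
      then show "c \<in> A.op d" using A.op_ball[of b d c] d(2) base.minus_commute_lt by blast
    qed
  qed
qed

text \<open>
  Here \<open>v (x - b)\<close> is the largest radius \<open>v \<delta>\<close>, which occurs for a closed ball but not for an open one.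
\<close>

lemma appr_residue_extending:
  assumes A: "approx_type G0 v0 A"
    and b: "b \<in> approx_type.cl v0 A \<delta>" and op: "approx_type.op v0 A \<delta> = {}"
    and max: "\<And>d. approx_type.cl v0 A d \<noteq> {} \<Longrightarrow> value_le G0 v0 d \<delta>"
    and x: "ratX - const b \<approx> const \<delta>"
  shows "appr v0 G v = A"
proof -
  interpret A: approx_type G0 v0 A by (rule A)
  have le_x: "const d \<preceq> ratX - const b \<longleftrightarrow> value_le G0 v0 d \<delta>" for d
    using le_eqv_trans[OF _ x] le_eqv_trans[OF _ eqv_sym[OF x]] unfolding const_le[symmetric] by blast
  have lt_x: "const d \<prec> ratX - const b \<longleftrightarrow> base.lt d \<delta>" for d
    using lt_eqv_trans[OF _ x] lt_eqv_trans[OF _ eqv_sym[OF x]] unfolding const_lt[symmetric] by blast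
  show ?thesis
  proof (rule appr_eqI[OF A])
    fix c d
    have le_dist: "const d \<preceq> ratX - const c \<longleftrightarrow> value_le G0 v0 d \<delta> \<and> value_le G0 v0 d (b - c)"
      using le_distance[of d c] le_x[of d] const_le by blast
    have lt_dist: "const d \<prec> ratX - const c \<longleftrightarrow> base.lt d \<delta> \<and> base.lt d (b - c)"
      using lt_distance[of d c] lt_x[of d] const_lt by blast
    show "c \<in> A.cl d \<longleftrightarrow> const d \<preceq> ratX - const c"
      unfolding le_dist
    proof
      assume c: "c \<in> A.cl d"
      then have d: "value_le G0 v0 d \<delta>" using max by blast
      then have "b \<in> A.cl d" using A.cl_mono[OF b] by blast
      then show "value_le G0 v0 d \<delta> \<and> value_le G0 v0 d (b - c)" using d A.cl_ball[OF c] by blast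
    next
      assume d: "value_le G0 v0 d \<delta> \<and> value_le G0 v0 d (b - c)"
      then have "b \<in> A.cl d" using A.cl_mono[OF b] by blast
      then show "c \<in> A.cl d" using d A.cl_ball[of b d c] base.minus_commute_le by blast
    qed
    show "c \<in> A.op d \<longleftrightarrow> const d \<prec> ratX - const c"
      unfolding lt_dist
    proof
      assume c: "c \<in> A.op d"
      then have "value_le G0 v0 d \<delta>" using max A.op_cl by blast
      moreover have "\<not> base.eqv d \<delta>" using A.op_cong[of d \<delta>] op c by blast
      ultimately have d: "base.lt d \<delta>" using base.le_cases by blast
      then have "b \<in> A.op d" using A.cl_down[OF b] by blast
      then show "base.lt d \<delta> \<and> base.lt d (b - c)" using d A.op_ball[OF c] by blast
    next
      assume d: "base.lt d \<delta> \<and> base.lt d (b - c)"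
      then have "b \<in> A.op d" using A.cl_down[OF b] by blast
      then show "c \<in> A.op d" using d A.op_ball[of b d c] base.minus_commute_lt by blast
    qed
  qed
qed

end

section \<open>Realizing immediate approximation types\<close>

context immediate_approx
begin

lemma common_point:
  assumes "base.fixed p" "base.fixed q" "base.fixed r"
  shows "\<exists>c. poly p c \<approx> eventual p \<and> poly q c \<approx> eventual q \<and> poly r c \<approx> eventual r"
  by (rule eventually_happens'[OF base.F_nonbot]) (intro eventually_conj pt assms)

lemma eventual_mult:
  assumes "base.fixed p" "base.fixed q" "base.fixed (p * q)"
  shows "eventual (p * q) \<approx> eventual p * eventual q"
proof -
  obtain c where c: "poly p c \<approx> eventual p" "poly q c \<approx> eventual q" "poly (p * q) c \<approx> eventual (p * q)"
    using common_point[OF assms] by blast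
  have "poly (p * q) c \<approx> eventual p * eventual q" using eqv_mult[OF c(1,2)] by simp
  then show ?thesis by (rule eqv_trans[OF eqv_sym[OF c(3)]])
qed

lemma eventual_add:
  assumes "base.fixed p" "base.fixed q" "base.fixed (p + q)"
  shows "eventual p \<preceq> eventual (p + q) \<or> eventual q \<preceq> eventual (p + q)"
proof -
  obtain c where c: "poly p c \<approx> eventual p" "poly q c \<approx> eventual q" "poly (p + q) c \<approx> eventual (p + q)"
    using common_point[OF assms] by blast
  have "poly p c \<preceq> poly (p + q) c \<or> poly q c \<preceq> poly (p + q) c"
    using le_total[of "poly p c" "poly q c"] le_add1[of "poly p c" "poly q c"]
      le_add1[of "poly q c" "poly p c"] by (auto simp: add.commute)
  then show ?thesis
    using le_eqv_trans[OF eqv_le_trans[OF eqv_sym[OF c(1)]] c(3)]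
      le_eqv_trans[OF eqv_le_trans[OF eqv_sym[OF c(2)]] c(3)] by blast
qed

lemma eventual_linear: "eventual [:- c, 1:] \<approx> base.rad c"
proof -
  have "base.fixed [:- c, 1:]" by (rule linear_fixed) simp
  then have "\<forall>\<^sub>F d in filt. poly [:- c, 1:] d \<approx> eventual [:- c, 1:] \<and> d - c \<approx> base.rad c"
    by (intro eventually_conj pt base_rad)
  then obtain d where "poly [:- c, 1:] d \<approx> eventual [:- c, 1:]" "d - c \<approx> base.rad c"
    using eventually_happens'[OF base.F_nonbot] by blast
  moreover have "poly [:- c, 1:] d = d - c" by simp
  ultimately show ?thesis using eqv_trans[OF eqv_sym] by metis
qed

lemma eventual_const: "eventual [:c:] = c"
  by simp

lemma appr_eq_if_eventual:
  assumes ext: "extension G v H w"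
    and linear: "\<And>c. w (of_poly [:- c, 1:]) = w (const (eventual [:- c, 1:]))"
  shows "appr v H w = A"
proof -
  interpret E: extension_of G v H w by (rule extension_imp_extension_of[OF valuation ext])
  interpret E: immediate_extension G v H w A by unfold_locales
  have "E.X.limit ratX"
  proof (rule E.limitI_rad)
    fix c
    have "E.eqv (of_poly [:- c, 1:]) (const (eventual [:- c, 1:]))"
      using linear E.v_eq_iff by blast
    then show "E.eqv (ratX - const c) (const (base.rad c))"
      using E.eqv_trans eventual_linear unfolding of_poly_linear E.const_eqv[symmetric] by blast
  qed
  then show ?thesis by (rule E.limit_imp_appr)
qed

text \<open>
  Eventual values are multiplicative and satisfy the ultrametric inequality, as this holds at a point
  of \<open>K\<close> where all the polynomials involved have their eventual values.
\<close>

lemma transcendental_extension: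
  assumes fixed: "\<And>p. base.fixed p"
  shows "\<exists>w. extension G v G w \<and> appr v G w = A"
proof -
  have pv: "poly_valuation G (\<lambda>p. v (eventual p))"
    unfolding poly_valuation_def
  proof (intro conjI allI)
    show "ordered_abelian_group G" by (rule valuationD(1)[OF valuation])
    fix p q :: "'k poly"
    show "v (eventual p) \<in> insert None (Some ` carrier G)" by (rule valuationD(2)[OF valuation])
    show "v (eventual p) = None \<longleftrightarrow> p = 0"
      using eventual_nonzero[OF fixed, of p] valuationD(3)[OF valuation, of "eventual p"] fixed
      unfolding below_fixed_def by auto
    show "v (eventual (p * q)) = vadd G (v (eventual p)) (v (eventual q))"
      using eventual_mult[OF fixed fixed fixed, of p q] valuationD(4)[OF valuation] v_eq_iff by metis
    show "vle G (v (eventual p)) (v (eventual (p + q))) \<or> vle G (v (eventual q)) (v (eventual (p + q)))"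
      using eventual_add[OF fixed fixed fixed, of p q] unfolding value_le_def .
  qed
  obtain w where w: "valuation G w" "\<And>p. w (of_poly p) = v (eventual p)"
    using poly_valuation_extends[OF pv] by blast
  have const: "w (const c) = v c" for c
    using w(2)[of "[:c:]"] by simp
  have "group_order_embedding (value_group G v) G id" by (rule id_embedding[OF valuation])
  then have ext: "extension G v G w"
    unfolding extension_def using w(1) const by (auto intro!: exI[of _ id] simp: option.map_id)
  have "appr v G w = A"
    by (rule appr_eq_if_eventual[OF ext]) (simp only: w(2) const)
  then show ?thesis using ext by blast
qed

text \<open>
  Write \<open>a * b = q * f + r\<close>.  Along the filter the values of \<open>a * b\<close> and \<open>r\<close> are eventually constant, while
  that of \<open>q * f\<close> increases strictly.  So \<open>q * f\<close> cannot be one of the two summands of minimal value: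
  \<open>r\<close> and \<open>a * b\<close> have the same value, and \<open>q * f\<close> has a larger one.
\<close>

lemma carry:
  assumes f: "\<not> base.fixed f" "below_fixed f"
    and ab: "Polynomial.degree a < Polynomial.degree f" "Polynomial.degree b < Polynomial.degree f"
  defines "q \<equiv> (a * b) div f" and "r \<equiv> (a * b) mod f"
  shows "Polynomial.degree q < Polynomial.degree f" "eventual r \<approx> eventual a * eventual b"
    "q \<noteq> 0 \<Longrightarrow> \<forall>\<^sub>F c in filt. eventual a * eventual b \<prec> eventual q * poly f c"
proof -
  have deg_f: "Polynomial.degree f > 0" using f(1) base.fixed_const by blast
  have f0: "f \<noteq> 0" using deg_f by auto
  show deg_q: "Polynomial.degree q < Polynomial.degree f"
  proof (cases "q = 0")
    case False
    have "Polynomial.degree q + Polynomial.degree f = Polynomial.degree (a * b)"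
      using div_poly_degree[OF deg_f] False unfolding q_def by blast
    moreover have "Polynomial.degree (a * b) \<le> Polynomial.degree a + Polynomial.degree b"
      by (rule Polynomial.degree_mult_le)
    ultimately show ?thesis using ab by linarith
  qed (use deg_f in simp)
  have deg_r: "Polynomial.degree r < Polynomial.degree f"
    unfolding r_def using degree_mod_less[OF f0, of "a * b"] deg_f by auto
  have fx: "base.fixed a" "base.fixed b" "base.fixed q" "base.fixed r"
    using f(2) ab deg_q deg_r unfolding below_fixed_def by blast+
  have ab_eq: "a * b = q * f + r" by (simp add: q_def r_def)
  define z where "z = eventual a * eventual b"
  have main: "eventual r \<approx> z \<and> (\<forall>\<^sub>F c in filt. z \<prec> eventual q * poly f c)" if q0: "q \<noteq> 0"
  proof -
    obtain h e where he: "h > 0" "e \<noteq> 0" "\<forall>\<^sub>F c in filt. poly f c \<approx> e * base.rad c ^ h"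
      by (rule base.nonfixed_growth[of f]) (use f in \<open>auto simp: below_fixed_def\<close>)
    have "below_fixed q" using f(2) deg_q unfolding below_fixed_def by auto
    then have q1: "eventual q \<noteq> 0" using eventual_nonzero fx(3) q0 by blast
    define y where "y = eventual q * e"
    have y0: "y \<noteq> 0" using q1 he(2) by (simp add: y_def)
    have grow: "y * base.rad c ^ h \<prec> y * base.rad d ^ h" if "base.rad c \<prec> base.rad d" for c d
      using lt_power[OF that he(1)] y0 by (simp add: lt_mult_iff)
    have at: "\<forall>\<^sub>F c in filt. poly a c * poly b c \<approx> z \<and> poly q c * poly f c \<approx> y * base.rad c ^ h
        \<and> poly r c \<approx> eventual r \<and> eventual q * poly f c \<approx> y * base.rad c ^ h"
      using pt[OF fx(1)] pt[OF fx(2)] pt[OF fx(3)] pt[OF fx(4)] he(3)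
    proof eventually_elim
      case (elim c)
      show ?case
        using eqv_mult[OF elim(1,2)] eqv_mult[OF elim(3,5)] elim(4) eqv_mult[OF eqv_refl elim(5), of "eventual q"]
        unfolding z_def y_def by (simp add: mult_ac)
    qed
    have r_at: "poly r c = poly a c * poly b c - poly q c * poly f c" for c
      using arg_cong[OF ab_eq, of "\<lambda>p. poly p c"] by simp
    have "\<exists>c. z \<preceq> y * base.rad c ^ h"
    proof (rule ccontr)
      assume "\<not> ?thesis"
      then have less: "y * base.rad c ^ h \<prec> z" for c unfolding lt_def by blast
      have r_grows: "\<forall>\<^sub>F c in filt. eventual r \<approx> y * base.rad c ^ h"
        using at
      proof eventually_elim
        case (elim c)
        have "poly q c * poly f c \<prec> poly a c * poly b c"
          using elim less[of c] eqv_lt_trans lt_eqv_trans eqv_sym by blast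
        then have "- (poly q c * poly f c) + poly a c * poly b c \<approx> - (poly q c * poly f c)"
          by (intro lt_add_eqv) simp
        then have "poly r c \<approx> poly q c * poly f c" unfolding r_at by simp
        then show ?case using elim eqv_sym eqv_trans by blast
      qed
      obtain c where c: "eventual r \<approx> y * base.rad c ^ h"
        using eventually_happens'[OF base.F_nonbot r_grows] by blast
      obtain d where d: "eventual r \<approx> y * base.rad d ^ h" "base.rad c \<prec> base.rad d"
        using eventually_happens'[OF base.F_nonbot eventually_conj[OF r_grows base.rad_increasing[of c]]] by auto
      have "y * base.rad c ^ h \<approx> y * base.rad d ^ h" by (rule eqv_trans[OF eqv_sym[OF c] d(1)])
      then show False using grow[OF d(2)] by (simp add: eqv_def lt_def)
    qed
    then obtain c0 where c0: "z \<preceq> y * base.rad c0 ^ h" by blast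
    have "\<forall>\<^sub>F c in filt. z \<prec> y * base.rad c ^ h"
      using base.rad_increasing[of c0]
    proof eventually_elim
      case (elim c)
      then show ?case using le_lt_trans[OF c0 grow] by simp
    qed
    with at have ev: "\<forall>\<^sub>F c in filt. z \<prec> eventual q * poly f c \<and> eventual r \<approx> z"
    proof eventually_elim
      case (elim c)
      have 1: "z \<prec> eventual q * poly f c" using elim lt_eqv_trans eqv_sym by blast
      have "poly a c * poly b c \<prec> - (poly q c * poly f c)"
        unfolding minus_lt using elim eqv_lt_trans lt_eqv_trans eqv_sym by blast
      then have "poly a c * poly b c + - (poly q c * poly f c) \<approx> poly a c * poly b c" by (rule lt_add_eqv)
      then have "poly r c \<approx> poly a c * poly b c" unfolding r_at by simp
      then have "eventual r \<approx> z" using elim eqv_sym eqv_trans by blast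
      then show ?case using 1 by blast
    qed
    then have "eventual r \<approx> z" using eventually_happens'[OF base.F_nonbot] by blast
    moreover have "\<forall>\<^sub>F c in filt. z \<prec> eventual q * poly f c" using ev by (rule eventually_mono) blast
    ultimately show ?thesis by blast
  qed
  show "eventual r \<approx> eventual a * eventual b"
  proof (cases "q = 0")
    case True
    then have "r = a * b" using ab_eq by simp
    then show ?thesis using eventual_mult[OF fx(1,2)] fx(4) by simp
  qed (use main z_def in blast)
  show "\<forall>\<^sub>F c in filt. eventual a * eventual b \<prec> eventual q * poly f c" if "q \<noteq> 0"
    using main[OF that] unfolding z_def by blast
qed

text \<open>
  A non-fixed polynomial of minimal degree is a key polynomial for the eventual values, with any
  value \<open>\<beta>\<close> that bounds the values it takes along the filter.
\<close>

lemma key_polynomial_eventual: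
  assumes f: "\<not> base.fixed f" "below_fixed f"
    and H: "ordered_abelian_group H" and emb: "group_order_embedding (value_group G v) H \<iota>"
    and \<beta>: "\<beta> \<in> carrier H"
    and bound: "\<forall>\<^sub>F c in filt. vle H (map_option \<iota> (v (poly f c))) (Some \<beta>)"
  shows "key_polynomial H (\<lambda>a. map_option \<iota> (v (eventual a))) f \<beta>"
proof -
  interpret H: ordered_abelian_group H by (rule H)
  note e = embedding_value[OF valuation emb]
  have eqv_imp: "map_option \<iota> (v a) = map_option \<iota> (v b)" if "a \<approx> b" for a b
    using that v_eq_iff by metis
  show ?thesis
  proof (intro key_polynomial.intro key_polynomial_axioms.intro H)
    show "0 < Polynomial.degree f" using f(1) base.fixed_const by blast
    show "\<beta> \<in> carrier H" by (rule \<beta>)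
    fix a b :: "'k poly"
    show "map_option \<iota> (v (eventual a)) \<in> insert None (Some ` carrier H)" by (rule e(1))
    assume a: "Polynomial.degree a < Polynomial.degree f"
    then have fa: "base.fixed a" "below_fixed a" using f(2) unfolding below_fixed_def by auto
    show "map_option \<iota> (v (eventual a)) = None \<longleftrightarrow> a = 0"
      unfolding e(2) using eventual_nonzero[OF fa] by auto
    assume b: "Polynomial.degree b < Polynomial.degree f"
    then have fb: "base.fixed b" "base.fixed (a + b)"
      using f(2) Polynomial.degree_add_less[OF a b] unfolding below_fixed_def by auto
    show "vle H (map_option \<iota> (v (eventual a))) (map_option \<iota> (v (eventual (a + b))))
        \<or> vle H (map_option \<iota> (v (eventual b))) (map_option \<iota> (v (eventual (a + b))))"
      unfolding e(4) using eventual_add fa fb by blast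
    note carry = carry[OF f a b]
    show "map_option \<iota> (v (eventual ((a * b) mod f)))
        = vadd H (map_option \<iota> (v (eventual a))) (map_option \<iota> (v (eventual b)))"
      using eqv_imp[OF carry(2)] unfolding e(3) .
    show "vle H (vadd H (map_option \<iota> (v (eventual a))) (map_option \<iota> (v (eventual b))))
        (vadd H (Some \<beta>) (map_option \<iota> (v (eventual ((a * b) div f)))))"
    proof (cases "(a * b) div f = 0")
      case True
      then show ?thesis by (simp add: v_0 H.vadd_None)
    next
      case False
      let ?q = "(a * b) div f"
      obtain c where c: "eventual a * eventual b \<prec> eventual ?q * poly f c"
        "vle H (map_option \<iota> (v (poly f c))) (Some \<beta>)"
        using eventually_happens'[OF base.F_nonbot eventually_conj[OF carry(3)[OF False] bound]] by blast
      have \<beta>V: "Some \<beta> \<in> insert None (Some ` carrier H)" using \<beta> by blast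
      have "vle H (map_option \<iota> (v (eventual a * eventual b))) (map_option \<iota> (v (eventual ?q * poly f c)))"
        unfolding e(4) by (rule lt_imp_le[OF c(1)])
      moreover have "vle H (map_option \<iota> (v (eventual ?q * poly f c))) (vadd H (map_option \<iota> (v (eventual ?q))) (Some \<beta>))"
        unfolding e(3) by (intro H.vadd_mono e(1) \<beta>V c(2))
      ultimately have "vle H (map_option \<iota> (v (eventual a * eventual b))) (vadd H (map_option \<iota> (v (eventual ?q))) (Some \<beta>))"
        by (rule H.vle_trans[OF e(1) e(1) H.vadd_closed[OF e(1) \<beta>V]])
      then show ?thesis unfolding e(3) by (simp only: H.vadd_comm[OF e(1) \<beta>V])
    qed
  qed
qed

text \<open>
  The new valuation gives \<open>x - c\<close> its eventual value, because \<open>f\<close>, not being fixed, has degree at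
  least two; so \<open>x\<close> becomes a pseudo-limit.
\<close>

lemma algebraic_extension:
  assumes f: "\<not> base.fixed f" "below_fixed f"
    and H: "ordered_abelian_group H" and emb: "group_order_embedding (value_group G v) H \<iota>"
    and \<beta>: "\<beta> \<in> carrier H"
    and bound: "\<forall>\<^sub>F c in filt. vle H (map_option \<iota> (v (poly f c))) (Some \<beta>)"
  shows "\<exists>w. extension G v H w \<and> appr v H w = A \<and> (\<forall>c. w (const c) = map_option \<iota> (v c))
    \<and> key_extension G v H w (\<lambda>a. map_option \<iota> (v (eventual a))) f \<beta>"
proof -
  obtain w where w: "extension G v H w" "\<forall>c. w (const c) = map_option \<iota> (v c)"
    "key_extension G v H w (\<lambda>a. map_option \<iota> (v (eventual a))) f \<beta>"
    using key_extension_exists[OF valuation emb key_polynomial_eventual[OF assms]] eventual_const by auto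
  interpret E: key_extension G v H w "\<lambda>a. map_option \<iota> (v (eventual a))" f \<beta> by (rule w(3))
  have "\<not> Polynomial.degree f \<le> 1" using linear_fixed f(1) by blast
  then have small: "E.key.small [:- c, 1:]" for c by simp
  have "appr v H w = A"
    by (rule appr_eq_if_eventual[OF w(1)]) (simp only: E.v_w E.key.w_small[OF small] w(2)[rule_format])
  then show ?thesis using w by blast
qed

lemma minimal_nonfixed:
  assumes "\<not> base.fixed p"
  obtains f where "\<not> base.fixed f" "below_fixed f"
proof -
  obtain f where f: "\<not> base.fixed f" "\<And>g. \<not> base.fixed g \<Longrightarrow> Polynomial.degree f \<le> Polynomial.degree g"
    using ex_has_least_nat[of "\<lambda>g. \<not> base.fixed g" p Polynomial.degree] assms by blast
  then have "below_fixed f" unfolding below_fixed_def by (meson not_le)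
  then show ?thesis using that f(1) by blast
qed

text \<open>
  The distance from \<open>c\<close> to points far out is smaller than the radius of any ball of the type that
  excludes \<open>c\<close>.
\<close>

lemma rad_bound: "cl d = {} \<Longrightarrow> base.rad c \<prec> d"
proof -
  assume d: "cl d = {}"
  obtain g where g: "cl g \<noteq> {}" "c \<notin> cl g" using excluded by blast
  have "\<forall>\<^sub>F b in filt. b \<in> cl g \<and> b - c \<approx> base.rad c"
    by (intro eventually_conj eventually_cl g base_rad)
  then obtain b where b: "b \<in> cl g" "b - c \<approx> base.rad c"
    using eventually_happens'[OF base.F_nonbot] by blast
  have "base.rad c \<approx> b - c" by (rule eqv_sym[OF b(2)])
  also have "b - c \<prec> g"
    using cl_ball[OF b(1), of c] g(2) unfolding lt_def by (simp add: minus_commute_le)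
  also have "g \<preceq> d" using cl_mono[OF b(1), of d] d le_total[of g d] by blast
  finally show ?thesis .
qed

text \<open>
  Here \<open>\<beta>\<close> lies above the whole value group; the cut \<open>D\<close> is all of it.
\<close>

lemma adjoins_value_extension:
  assumes f: "\<not> base.fixed f" "below_fixed f"
  shows "\<exists>(H :: ('g \<times> int) ogroup) w. extension G v H w \<and> appr v H w = A \<and> adjoins_value (value_le H w)"
proof -
  define V where "V = value_group G v"
  interpret V: ordered_abelian_group V unfolding V_def by (rule value_group_ordered[OF valuation])
  define H where "H = adjoin_cut V (carrier V)"
  let ?\<iota> = "\<lambda>g. (g, 0 :: int)" and ?\<beta> = "(\<one>\<^bsub>V\<^esub>, 1 :: int)"
  have H: "ordered_abelian_group H" unfolding H_def by (rule V.adjoin_cut_ordered) simp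
  have emb: "group_order_embedding (value_group G v) H ?\<iota>"
    unfolding H_def V_def[symmetric] by (rule V.adjoin_cut_embedding) simp
  have \<beta>: "?\<beta> \<in> carrier H" by (simp add: H_def V.adjoin_cut_simps)
  obtain h e where he: "h > 0" "e \<noteq> 0" "\<forall>\<^sub>F c in filt. poly f c \<approx> e * base.rad c ^ h"
    by (rule base.nonfixed_growth[of f]) (use f in \<open>auto simp: below_fixed_def\<close>)
  have bound: "\<forall>\<^sub>F c in filt. vle H (map_option ?\<iota> (v (poly f c))) (Some ?\<beta>)"
    using he(3)
  proof eventually_elim
    case (elim c)
    then have "poly f c \<noteq> 0" using he(2) base.rad_nonzero[of c] eqv_imp_zero_iff[OF elim] by simp
    then obtain g where g: "v (poly f c) = Some g" using valuationD(3)[OF valuation, of "poly f c"] by auto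
    then have "g \<in> carrier V" by (auto simp: V_def value_group_def values_of_def)
    then show ?case using V.adjoin_cut_lower[of "carrier V" g] by (simp add: g H_def ord_less_def)
  qed
  obtain w where w: "extension G v H w" "appr v H w = A" "\<And>c. w (const c) = map_option ?\<iota> (v c)"
    "key_extension G v H w (\<lambda>a. map_option ?\<iota> (v (eventual a))) f ?\<beta>"
    using algebraic_extension[OF f H emb \<beta> bound] by blast
  interpret E: key_extension G v H w "\<lambda>a. map_option ?\<iota> (v (eventual a))" f ?\<beta> by (rule w(4))
  have "adjoins_value (value_le H w)"
  proof (rule E.adjoins_value)
    show "\<exists>c. E.eqv (of_poly a) (const c)" if "E.key.small a" for a
      using E.v_eq_iff E.v_w[of a] E.key.w_small[OF that] w(3)[of "eventual a"] by metis
    show "\<not> E.eqv (of_poly f ^ n) (const c)" if "n > 0" for n c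
    proof
      assume "E.eqv (of_poly f ^ n) (const c)"
      then have "w (of_poly f ^ n) = w (const c)" using E.v_eq_iff by blast
      moreover have "w (of_poly f ^ n) = Some (\<one>\<^bsub>V\<^esub>, int n)"
        using valuation_power[OF E.valuation E.v_f, of n] V.adjoin_cut_pow[of "carrier V" n]
        by (simp add: H_def)
      ultimately show False using that w(3)[of c] by (cases "v c") auto
    qed
  qed
  then show ?thesis using w by blast
qed

text \<open>
  Along the filter \<open>f\<close> has values \<open>v (e * rad c ^ h)\<close>.  If \<open>v d\<close> is not in the support, these are bounded
  by \<open>v (e * d ^ h)\<close>, which can serve as \<open>\<beta>\<close> and is the value of a constant.
\<close>

lemma adjoins_residue_extension:
  assumes f: "\<not> base.fixed f" "below_fixed f" and d: "cl d = {}" "d \<noteq> 0"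
  shows "\<exists>(H :: 'g ogroup) w. extension G v H w \<and> appr v H w = A \<and> adjoins_residue (value_le H w)"
proof -
  have G: "ordered_abelian_group G" by (rule valuationD(1)[OF valuation])
  have emb: "group_order_embedding (value_group G v) G id" by (rule id_embedding[OF valuation])
  obtain h e where he: "h > 0" "e \<noteq> 0" "\<forall>\<^sub>F c in filt. poly f c \<approx> e * base.rad c ^ h"
    by (rule base.nonfixed_growth[of f]) (use f in \<open>auto simp: below_fixed_def\<close>)
  have "e * d ^ h \<noteq> 0" using he d by simp
  then obtain \<beta> where \<beta>: "v (e * d ^ h) = Some \<beta>" using valuationD(3)[OF valuation, of "e * d ^ h"] by auto
  then have \<beta>G: "\<beta> \<in> carrier G" using valuationD(2)[OF valuation, of "e * d ^ h"] by auto
  have bound: "\<forall>\<^sub>F c in filt. vle G (map_option id (v (poly f c))) (Some \<beta>)"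
    using he(3)
  proof eventually_elim
    case (elim c)
    have "e * base.rad c ^ h \<preceq> e * d ^ h" by (intro le_mult le_power lt_imp_le rad_bound d)
    with elim have "poly f c \<preceq> e * d ^ h" by (rule eqv_le_trans)
    then show ?case by (simp add: value_le_def \<beta> option.map_id)
  qed
  obtain w where w: "extension G v G w" "appr v G w = A" "\<And>c. w (const c) = map_option id (v c)"
    "key_extension G v G w (\<lambda>a. map_option id (v (eventual a))) f \<beta>"
    using algebraic_extension[OF f G emb \<beta>G bound] by blast
  interpret E: key_extension G v G w "\<lambda>a. map_option id (v (eventual a))" f \<beta> by (rule w(4))
  interpret E: immediate_extension G v G w A by unfold_locales
  have "adjoins_residue (value_le G w)"
  proof (rule E.adjoins_residue)
    show "w (const (e * d ^ h)) = Some \<beta>" unfolding w(3) \<beta> by simp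
    show "\<exists>c. E.lt (of_poly a) (of_poly a - const c)" if "E.key.small a" "a \<noteq> 0" for a
      using E.fixed_approx_const[OF E.appr_imp_limit[OF w(2)] that(2)] that(1) f(2)
      unfolding below_fixed_def by auto
  qed
  then show ?thesis using w by blast
qed

end

section \<open>Uniqueness for immediate approximation types\<close>

lemma key_decomposition:
  fixes f q :: "'k::field poly"
  assumes "Polynomial.degree f > 0" "q \<noteq> 0"
  shows "\<exists>i a r. Polynomial.degree a < Polynomial.degree f \<and> a \<noteq> 0 \<and> q = f ^ i * (a + f * r)"
  using assms(2)
proof (induction "Polynomial.degree q" arbitrary: q rule: less_induct)
  case less
  have f0: "f \<noteq> 0" using assms(1) by auto
  have q: "q = q mod f + f * (q div f)" by (simp add: mult.commute)
  show ?case
  proof (cases "q mod f = 0")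
    case True
    then have q': "q = f * (q div f)" using q by simp
    then have ne: "q div f \<noteq> 0" using less.prems by auto
    then have "Polynomial.degree (q div f) < Polynomial.degree q"
      using div_poly_smaller[OF assms(1), of q] by blast
    then obtain i a r where "Polynomial.degree a < Polynomial.degree f" "a \<noteq> 0" "q div f = f ^ i * (a + f * r)"
      using less.hyps[OF _ ne] by blast
    moreover from this have "q = f ^ Suc i * (a + f * r)" using q' by (simp add: mult_ac)
    ultimately show ?thesis by blast
  next
    case False
    then have "Polynomial.degree (q mod f) < Polynomial.degree f" using degree_mod_less[OF f0, of q] by blast
    then show ?thesis using False q by (intro exI[of _ 0] exI[of _ "q mod f"] exI[of _ "q div f"]) simp
  qed
qed

context immediate_extension
begin

lemma poly_bounded_below:
  assumes x: "X.limit ratX"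
  shows "\<exists>e. e \<noteq> 0 \<and> const e \<preceq> of_poly r"
proof (induction r)
  case 0
  show ?case by (intro exI[of _ 1]) simp
next
  case (pCons a p)
  obtain e where e: "e \<noteq> 0" "const e \<preceq> of_poly p" using pCons by blast
  let ?y = "X.rad 0"
  have "ratX \<approx> const ?y" using X.limit_rad[OF x, of 0] by simp
  then have y: "const ?y \<preceq> ratX" by (simp add: eqv_def)
  have ye: "?y * e \<noteq> 0" using e X.rad_nonzero[of 0] by simp
  have 1: "const (?y * e) \<preceq> ratX * of_poly p" using le_mult_mono[OF y e(2)] by simp
  show ?case
  proof (cases "a \<noteq> 0 \<and> const a \<preceq> const (?y * e)")
    case True
    then have "const a \<preceq> ratX * of_poly p" using le_trans[OF _ 1] by blast
    then show ?thesis
      using True le_add1[of "const a" "ratX * of_poly p"] unfolding of_poly_pCons by blast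
  next
    case False
    then have "const (?y * e) \<preceq> const a"
      using le_total[of "const a" "const (?y * e)"] by (cases "a = 0") auto
    then have "const (?y * e) \<preceq> of_poly (pCons a p)"
      unfolding of_poly_pCons using 1 by (rule le_add)
    then show ?thesis using ye by blast
  qed
qed

text \<open>
  The values \<open>v (f c)\<close> are lower bounds for \<open>v f\<close>, and they are cofinal in the value group when the radii
  are, since \<open>v (f c) = v (e * rad c ^ h)\<close> with \<open>h > 0\<close>.
\<close>

lemma nonfixed_large:
  assumes A: "appr v0 G v = A" and full: "\<And>d. d \<noteq> 0 \<Longrightarrow> base.cl d \<noteq> {}"
    and f: "\<not> base.base.fixed f" "base.below_fixed f" and a: "a \<noteq> 0"
  shows "const a \<prec> of_poly f"
proof -
  have x: "X.limit ratX" by (rule appr_imp_limit[OF A])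
  obtain h e where he: "h > 0" "e \<noteq> 0" "\<forall>\<^sub>F c in base.filt. const (poly f c) \<approx> const (e * X.rad c ^ h)"
    and upper: "\<forall>\<^sub>F c in base.filt. const (poly f c) \<preceq> X.ev f ratX"
    by (rule X.nonfixed_growth[of f]) (use f x in \<open>auto simp: base.below_fixed_def X_fixed\<close>)
  obtain g where g: "base.cl g \<noteq> {}" "1 \<preceq> const g" "const (a / e) \<prec> const g"
  proof -
    have ae: "a / e \<noteq> 0" using a he by simp
    show thesis
    proof (cases "const (a / e) \<preceq> const 1")
      case True
      obtain g where g: "base.cl g \<noteq> {}" "base.lt 1 g" using base.no_max[OF full[of 1]] by auto
      then have "const 1 \<prec> const g" unfolding const_lt by blast
      then show ?thesis using that[OF g(1)] True le_lt_trans[of "const (a / e)" "const 1"] lt_imp_le by simp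
    next
      case False
      obtain g where g: "base.cl g \<noteq> {}" "base.lt (a / e) g" using base.no_max[OF full[OF ae]] by blast
      then have "const (a / e) \<prec> const g" unfolding const_lt by blast
      moreover have "const 1 \<prec> const (a / e)" using False unfolding lt_def by blast
      ultimately show ?thesis using that[OF g(1)] lt_imp_le lt_trans[of "const 1"] by simp
    qed
  qed
  have "\<forall>\<^sub>F c in base.filt. c \<in> base.cl g \<and> const (poly f c) \<approx> const (e * X.rad c ^ h)
      \<and> const (poly f c) \<preceq> X.ev f ratX"
    by (intro eventually_conj base.eventually_cl g he upper)
  then obtain c where c: "c \<in> base.cl g" "const (poly f c) \<approx> const (e * X.rad c ^ h)"
    "const (poly f c) \<preceq> X.ev f ratX"
    using eventually_happens'[OF X.F_nonbot] by blast
  have "const g \<preceq> ratX - const c" using c(1) appr_cl[of g] unfolding A near_closed_def by blast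
  then have rad: "const g \<preceq> const (X.rad c)" using X.limit_rad[OF x, of c] by (rule le_eqv_trans)
  have "const (a / e) \<prec> const g" by (rule g(3))
  also have "const g \<preceq> const g ^ h"
  proof (cases h)
    case (Suc m)
    then show ?thesis using le_mult[OF le_power[OF g(2), of m], of "const g"] by simp
  qed (use he in simp)
  also have "const g ^ h \<preceq> const (X.rad c) ^ h" by (rule le_power[OF rad])
  finally have "const e * const (a / e) \<prec> const e * const (X.rad c) ^ h"
    using he(2) by (simp only: lt_mult_iff const_eq_0_iff not_False_eq_True)
  then have "const a \<prec> const (e * X.rad c ^ h)" using he(2) by simp
  also have "\<dots> \<approx> const (poly f c)" by (rule eqv_sym[OF c(2)])
  also have "\<dots> \<preceq> of_poly f" using c(3) unfolding X_ev .
  finally show ?thesis .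
qed

text \<open>
  As \<open>v f\<close> exceeds all values of constants, the lowest nonzero digit of a polynomial decides its value.
  Neither the digit nor its eventual value depends on the extension.
\<close>

lemma leading_value:
  assumes A: "appr v0 G v = A" and full: "\<And>d. d \<noteq> 0 \<Longrightarrow> base.cl d \<noteq> {}"
    and f: "\<not> base.base.fixed f" "base.below_fixed f"
    and a: "Polynomial.degree a < Polynomial.degree f" "a \<noteq> 0"
  shows "of_poly (f ^ i * (a + f * r)) \<approx> const (base.eventual a) * of_poly f ^ i" "base.eventual a \<noteq> 0"
proof -
  have x: "X.limit ratX" by (rule appr_imp_limit[OF A])
  have fa: "base.base.fixed a" "base.below_fixed a" using f(2) a(1) unfolding base.below_fixed_def by auto
  show a0: "base.eventual a \<noteq> 0" by (rule base.eventual_nonzero[OF fa a(2)])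
  have av: "of_poly a \<approx> const (base.eventual a)" by (rule fixed_eqv_const[OF x fa])
  obtain e where e: "e \<noteq> 0" "const e \<preceq> of_poly r" using poly_bounded_below[OF x] by blast
  have "const (base.eventual a / e) \<prec> of_poly f"
    using a0 e by (intro nonfixed_large[OF A full f]) simp_all
  then have "const (base.eventual a / e) * const e \<prec> of_poly f * of_poly r"
    by (rule lt_le_mult[OF _ e(2)]) (use e in simp)
  then have "const (base.eventual a) \<prec> of_poly f * of_poly r" using e by simp
  with av have "of_poly a \<prec> of_poly f * of_poly r" by (rule eqv_lt_trans)
  then have "of_poly a + of_poly f * of_poly r \<approx> of_poly a" by (rule lt_add_eqv)
  then have "of_poly a + of_poly f * of_poly r \<approx> const (base.eventual a)" using av by (rule eqv_trans)
  then have "(of_poly a + of_poly f * of_poly r) * of_poly f ^ i \<approx> const (base.eventual a) * of_poly f ^ i"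
    by (intro eqv_mult eqv_refl)
  then show "of_poly (f ^ i * (a + f * r)) \<approx> const (base.eventual a) * of_poly f ^ i"
    by (simp add: mult.commute)
qed

text \<open>
  The values \<open>v c + i * v y\<close> are ordered lexicographically, the exponent coming first.
\<close>

lemma compare_leading:
  assumes large: "\<And>a. a \<noteq> 0 \<Longrightarrow> const a \<prec> y" and y: "y \<noteq> 0" and cd: "c \<noteq> 0" "d \<noteq> 0"
  shows "const c * y ^ i \<preceq> const d * y ^ j \<longleftrightarrow> i < j \<or> i = j \<and> value_le G0 v0 c d"
proof -
  have one: "1 \<preceq> y" using lt_imp_le[OF large[of 1]] by simp
  have less: "const c * y ^ i \<prec> const d * y ^ j" if "i < j" "c \<noteq> 0" "d \<noteq> 0" for c d i j
  proof -
    obtain m where m: "j = i + Suc m" using less_imp_Suc_add[OF \<open>i < j\<close>] by auto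
    have "const (c / d) \<prec> y" by (rule large) (use that in simp)
    also have "y \<preceq> y * y ^ m" using le_mult[OF le_power[OF one, of m], of y] by simp
    finally have "(const d * y ^ i) * const (c / d) \<prec> (const d * y ^ i) * (y * y ^ m)"
      using y that by (subst lt_mult_iff) simp_all
    then show ?thesis using that by (simp add: m power_add mult_ac)
  qed
  consider "i < j" | "i = j" | "j < i" by linarith
  then show ?thesis
  proof cases
    case 1
    then show ?thesis using lt_imp_le[OF less[OF 1 cd]] by simp
  next
    case 2
    then show ?thesis using le_mult_iff'[of "y ^ j" "const c" "const d"] y const_le by simp
  next
    case 3
    then show ?thesis using less[OF 3 cd(2,1)] by (simp add: lt_def)
  qed
qed

end

section \<open>Extensions with a canonical value group\<close>

lemma immediate_type_imp: "valuation G0 v0 \<Longrightarrow> immediate_type G0 v0 A \<Longrightarrow> immediate_approx G0 v0 A"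
  unfolding immediate_type_def
  by (intro immediate_approx.intro approx_type.intro field_valuation.intro approx_type_axioms.intro
      immediate_approx_axioms.intro) simp_all

lemma approx_typeI: "valuation G0 v0 \<Longrightarrow> A \<in> nontrivial_types G0 v0 \<Longrightarrow> approx_type G0 v0 A"
  by (intro approx_type.intro field_valuation.intro approx_type_axioms.intro)

lemma immediate_extensionI:
  assumes "valuation G0 v0" "extension G0 v0 G v" "immediate_type G0 v0 A"
  shows "immediate_extension G0 v0 G v A"
  by (rule immediate_extension.intro[OF extension_imp_extension_of[OF assms(1,2)]
        immediate_type_imp[OF assms(1,3)]])

lemma canonical_extension:
  fixes v0 :: "'k::field \<Rightarrow> 'g option" and v :: "'k ratfun \<Rightarrow> 'h option"
  assumes v0: "valuation G0 v0" and ext: "extension G0 v0 G v"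
  shows "\<exists>(H :: 'k canonical_value ogroup) w. extension G0 v0 H w \<and> value_le H w = value_le G v
           \<and> appr v0 H w = appr v0 G v"
proof -
  obtain H :: "'k canonical_value ogroup" and w where w: "extension G0 v0 H w" "equivalent_ext G v H w"
    using extension_canonical[OF ext] by blast
  have le: "value_le H w = value_le G v" using equivalent_ext_imp_value_le_eq[OF w(2)] by simp
  moreover have "appr v0 H w = appr v0 G v"
    by (rule appr_cong[OF extension_imp_extension_of[OF v0 w(1)] extension_imp_extension_of[OF v0 ext] le])
  ultimately show ?thesis using w by blast
qed

lemma canonical_value_transcendental:
  fixes v0 :: "'k::field \<Rightarrow> 'g option" and v :: "'k ratfun \<Rightarrow> 'h option"
  assumes v0: "valuation G0 v0" and ext: "extension G0 v0 G v" and "adjoins_value (value_le G v)"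
  shows "\<exists>(H :: 'k canonical_value ogroup) w. extension G0 v0 H w \<and> appr v0 H w = appr v0 G v
           \<and> value_transcendental H w"
proof -
  obtain H :: "'k canonical_value ogroup" and w where w: "extension G0 v0 H w"
    "value_le H w = value_le G v" "appr v0 H w = appr v0 G v"
    using canonical_extension[OF v0 ext] by blast
  interpret extension_of G0 v0 H w by (rule extension_imp_extension_of[OF v0 w(1)])
  have "value_transcendental H w" by (rule value_transcendentalI) (simp only: w(2) assms(3))
  then show ?thesis using w by blast
qed

lemma canonical_residue_transcendental:
  fixes v0 :: "'k::field \<Rightarrow> 'g option" and v :: "'k ratfun \<Rightarrow> 'h option"
  assumes v0: "valuation G0 v0" and ext: "extension G0 v0 G v" and "adjoins_residue (value_le G v)"
  shows "\<exists>(H :: 'k canonical_value ogroup) w. extension G0 v0 H w \<and> appr v0 H w = appr v0 G v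
           \<and> residue_transcendental H w"
proof -
  obtain H :: "'k canonical_value ogroup" and w where w: "extension G0 v0 H w"
    "value_le H w = value_le G v" "appr v0 H w = appr v0 G v"
    using canonical_extension[OF v0 ext] by blast
  interpret extension_of G0 v0 H w by (rule extension_imp_extension_of[OF v0 w(1)])
  have "residue_transcendental H w" by (rule residue_transcendentalI) (simp only: w(2) assms(3))
  then show ?thesis using w by blast
qed

section \<open>Extensions realizing an immediate type\<close>

text \<open>
  Every polynomial has the eventual value of its values at points of \<open>K\<close>, and differs from such a
  point value by something of larger value.
\<close>

lemma transcendental_immediate_ext:
  assumes v0: "valuation G0 v0" and A: "transcendental_immediate G0 v0 A"
    and ext: "extension G0 v0 G v" "appr v0 G v = A"
  shows "immediate_ext G v"
    and "value_le G v (of_poly p) (of_poly q) \<longleftrightarrow>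
      value_le G0 v0 (poly p (immediate_approx.pt G0 v0 A p)) (poly q (immediate_approx.pt G0 v0 A q))"
proof -
  have im: "immediate_type G0 v0 A" using A by (simp add: transcendental_immediate_def)
  interpret immediate_extension G0 v0 G v A by (rule immediate_extensionI[OF v0 ext(1) im])
  have fixed: "base.base.fixed p" for p
    using A base.base_fixed unfolding transcendental_immediate_def by blast
  have below: "base.below_fixed p" for p using fixed unfolding base.below_fixed_def by blast
  have x: "X.limit ratX" by (rule appr_imp_limit[OF ext(2)])
  show "immediate_ext G v"
    by (rule immediate_extI) (rule fixed_approx_const[OF x _ fixed below])
  have 1: "of_poly p \<approx> const (base.eventual p)" for p by (rule fixed_eqv_const[OF x fixed below])
  show "value_le G v (of_poly p) (of_poly q) \<longleftrightarrow> value_le G0 v0 (base.eventual p) (base.eventual q)"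
    unfolding const_le[symmetric]
    using eqv_le_trans[OF eqv_sym[OF 1] le_eqv_trans[OF _ 1]]
      eqv_le_trans[OF 1 le_eqv_trans[OF _ eqv_sym[OF 1]]] by blast
qed

lemma transcendental_immediate_unique:
  assumes v0: "valuation G0 v0" and A: "transcendental_immediate G0 v0 A"
    and v: "extension G0 v0 G v" "appr v0 G v = A" and w: "extension G0 v0 H w" "appr v0 H w = A"
  shows "equivalent_ext G v H w"
proof -
  have val: "valuation G v" "valuation H w" using v w by (simp_all add: extension_def)
  have "value_le G v = value_le H w"
    by (rule value_le_eqI_poly[OF valuation_imp_preorder[OF val(1)] valuation_imp_preorder[OF val(2)]])
      (simp only: transcendental_immediate_ext(2)[OF v0 A v] transcendental_immediate_ext(2)[OF v0 A w])
  then show ?thesis by (rule value_le_eq_imp_equivalent_ext[OF val])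
qed

lemma algebraic_immediate_nonfixed:
  assumes v0: "valuation G0 v0" and A: "algebraic_immediate G0 v0 A"
  obtains f where "\<not> pseudo_limit.fixed (value_le G0 v0) id (immediate_approx.filt v0 A) f"
    "immediate_approx.below_fixed G0 v0 A f"
proof -
  have im: "immediate_type G0 v0 A" using A by (simp add: algebraic_immediate_def)
  interpret immediate_approx G0 v0 A by (rule immediate_type_imp[OF v0 im])
  obtain p where "\<not> fixes_value v0 A p" using A unfolding algebraic_immediate_def by blast
  then have "\<not> base.fixed p" by (simp only: base_fixed not_False_eq_True)
  then show ?thesis by (rule minimal_nonfixed) (rule that)
qed

lemma algebraic_immediate_exists:
  fixes v0 :: "'k::field \<Rightarrow> 'g option"
  assumes v0: "valuation G0 v0" and A: "algebraic_immediate G0 v0 A"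
  shows "\<exists>(G :: 'k canonical_value ogroup) v. extension G0 v0 G v \<and> appr v0 G v = A \<and> value_transcendental G v"
    and "supp A \<noteq> Some ` values_of v0 UNIV \<Longrightarrow>
      \<exists>(G :: 'k canonical_value ogroup) v. extension G0 v0 G v \<and> appr v0 G v = A \<and> residue_transcendental G v"
proof -
  have im: "immediate_type G0 v0 A" using A by (simp add: algebraic_immediate_def)
  interpret immediate_approx G0 v0 A by (rule immediate_type_imp[OF v0 im])
  obtain f where f: "\<not> base.fixed f" "below_fixed f" by (rule algebraic_immediate_nonfixed[OF v0 A]) (rule that)
  obtain G :: "('g \<times> int) ogroup" and v where v: "extension G0 v0 G v" "appr v0 G v = A" "adjoins_value (value_le G v)"
    using adjoins_value_extension[OF f] by blast
  show "\<exists>(G :: 'k canonical_value ogroup) v. extension G0 v0 G v \<and> appr v0 G v = A \<and> value_transcendental G v"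
    using canonical_value_transcendental[OF v0 v(1,3)] unfolding v(2) .
  assume "supp A \<noteq> Some ` values_of v0 UNIV"
  moreover have "supp A \<subseteq> Some ` values_of v0 UNIV"
    unfolding supp_eq using in_values_iff cl_nonzero by blast
  ultimately obtain \<gamma> where \<gamma>: "\<gamma> \<in> Some ` values_of v0 UNIV" "\<gamma> \<notin> supp A" by blast
  then obtain d where d: "d \<noteq> 0" "\<gamma> = v0 d" using in_values_iff by blast
  then have "cl d = {}" using \<gamma>(2) supp_iff by blast
  then obtain G :: "'g ogroup" and v where v: "extension G0 v0 G v" "appr v0 G v = A" "adjoins_residue (value_le G v)"
    using adjoins_residue_extension[OF f _ d(1)] by blast
  show "\<exists>(G :: 'k canonical_value ogroup) v. extension G0 v0 G v \<and> appr v0 G v = A \<and> residue_transcendental G v"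
    using canonical_residue_transcendental[OF v0 v(1,3)] unfolding v(2) .
qed

text \<open>
  With \<open>f\<close> non-fixed of minimal degree and all radii in the support, \<open>v f\<close> exceeds \<open>v K\<close>.  So the value of
  any polynomial is read off from its lowest nonzero digit, and the resulting comparison is the same
  for all extensions of type \<open>A\<close>.
\<close>

lemma algebraic_immediate_full:
  fixes v0 :: "'k::field \<Rightarrow> 'g option"
  assumes v0: "valuation G0 v0" and A: "algebraic_immediate G0 v0 A"
    and full: "supp A = Some ` values_of v0 UNIV"
    and ext: "extension G0 v0 G v" "appr v0 G v = A"
    and f: "\<not> pseudo_limit.fixed (value_le G0 v0) id (immediate_approx.filt v0 A) f"
      "immediate_approx.below_fixed G0 v0 A f"
  shows "value_transcendental G v"
    and "\<lbrakk>Polynomial.degree a < Polynomial.degree f; a \<noteq> 0; Polynomial.degree b < Polynomial.degree f; b \<noteq> 0\<rbrakk>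
      \<Longrightarrow> value_le G v (of_poly (f ^ i * (a + f * r))) (of_poly (f ^ j * (b + f * s))) \<longleftrightarrow>
        i < j \<or> i = j \<and> value_le G0 v0 (poly a (immediate_approx.pt G0 v0 A a)) (poly b (immediate_approx.pt G0 v0 A b))"
proof -
  have im: "immediate_type G0 v0 A" using A by (simp add: algebraic_immediate_def)
  interpret immediate_extension G0 v0 G v A by (rule immediate_extensionI[OF v0 ext(1) im])
  have deg_f: "Polynomial.degree f > 0" using f(1) base.base.fixed_const by blast
  have cl: "base.cl d \<noteq> {}" if "d \<noteq> 0" for d
  proof -
    have "v0 d \<in> supp A" unfolding full base.in_values_iff using that by blast
    then show ?thesis unfolding base.supp_iff .
  qed
  note large = nonfixed_large[OF ext(2) cl f]
  note leading = leading_value[OF ext(2) cl f]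
  have f0: "of_poly f \<noteq> 0" using deg_f by auto
  show "value_le G v (of_poly (f ^ i * (a + f * r))) (of_poly (f ^ j * (b + f * s))) \<longleftrightarrow>
      i < j \<or> i = j \<and> value_le G0 v0 (base.eventual a) (base.eventual b)"
    if a: "Polynomial.degree a < Polynomial.degree f" "a \<noteq> 0" and b: "Polynomial.degree b < Polynomial.degree f" "b \<noteq> 0"
  proof -
    note la = leading(1)[OF _ a, of i r] and lb = leading(1)[OF _ b, of j s]
    have "of_poly (f ^ i * (a + f * r)) \<preceq> of_poly (f ^ j * (b + f * s)) \<longleftrightarrow>
        const (base.eventual a) * of_poly f ^ i \<preceq> const (base.eventual b) * of_poly f ^ j"
      using eqv_le_trans[OF eqv_sym[OF la] le_eqv_trans[OF _ lb]]
        eqv_le_trans[OF la le_eqv_trans[OF _ eqv_sym[OF lb]]] by blast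
    also have "\<dots> \<longleftrightarrow> i < j \<or> i = j \<and> value_le G0 v0 (base.eventual a) (base.eventual b)"
      by (rule compare_leading[OF large f0 leading(2)[OF _ a] leading(2)[OF _ b]])
    finally show ?thesis .
  qed
  show "value_transcendental G v"
  proof (rule value_transcendentalI)
    show "adjoins_value (value_le G v)"
      unfolding adjoins_value_def
    proof (intro exI[of _ "of_poly f"] conjI allI impI)
      show "of_poly f \<noteq> 0" by (rule f0)
      show "\<not> of_poly f ^ n \<approx> const c" if n: "n > 0" for n c
      proof
        assume eq: "of_poly f ^ n \<approx> const c"
        then have c: "c \<noteq> 0" using f0 eqv_imp_zero_iff[OF eq] by auto
        have "const c * of_poly f ^ 0 \<preceq> const 1 * of_poly f ^ n" 
          using compare_leading[OF large f0 c one_neq_zero, of 0 n] n by blast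
        moreover have "\<not> const 1 * of_poly f ^ n \<preceq> const c * of_poly f ^ 0"
          using compare_leading[OF large f0 one_neq_zero c, of n 0] n by blast
        ultimately show False using eq by (simp add: eqv_def)
      qed
      fix q :: "'k poly" assume "q \<noteq> 0"
      then obtain i a r where "Polynomial.degree a < Polynomial.degree f" "a \<noteq> 0" "q = f ^ i * (a + f * r)"
        using key_decomposition[OF deg_f] by blast
      then show "\<exists>c i. of_poly q \<approx> const c * of_poly f ^ i" using leading(1) by blast
    qed
  qed
qed

lemma algebraic_immediate_unique:
  fixes v0 :: "'k::field \<Rightarrow> 'g option"
  assumes v0: "valuation G0 v0" and A: "algebraic_immediate G0 v0 A"
    and full: "supp A = Some ` values_of v0 UNIV"
    and v: "extension G0 v0 G v" "appr v0 G v = A" and w: "extension G0 v0 H w" "appr v0 H w = A"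
  shows "equivalent_ext G v H w"
proof -
  have val: "valuation G v" "valuation H w" using v w by (simp_all add: extension_def)
  note pre = valuation_imp_preorder[OF val(1)] valuation_imp_preorder[OF val(2)]
  obtain f where f: "\<not> pseudo_limit.fixed (value_le G0 v0) id (immediate_approx.filt v0 A) f"
    "immediate_approx.below_fixed G0 v0 A f"
    by (rule algebraic_immediate_nonfixed[OF v0 A]) (rule that)
  have "immediate_type G0 v0 A" using A by (simp add: algebraic_immediate_def)
  then interpret immediate_approx G0 v0 A by (rule immediate_type_imp[OF v0])
  have deg_f: "Polynomial.degree f > 0" using f(1) base.fixed_const by blast
  have "value_le G v = value_le H w"
  proof (rule value_le_eqI_poly[OF pre])
    fix p q :: "'k poly"
    show "value_le G v (of_poly p) (of_poly q) \<longleftrightarrow> value_le H w (of_poly p) (of_poly q)"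
    proof (cases "p = 0 \<or> q = 0")
      case True
      then show ?thesis
        using valuation_preorder.le_zero[OF pre(1)] valuation_preorder.le_zero[OF pre(2)]
          valuation_preorder.zero_le_iff[OF pre(1)] valuation_preorder.zero_le_iff[OF pre(2)] by auto
    next
      case False
      then obtain i a r where p: "Polynomial.degree a < Polynomial.degree f" "a \<noteq> 0" "p = f ^ i * (a + f * r)"
        using key_decomposition[OF deg_f] by blast
      obtain j b s where q: "Polynomial.degree b < Polynomial.degree f" "b \<noteq> 0" "q = f ^ j * (b + f * s)"
        using key_decomposition[OF deg_f] False by blast
      show ?thesis
        unfolding p(3) q(3)
          algebraic_immediate_full(2)[OF v0 A full v f p(1,2) q(1,2)]
          algebraic_immediate_full(2)[OF v0 A full w f p(1,2) q(1,2)] ..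
    qed
  qed
  then show ?thesis by (rule value_le_eq_imp_equivalent_ext[OF val])
qed

section \<open>Extensions realizing a value-extending type\<close>

text \<open>
  The conditions on \<open>\<alpha>\<close> in terms of the preorder, for an element \<open>y\<close> of value \<open>\<alpha>\<close>.
\<close>

lemma realizes_supp_iff:
  fixes v0 :: "'k::field \<Rightarrow> 'g option" and v :: "'k ratfun \<Rightarrow> 'h option"
  assumes v0: "valuation G0 v0" and v: "valuation G v" "\<And>c. v (const c) = map_option \<iota> (v0 c)"
    and y: "v y = Some \<alpha>"
    and emb: "group_order_embedding (value_group G0 v0) G \<iota>"
  shows "realizes_supp G0 v0 A G \<iota> \<alpha> \<longleftrightarrow>
    (\<forall>n c. n > 0 \<longrightarrow> \<not> valuation_preorder.eqv (value_le G v) (y ^ n) (const c))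
    \<and> (\<forall>d. d \<noteq> 0 \<longrightarrow> v0 d \<in> supp A \<longrightarrow> valuation_preorder.lt (value_le G v) (const d) y)
    \<and> (\<forall>d. d \<noteq> 0 \<longrightarrow> v0 d \<notin> supp A \<longrightarrow> valuation_preorder.lt (value_le G v) y (const d))"
proof -
  interpret field_valuation G v by unfold_locales (rule v(1))
  have G: "ordered_abelian_group G" by (rule valuationD(1)[OF v(1)])
  have \<alpha>: "\<alpha> \<in> carrier G" using valuationD(2)[OF v(1), of y] y by auto
  have vd: "\<exists>g. v0 d = Some g \<and> g \<in> values_of v0 UNIV" if "d \<noteq> 0" for d
    using valuationD(3)[OF v0, of d] that by (auto simp: values_of_def)
  have vg: "\<exists>d. d \<noteq> 0 \<and> v0 d = Some g" if g: "g \<in> values_of v0 UNIV" for g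
  proof -
    obtain d where d: "v0 d = Some g" using g by (auto simp: values_of_def)
    then show ?thesis using valuationD(3)[OF v0, of d] by (intro exI[of _ d]) auto
  qed
  have 1: "\<alpha> [^]\<^bsub>G\<^esub> n \<notin> \<iota> ` values_of v0 UNIV \<longleftrightarrow> (\<forall>c. \<not> y ^ n \<approx> const c)" for n :: nat
  proof -
    have "v (y ^ n) = Some (\<alpha> [^]\<^bsub>G\<^esub> n)" by (rule valuation_power[OF v(1) y])
    then have eq: "y ^ n \<approx> const c \<longleftrightarrow> map_option \<iota> (v0 c) = Some (\<alpha> [^]\<^bsub>G\<^esub> n)" for c
      using v_eq_iff[of "y ^ n" "const c"] v(2)[of c] by metis
    show ?thesis
      unfolding eq map_option_eq_Some
    proof (intro iffI allI notI)
      fix c assume "\<alpha> [^]\<^bsub>G\<^esub> n \<notin> \<iota> ` values_of v0 UNIV" "\<exists>z. v0 c = Some z \<and> \<iota> z = \<alpha> [^]\<^bsub>G\<^esub> n"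
      moreover from this(2) obtain z where z: "v0 c = Some z" "\<iota> z = \<alpha> [^]\<^bsub>G\<^esub> n" by blast
      moreover have "\<iota> z \<in> \<iota> ` values_of v0 UNIV"
        by (rule imageI) (use z(1) in \<open>auto simp: values_of_def\<close>)
      ultimately show False by metis
    next
      assume *: "\<forall>c. \<not> (\<exists>z. v0 c = Some z \<and> \<iota> z = \<alpha> [^]\<^bsub>G\<^esub> n)"
      assume "\<alpha> [^]\<^bsub>G\<^esub> n \<in> \<iota> ` values_of v0 UNIV"
      then obtain g where "\<alpha> [^]\<^bsub>G\<^esub> n = \<iota> g" "g \<in> values_of v0 UNIV" by (rule imageE)
      moreover from this(2) obtain c where "v0 c = Some g" by (auto simp: values_of_def)
      ultimately show False using * by metis
    qed
  qed
  have lower: "ord_less G (\<iota> g) \<alpha> \<longleftrightarrow> const d \<prec> y" if "v0 d = Some g" for d g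
    using vless_iff[of "const d" y] v(2)[of d] y that by (simp add: vless_def ord_less_def)
  have upper: "ord_less G \<alpha> (\<iota> g) \<longleftrightarrow> y \<prec> const d" if "v0 d = Some g" for d g
    using vless_iff[of y "const d"] v(2)[of d] y that by (simp add: vless_def ord_less_def)
  have 2: "(\<forall>\<gamma>\<in>values_of v0 UNIV. Some \<gamma> \<in> supp A \<longrightarrow> ord_less G (\<iota> \<gamma>) \<alpha>)
      \<longleftrightarrow> (\<forall>d. d \<noteq> 0 \<longrightarrow> v0 d \<in> supp A \<longrightarrow> const d \<prec> y)"
  proof (intro iffI allI impI ballI)
    fix d assume *: "\<forall>\<gamma>\<in>values_of v0 UNIV. Some \<gamma> \<in> supp A \<longrightarrow> ord_less G (\<iota> \<gamma>) \<alpha>" "d \<noteq> 0" "v0 d \<in> supp A"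
    obtain g where g: "v0 d = Some g" "g \<in> values_of v0 UNIV" using vd[OF *(2)] by blast
    then have "ord_less G (\<iota> g) \<alpha>" using * by simp
    then show "const d \<prec> y" unfolding lower[OF g(1)] .
  next
    fix g assume *: "\<forall>d. d \<noteq> 0 \<longrightarrow> v0 d \<in> supp A \<longrightarrow> const d \<prec> y" "g \<in> values_of v0 UNIV" "Some g \<in> supp A"
    obtain d where d: "d \<noteq> 0" "v0 d = Some g" using vg[OF *(2)] by blast
    then have "const d \<prec> y" using * by simp
    then show "ord_less G (\<iota> g) \<alpha>" unfolding lower[OF d(2)] .
  qed
  have 3: "(\<forall>\<gamma>\<in>values_of v0 UNIV. Some \<gamma> \<notin> supp A \<longrightarrow> ord_less G \<alpha> (\<iota> \<gamma>))
      \<longleftrightarrow> (\<forall>d. d \<noteq> 0 \<longrightarrow> v0 d \<notin> supp A \<longrightarrow> y \<prec> const d)"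
  proof (intro iffI allI impI ballI)
    fix d assume *: "\<forall>\<gamma>\<in>values_of v0 UNIV. Some \<gamma> \<notin> supp A \<longrightarrow> ord_less G \<alpha> (\<iota> \<gamma>)" "d \<noteq> 0" "v0 d \<notin> supp A"
    obtain g where g: "v0 d = Some g" "g \<in> values_of v0 UNIV" using vd[OF *(2)] by blast
    then have "ord_less G \<alpha> (\<iota> g)" using * by simp
    then show "y \<prec> const d" unfolding upper[OF g(1)] .
  next
    fix g assume *: "\<forall>d. d \<noteq> 0 \<longrightarrow> v0 d \<notin> supp A \<longrightarrow> y \<prec> const d" "g \<in> values_of v0 UNIV" "Some g \<notin> supp A"
    obtain d where d: "d \<noteq> 0" "v0 d = Some g" using vg[OF *(2)] by blast
    then have "y \<prec> const d" using * by simp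
    then show "ord_less G \<alpha> (\<iota> g)" unfolding upper[OF d(2)] .
  qed
  show ?thesis unfolding realizes_supp_def 1 2 3 using G emb \<alpha> by blast
qed

lemma value_extending_monomial:
  fixes v0 :: "'k::field \<Rightarrow> 'g option" and G :: "'h ogroup"
  assumes v0: "valuation G0 v0" and A: "value_extending G0 v0 A" and b: "b \<in> inter A"
    and r: "realizes_supp G0 v0 A G \<iota> \<alpha>"
  shows "\<exists>!v. monomial_valuation v0 G \<iota> b \<alpha> v"
    and "monomial_valuation v0 G \<iota> b \<alpha> v \<Longrightarrow>
      extension G0 v0 G v \<and> appr v0 G v = A \<and> adjoins_value (value_le G v)
      \<and> (\<forall>c. v (const c) = map_option \<iota> (v0 c)) \<and> v (ratX - const b) = Some \<alpha>"
proof -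
  have G: "ordered_abelian_group G" and emb: "group_order_embedding (value_group G0 v0) G \<iota>"
    and \<alpha>: "\<alpha> \<in> carrier G"
    using r by (simp_all add: realizes_supp_def)
  obtain w where w: "monomial_valuation v0 G \<iota> b \<alpha> w" "extension G0 v0 G w"
    "\<forall>c. w (const c) = map_option \<iota> (v0 c)"
    "key_extension G0 v0 G w (\<lambda>a. map_option \<iota> (v0 (Polynomial.coeff a 0))) [:- b, 1:] \<alpha>"
    using monomial_valuation_exists[OF v0 emb G \<alpha>, of b] by blast
  have unique: "v = w" if "monomial_valuation v0 G \<iota> b \<alpha> v" for v
    by (rule monomial_valuation_unique[OF v0 emb \<alpha> that w(1)])
  then show "\<exists>!v. monomial_valuation v0 G \<iota> b \<alpha> v" using w(1) by blast
  interpret E: linear_key_extension G0 v0 G w \<iota> b \<alpha>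
    by (rule linear_key_extension.intro[OF w(4)])
  interpret A: approx_type G0 v0 A
    by (rule approx_typeI[OF v0]) (use A in \<open>simp add: value_extending_def\<close>)
  have y: "w (ratX - const b) = Some \<alpha>" using E.v_f unfolding of_poly_linear .
  have cut: "\<And>n c. n > 0 \<Longrightarrow> \<not> E.eqv ((ratX - const b) ^ n) (const c)"
    "\<And>d. d \<noteq> 0 \<Longrightarrow> v0 d \<in> supp A \<Longrightarrow> E.lt (const d) (ratX - const b)"
    "\<And>d. d \<noteq> 0 \<Longrightarrow> v0 d \<notin> supp A \<Longrightarrow> E.lt (ratX - const b) (const d)"
    using r unfolding realizes_supp_iff[OF v0 E.valuation w(3)[rule_format] y emb] by blast+
  have "appr v0 G w = A"
  proof (rule E.appr_value_extending[OF A.approx_type_axioms b])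
    show "A.op d \<noteq> {}" if "A.cl d \<noteq> {}" for d
      using A that unfolding value_extending_def A.supp_iff[symmetric] A.op_def by blast
    show "E.lt (const d) (ratX - const b)" if "A.cl d \<noteq> {}" for d
      using cut(2)[of d] that A.cl_nonzero A.supp_iff by blast
    show "E.lt (ratX - const b) (const d)" if "d \<noteq> 0" "A.cl d = {}" for d
      using cut(3)[OF that(1)] that(2) A.supp_iff by blast
  qed
  moreover have "adjoins_value (value_le G w)"
  proof (rule E.adjoins_value)
    show "\<exists>c. E.eqv (of_poly a) (const c)" if "E.key.small a" for a
      using E.small_imp_const[OF that] E.eqv_refl by metis
    show "\<not> E.eqv (of_poly [:- b, 1:] ^ n) (const c)" if "n > 0" for n c
      unfolding of_poly_linear by (rule cut(1)[OF that])
  qed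
  ultimately show "monomial_valuation v0 G \<iota> b \<alpha> v \<Longrightarrow>
      extension G0 v0 G v \<and> appr v0 G v = A \<and> adjoins_value (value_le G v)
      \<and> (\<forall>c. v (const c) = map_option \<iota> (v0 c)) \<and> v (ratX - const b) = Some \<alpha>"
    using unique w y by blast
qed

text \<open>
  The cut is defined by the support, which is an initial segment of the value group.
\<close>

lemma realizes_supp_exists:
  fixes v0 :: "'k::field \<Rightarrow> 'g option"
  assumes v0: "valuation G0 v0" and A: "A \<in> nontrivial_types G0 v0"
  shows "\<exists>(G :: ('g \<times> int) ogroup) \<iota> \<alpha>. realizes_supp G0 v0 A G \<iota> \<alpha>"
proof -
  interpret A: approx_type G0 v0 A by (rule approx_typeI[OF v0 A])
  define V where "V = value_group G0 v0"
  interpret V: ordered_abelian_group V unfolding V_def by (rule value_group_ordered[OF v0])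
  have V: "carrier V = values_of v0 UNIV" "ord_le V = ord_le G0" by (simp_all add: V_def value_group_def)
  define D where "D = {g \<in> carrier V. Some g \<in> supp A}"
  have D: "D \<subseteq> carrier V" by (auto simp: D_def)
  let ?G = "adjoin_cut V D" and ?\<alpha> = "(\<one>\<^bsub>V\<^esub>, 1 :: int)"
  have "realizes_supp G0 v0 A ?G (\<lambda>g. (g, 0)) ?\<alpha>"
    unfolding realizes_supp_def
  proof (intro conjI allI ballI impI)
    show "ordered_abelian_group ?G" by (rule V.adjoin_cut_ordered[OF D])
    show "group_order_embedding (value_group G0 v0) ?G (\<lambda>g. (g, 0))"
      using V.adjoin_cut_embedding[OF D] unfolding V_def .
    show "?\<alpha> \<in> carrier ?G" by (simp add: V.adjoin_cut_simps[OF D])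
    show "?\<alpha> [^]\<^bsub>?G\<^esub> n \<notin> (\<lambda>g. (g, 0)) ` values_of v0 UNIV" if "n > 0" for n :: nat
      using that by (auto simp: V.adjoin_cut_pow[OF D])
    fix g assume g: "g \<in> values_of v0 UNIV"
    show "ord_less ?G (g, 0) ?\<alpha>" if "Some g \<in> supp A"
      using that g by (intro V.adjoin_cut_lower[OF D]) (simp add: D_def V(1))
    show "ord_less ?G ?\<alpha> (g, 0)" if ng: "Some g \<notin> supp A"
    proof (rule V.adjoin_cut_upper[OF D])
      show "g \<in> carrier V" using g V by simp
      fix d assume "d \<in> D"
      then have d: "d \<in> values_of v0 UNIV" "Some d \<in> supp A" using V by (simp_all add: D_def)
      obtain a where a: "v0 a = Some g" using g by (auto simp: values_of_def)
      obtain e where e: "v0 e = Some d" using d(1) by (auto simp: values_of_def)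
      show "\<not> ord_le V g d"
      proof
        assume "ord_le V g d"
        then have "value_le G0 v0 a e" using a e V(2) by (simp add: value_le_def)
        moreover have "A.cl e \<noteq> {}" using d(2) A.supp_iff[of e] e by simp
        ultimately have "A.cl a \<noteq> {}" using A.cl_mono by blast
        then show False using ng A.supp_iff[of a] a by simp
      qed
    qed
  qed
  then show ?thesis by blast
qed

text \<open>
  The monomial valuation with values in \<open>v0 K \<oplus> \<int>\<alpha>\<close> is replaced by an equivalent one with canonical value
  group.  All its properties are expressed by the preorder, so they survive.
\<close>

lemma value_extending_canonical:
  fixes v0 :: "'k::field \<Rightarrow> 'g option"
  assumes v0: "valuation G0 v0" and A: "value_extending G0 v0 A" and b: "b \<in> inter A"
  shows "\<exists>(G :: 'k canonical_value ogroup) \<iota> \<alpha> v. realizes_supp G0 v0 A G \<iota> \<alpha>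
    \<and> monomial_valuation v0 G \<iota> b \<alpha> v \<and> extension G0 v0 G v \<and> appr v0 G v = A"
proof -
  have nt: "A \<in> nontrivial_types G0 v0" using A by (simp add: value_extending_def)
  obtain G :: "('g \<times> int) ogroup" and \<iota> \<alpha> where r: "realizes_supp G0 v0 A G \<iota> \<alpha>"
    using realizes_supp_exists[OF v0 nt] by blast
  obtain v where mono: "monomial_valuation v0 G \<iota> b \<alpha> v"
    using value_extending_monomial(1)[OF v0 A b r] by blast
  then have v: "extension G0 v0 G v" "appr v0 G v = A" "\<And>c. v (const c) = map_option \<iota> (v0 c)"
    "v (ratX - const b) = Some \<alpha>"
    using value_extending_monomial(2)[OF v0 A b r] by blast+
  have emb: "group_order_embedding (value_group G0 v0) G \<iota>" using r by (simp add: realizes_supp_def)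
  have val: "valuation G v" using v(1) by (simp add: extension_def)
  obtain H :: "'k canonical_value ogroup" and w where w: "extension G0 v0 H w"
    "value_le H w = value_le G v" "appr v0 H w = appr v0 G v"
    using canonical_extension[OF v0 v(1)] by blast
  have valw: "valuation H w" using w(1) by (simp add: extension_def)
  obtain \<kappa> where \<kappa>: "group_order_embedding (value_group G0 v0) H \<kappa>" "\<And>c. w (const c) = map_option \<kappa> (v0 c)"
    using w(1) unfolding extension_def by blast
  have "ratX - const b \<noteq> 0" using v(4) valuationD(3)[OF val, of "ratX - const b"] by auto
  then obtain \<alpha>' where \<alpha>': "w (ratX - const b) = Some \<alpha>'"
    using valuationD(3)[OF valw, of "ratX - const b"] by auto
  have "realizes_supp G0 v0 A H \<kappa> \<alpha>'"
    using r unfolding realizes_supp_iff[OF v0 val v(3,4) emb] realizes_supp_iff[OF v0 valw \<kappa>(2) \<alpha>' \<kappa>(1)] w(2) .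
  moreover have "monomial_valuation v0 H \<kappa> b \<alpha>' w"
    using mono unfolding monomial_valuation_iff[OF val v(3,4)] monomial_valuation_iff[OF valw \<kappa>(2) \<alpha>'] w(2) .
  ultimately show ?thesis using w v(2) by metis
qed

section \<open>Extensions realizing a residue-extending type\<close>

text \<open>
  A point of the intersection lies in some closed ball but not in the open ball of the same radius;
  the latter must be missing from the type, so no larger radius occurs.
\<close>

lemma residue_extending_max:
  fixes v0 :: "'k::field \<Rightarrow> 'g option"
  assumes v0: "valuation G0 v0" and A: "residue_extending G0 v0 A"
  obtains d where "d \<noteq> 0" "approx_type.cl v0 A d \<noteq> {}" "approx_type.op v0 A d = {}"
    "\<forall>e. approx_type.cl v0 A e \<noteq> {} \<longrightarrow> value_le G0 v0 e d" "inter A = approx_type.cl v0 A d"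
proof -
  interpret A: approx_type G0 v0 A
    by (rule approx_typeI[OF v0]) (use A in \<open>simp add: residue_extending_def\<close>)
  obtain b where b: "b \<in> inter A" using A unfolding residue_extending_def by blast
  then obtain \<gamma> where \<gamma>: "\<gamma> \<in> supp A" "b \<in> closed_at A \<gamma> - open_at A \<gamma>"
    using A unfolding residue_extending_def by blast
  then obtain d where d: "\<gamma> = v0 d" unfolding A.supp_eq by blast
  have bd: "b \<in> A.cl d" "b \<notin> A.op d" using \<gamma>(2) d by (simp_all add: A.cl_def A.op_def)
  have op: "A.op d = {}" using b bd(2) unfolding A.inter_iff by blast
  have max: "value_le G0 v0 e d" if e: "A.cl e \<noteq> {}" for e
  proof (rule ccontr)
    assume "\<not> value_le G0 v0 e d"
    then have "A.lt d e" by (simp add: A.lt_def)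
    then have "A.op d \<noteq> {}" using A.cl_down e by blast
    then show False using op by simp
  qed
  have "A.cl d \<subseteq> inter A"
  proof
    fix c assume c: "c \<in> A.cl d"
    have "c \<in> A.cl e" if "A.cl e \<noteq> {}" for e using A.cl_mono[OF c max[OF that]] .
    moreover have "c \<in> A.op e" if e: "A.op e \<noteq> {}" for e
    proof -
      have "value_le G0 v0 e d" using max[of e] e A.op_cl by blast
      moreover have "\<not> A.eqv e d" using A.op_cong[of e d] op e by blast
      ultimately have "A.lt e d" using A.le_cases by blast
      then show ?thesis by (rule A.cl_down[OF c])
    qed
    ultimately show "c \<in> inter A" unfolding A.inter_iff by blast
  qed
  moreover have "inter A \<subseteq> A.cl d" using bd(1) unfolding subset_iff A.inter_iff by blast
  ultimately have "inter A = A.cl d" by blast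
  moreover have "A.cl d \<noteq> {}" using bd(1) by blast
  ultimately show ?thesis using that[OF A.cl_nonzero[OF bd(1)] _ op] max by blast
qed

lemma residue_extending_monomial:
  fixes v0 :: "'k::field \<Rightarrow> 'g option" and G :: "'h ogroup"
  assumes v0: "valuation G0 v0" and A: "A \<in> nontrivial_types G0 v0"
    and d: "v0 d = Some \<delta>" "approx_type.op v0 A d = {}"
      "\<forall>e. approx_type.cl v0 A e \<noteq> {} \<longrightarrow> value_le G0 v0 e d"
    and b: "b \<in> approx_type.cl v0 A d"
    and G: "ordered_abelian_group G" and emb: "group_order_embedding (value_group G0 v0) G \<iota>"
  shows "\<exists>!v. monomial_valuation v0 G \<iota> b (\<iota> \<delta>) v"
    and "monomial_valuation v0 G \<iota> b (\<iota> \<delta>) v \<Longrightarrow>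
      extension G0 v0 G v \<and> appr v0 G v = A \<and> residue_transcendental G v"
proof -
  have \<alpha>: "\<iota> \<delta> \<in> carrier G" using embedding_value(1)[OF v0 emb, of d] d(1) by auto
  obtain w where w: "monomial_valuation v0 G \<iota> b (\<iota> \<delta>) w" "extension G0 v0 G w"
    "\<forall>c. w (const c) = map_option \<iota> (v0 c)"
    "key_extension G0 v0 G w (\<lambda>a. map_option \<iota> (v0 (Polynomial.coeff a 0))) [:- b, 1:] (\<iota> \<delta>)"
    using monomial_valuation_exists[OF v0 emb G \<alpha>, of b] by blast
  have unique: "v = w" if "monomial_valuation v0 G \<iota> b (\<iota> \<delta>) v" for v
    by (rule monomial_valuation_unique[OF v0 emb \<alpha> that w(1)])
  then show "\<exists>!v. monomial_valuation v0 G \<iota> b (\<iota> \<delta>) v" using w(1) by blast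
  interpret E: linear_key_extension G0 v0 G w \<iota> b "\<iota> \<delta>"
    by (rule linear_key_extension.intro[OF w(4)])
  interpret A: approx_type G0 v0 A by (rule approx_typeI[OF v0 A])
  have wd: "w (const d) = Some (\<iota> \<delta>)" using w(3) d(1) by simp
  have "w (ratX - const b) = Some (\<iota> \<delta>)" using E.v_f unfolding of_poly_linear .
  then have "E.eqv (ratX - const b) (const d)" using wd E.v_eq_iff by metis
  then have "appr v0 G w = A"
    by (intro E.appr_residue_extending[OF A.approx_type_axioms b d(2)] d(3)[rule_format])
  moreover have "residue_transcendental G w"
  proof (rule E.residue_transcendentalI, rule E.adjoins_residue[OF wd])
    fix a :: "'k poly" assume a: "E.key.small a" "a \<noteq> 0"
    obtain c where c: "of_poly a = const c" using E.small_imp_const[OF a(1)] by blast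
    show "\<exists>c. E.lt (of_poly a) (of_poly a - const c)"
      by (intro exI[of _ c]) (use a(2) in \<open>simp add: c[symmetric]\<close>)
  qed
  ultimately show "monomial_valuation v0 G \<iota> b (\<iota> \<delta>) v \<Longrightarrow>
      extension G0 v0 G v \<and> appr v0 G v = A \<and> residue_transcendental G v"
    using unique w by blast
qed

section \<open>Every non-trivial type is realized\<close>

text \<open>
  Suppose the intersection contains \<open>b\<close> and some radius \<open>v d\<close> of the support has no open ball.  Then a
  point \<open>c\<close> outside the closed ball of radius \<open>v d\<close> separates at the radius \<open>v (c - b)\<close>.
\<close>

lemma nontrivial_cases:
  fixes v0 :: "'k::field \<Rightarrow> 'g option"
  assumes v0: "valuation G0 v0" and A: "A \<in> nontrivial_types G0 v0"
  shows "immediate_type G0 v0 A \<or> value_extending G0 v0 A \<or> residue_extending G0 v0 A"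
proof -
  interpret A: approx_type G0 v0 A by (rule approx_typeI[OF v0 A])
  show ?thesis
  proof (cases "inter A = {}")
    case True
    then have "A \<noteq> {}" by (auto simp: inter_def)
    then show ?thesis using True A by (simp add: immediate_type_def)
  next
    case False
    then obtain b where b: "b \<in> inter A" by blast
    show ?thesis
    proof (cases "\<forall>\<gamma>\<in>supp A. open_at A \<gamma> \<noteq> {}")
      case True
      then show ?thesis using False A by (simp add: value_extending_def)
    next
      case not_open: False
      then obtain \<gamma> where \<gamma>: "\<gamma> \<in> supp A" "open_at A \<gamma> = {}" by blast
      then obtain d where d: "\<gamma> = v0 d" unfolding A.supp_eq by blast
      have cl: "A.cl d \<noteq> {}" and op: "A.op d = {}" using \<gamma> d A.supp_iff A.op_def by auto
      have bd: "b \<in> A.cl d" using b cl unfolding A.inter_iff by blast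
      have "\<exists>\<gamma>\<in>supp A. c \<in> closed_at A \<gamma> - open_at A \<gamma>" for c
      proof (cases "c \<in> A.cl d")
        case True
        then show ?thesis using \<gamma> op by (intro bexI[of _ \<gamma>]) (simp_all add: d A.cl_def A.op_def)
      next
        case False
        define e where "e = c - b"
        have "A.lt e d" using False A.cl_ball[OF bd, of c] by (simp add: e_def A.lt_def)
        then have be: "b \<in> A.op e" by (rule A.cl_down[OF bd])
        have "c \<in> A.cl e" using A.cl_ball[OF A.op_cl[OF be], of c] by (simp add: e_def)
        moreover have "c \<notin> A.op e" using A.op_ball[OF be, of c] by (simp add: e_def)
        moreover have "v0 e \<in> supp A" using A.op_cl[OF be] A.supp_iff by blast
        ultimately show ?thesis by (intro bexI[of _ "v0 e"]) (simp_all add: A.cl_def A.op_def)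
      qed
      then show ?thesis using False A by (simp add: residue_extending_def)
    qed
  qed
qed

lemma every_type_realized:
  fixes v0 :: "'k::field \<Rightarrow> 'g option"
  assumes v0: "valuation G0 v0" and A: "A \<in> nontrivial_types G0 v0"
  shows "\<exists>(G :: 'k canonical_value ogroup) v. extension G0 v0 G v \<and> appr v0 G v = A"
proof -
  consider "transcendental_immediate G0 v0 A" | "algebraic_immediate G0 v0 A"
    | "value_extending G0 v0 A" | "residue_extending G0 v0 A"
    using nontrivial_cases[OF assms] unfolding transcendental_immediate_def algebraic_immediate_def by blast
  then show ?thesis
  proof cases
    case 1
    then have im: "immediate_type G0 v0 A" by (simp add: transcendental_immediate_def)
    interpret immediate_approx G0 v0 A by (rule immediate_type_imp[OF v0 im])
    have "base.fixed p" for p using 1 base_fixed unfolding transcendental_immediate_def by blast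
    then obtain v where v: "extension G0 v0 G0 v" "appr v0 G0 v = A"
      using transcendental_extension by blast
    then show ?thesis using canonical_extension[OF v0 v(1)] by metis
  next
    case 2
    then show ?thesis using algebraic_immediate_exists(1)[OF v0 2] by blast
  next
    case 3
    then obtain b where "b \<in> inter A" unfolding value_extending_def by blast
    then show ?thesis using value_extending_canonical[OF v0 3] by blast
  next
    case 4
    obtain d where d: "d \<noteq> 0" "approx_type.cl v0 A d \<noteq> {}" "approx_type.op v0 A d = {}"
      "\<forall>e. approx_type.cl v0 A e \<noteq> {} \<longrightarrow> value_le G0 v0 e d" "inter A = approx_type.cl v0 A d"
      by (rule residue_extending_max[OF v0 4]) (rule that; assumption)
    obtain \<delta> where \<delta>: "v0 d = Some \<delta>" using valuationD(3)[OF v0, of d] d(1) by auto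
    obtain b where b: "b \<in> approx_type.cl v0 A d" using d(2) by blast
    note mono = residue_extending_monomial[OF v0 A \<delta> d(3,4) b valuationD(1)[OF v0] id_embedding[OF v0]]
    obtain v where "monomial_valuation v0 G0 id b (id \<delta>) v" using mono(1) by blast
    then have v: "extension G0 v0 G0 v" "appr v0 G0 v = A" using mono(2) by blast+
    then show ?thesis using canonical_extension[OF v0 v(1)] by metis
  qed
qed

theorem theorem4p1:
  fixes G0 :: "'g ogroup" and v0 :: "'k::field \<Rightarrow> 'g option"
  assumes v0: "valuation G0 v0"
  shows
    \<comment> \<open>\<open>v \<mapsto> appr v\<close> is a well-defined function on the set of extensions up to equivalence ...\<close>
    "(\<forall>(G :: 'h ogroup) v. extension G0 v0 G v \<longrightarrow> appr v0 G v \<in> nontrivial_types G0 v0)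
   \<and> (\<forall>(G :: 'h ogroup) v (H :: 'i ogroup) w.
        extension G0 v0 G v \<and> extension G0 v0 H w \<and> equivalent_ext G v H w
          \<longrightarrow> appr v0 G v = appr v0 H w)

     \<comment> \<open>... and onto the non-trivial approximation types\<close>
   \<and> (\<forall>A\<in>nontrivial_types G0 v0.
        \<exists>(G :: 'k canonical_value ogroup) v. extension G0 v0 G v \<and> appr v0 G v = A)

     \<comment> \<open>1)\<close>
   \<and> (\<forall>A. transcendental_immediate G0 v0 A \<longrightarrow>
        (\<forall>(G :: 'h ogroup) v. extension G0 v0 G v \<and> appr v0 G v = A \<longrightarrow>
           immediate_ext G v
           \<and> (\<forall>(H :: 'i ogroup) w. extension G0 v0 H w \<and> appr v0 H w = A
                \<longrightarrow> equivalent_ext G v H w)))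

     \<comment> \<open>2)\<close>
   \<and> (\<forall>A. algebraic_immediate G0 v0 A \<and> supp A \<noteq> Some ` values_of v0 UNIV \<longrightarrow>
        (\<exists>(G :: 'k canonical_value ogroup) v.
           extension G0 v0 G v \<and> appr v0 G v = A \<and> value_transcendental G v)
        \<and> (\<exists>(G :: 'k canonical_value ogroup) v.
             extension G0 v0 G v \<and> appr v0 G v = A \<and> residue_transcendental G v))
   \<and> (\<forall>A. algebraic_immediate G0 v0 A \<and> supp A = Some ` values_of v0 UNIV \<longrightarrow>
        (\<forall>(G :: 'h ogroup) v. extension G0 v0 G v \<and> appr v0 G v = A \<longrightarrow>
           value_transcendental G v
           \<and> (\<forall>(H :: 'i ogroup) w. extension G0 v0 H w \<and> appr v0 H w = A
                \<longrightarrow> equivalent_ext G v H w)))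

     \<comment> \<open>3)\<close>
   \<and> (\<forall>A. value_extending G0 v0 A \<longrightarrow>
        (\<forall>b\<in>inter A. \<exists>(G :: 'k canonical_value ogroup) \<iota> \<alpha> v.
           realizes_supp G0 v0 A G \<iota> \<alpha> \<and> monomial_valuation v0 G \<iota> b \<alpha> v
           \<and> extension G0 v0 G v \<and> appr v0 G v = A)
        \<and> (\<forall>b\<in>inter A. \<forall>(G :: 'h ogroup) \<iota> \<alpha>. realizes_supp G0 v0 A G \<iota> \<alpha> \<longrightarrow>
             (\<exists>!v. monomial_valuation v0 G \<iota> b \<alpha> v)
             \<and> (\<forall>v. monomial_valuation v0 G \<iota> b \<alpha> v \<longrightarrow>
                  extension G0 v0 G v \<and> appr v0 G v = A \<and> value_transcendental G v)))

     \<comment> \<open>4)\<close>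
   \<and> (\<forall>A. residue_extending G0 v0 A \<longrightarrow>
        (\<exists>\<delta>\<in>values_of v0 UNIV.
           Some \<delta> \<in> supp A \<and> (\<forall>\<gamma>\<in>supp A. vle G0 \<gamma> (Some \<delta>))
           \<and> inter A = closed_at A (Some \<delta>)
           \<and> (\<forall>b\<in>inter A. \<exists>v. monomial_valuation v0 G0 id b \<delta> v
                \<and> extension G0 v0 G0 v \<and> appr v0 G0 v = A)
           \<and> (\<forall>b\<in>inter A. \<forall>(G :: 'h ogroup) \<iota>.
                ordered_abelian_group G \<and> group_order_embedding (value_group G0 v0) G \<iota> \<longrightarrow>
                  (\<exists>!v. monomial_valuation v0 G \<iota> b (\<iota> \<delta>) v)
                  \<and> (\<forall>v. monomial_valuation v0 G \<iota> b (\<iota> \<delta>) v \<longrightarrow>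
                       extension G0 v0 G v \<and> appr v0 G v = A \<and> residue_transcendental G v))))"
proof (intro conjI)
  have preorder_cong: "appr v0 G v = appr v0 H w"
    if "extension G0 v0 G v" "extension G0 v0 H w" "equivalent_ext G v H w"
    for G :: "'h ogroup" and v and H :: "'i ogroup" and w
    using appr_cong[OF extension_imp_extension_of[OF v0 that(1)] extension_imp_extension_of[OF v0 that(2)]
        equivalent_ext_imp_value_le_eq[OF that(3)]] .
  show "\<forall>(G :: 'h ogroup) v. extension G0 v0 G v \<longrightarrow> appr v0 G v \<in> nontrivial_types G0 v0"
    using extension_of.nontrivial_appr[OF extension_imp_extension_of[OF v0]] by blast
  show "\<forall>(G :: 'h ogroup) v (H :: 'i ogroup) w.
      extension G0 v0 G v \<and> extension G0 v0 H w \<and> equivalent_ext G v H w \<longrightarrow> appr v0 G v = appr v0 H w"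
    using preorder_cong by blast
  show "\<forall>A\<in>nontrivial_types G0 v0.
      \<exists>(G :: 'k canonical_value ogroup) v. extension G0 v0 G v \<and> appr v0 G v = A"
    using every_type_realized[OF v0] by blast
  show "\<forall>A. transcendental_immediate G0 v0 A \<longrightarrow>
        (\<forall>(G :: 'h ogroup) v. extension G0 v0 G v \<and> appr v0 G v = A \<longrightarrow>
           immediate_ext G v
           \<and> (\<forall>(H :: 'i ogroup) w. extension G0 v0 H w \<and> appr v0 H w = A
                \<longrightarrow> equivalent_ext G v H w))"
    using transcendental_immediate_ext(1)[OF v0] transcendental_immediate_unique[OF v0] by blast
  show "\<forall>A. algebraic_immediate G0 v0 A \<and> supp A \<noteq> Some ` values_of v0 UNIV \<longrightarrow>
        (\<exists>(G :: 'k canonical_value ogroup) v.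
           extension G0 v0 G v \<and> appr v0 G v = A \<and> value_transcendental G v)
        \<and> (\<exists>(G :: 'k canonical_value ogroup) v.
             extension G0 v0 G v \<and> appr v0 G v = A \<and> residue_transcendental G v)"
    using algebraic_immediate_exists[OF v0] by blast
  show "\<forall>A. algebraic_immediate G0 v0 A \<and> supp A = Some ` values_of v0 UNIV \<longrightarrow>
        (\<forall>(G :: 'h ogroup) v. extension G0 v0 G v \<and> appr v0 G v = A \<longrightarrow>
           value_transcendental G v
           \<and> (\<forall>(H :: 'i ogroup) w. extension G0 v0 H w \<and> appr v0 H w = A
                \<longrightarrow> equivalent_ext G v H w))"
  proof (intro allI impI conjI; elim conjE)
    fix A and G :: "'h ogroup" and v
    assume A: "algebraic_immediate G0 v0 A" "supp A = Some ` values_of v0 UNIV"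
      and v: "extension G0 v0 G v" "appr v0 G v = A"
    obtain f where f: "\<not> pseudo_limit.fixed (value_le G0 v0) id (immediate_approx.filt v0 A) f"
      "immediate_approx.below_fixed G0 v0 A f"
      by (rule algebraic_immediate_nonfixed[OF v0 A(1)]) (rule that)
    show "value_transcendental G v" by (rule algebraic_immediate_full(1)[OF v0 A v f])
    show "equivalent_ext G v H w" if "extension G0 v0 H w" "appr v0 H w = A" for H :: "'i ogroup" and w
      by (rule algebraic_immediate_unique[OF v0 A v that])
  qed
  show "\<forall>A. value_extending G0 v0 A \<longrightarrow>
        (\<forall>b\<in>inter A. \<exists>(G :: 'k canonical_value ogroup) \<iota> \<alpha> v.
           realizes_supp G0 v0 A G \<iota> \<alpha> \<and> monomial_valuation v0 G \<iota> b \<alpha> v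
           \<and> extension G0 v0 G v \<and> appr v0 G v = A)
        \<and> (\<forall>b\<in>inter A. \<forall>(G :: 'h ogroup) \<iota> \<alpha>. realizes_supp G0 v0 A G \<iota> \<alpha> \<longrightarrow>
             (\<exists>!v. monomial_valuation v0 G \<iota> b \<alpha> v)
             \<and> (\<forall>v. monomial_valuation v0 G \<iota> b \<alpha> v \<longrightarrow>
                  extension G0 v0 G v \<and> appr v0 G v = A \<and> value_transcendental G v))"
  proof (intro allI impI conjI ballI)
    fix A b assume A: "value_extending G0 v0 A" "b \<in> inter A"
    show "\<exists>(G :: 'k canonical_value ogroup) \<iota> \<alpha> v.
           realizes_supp G0 v0 A G \<iota> \<alpha> \<and> monomial_valuation v0 G \<iota> b \<alpha> v
           \<and> extension G0 v0 G v \<and> appr v0 G v = A"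
      by (rule value_extending_canonical[OF v0 A])
    fix G :: "'h ogroup" and \<iota> \<alpha> assume r: "realizes_supp G0 v0 A G \<iota> \<alpha>"
    show "\<exists>!v. monomial_valuation v0 G \<iota> b \<alpha> v" by (rule value_extending_monomial(1)[OF v0 A r])
    fix v assume "monomial_valuation v0 G \<iota> b \<alpha> v"
    then have v: "extension G0 v0 G v" "appr v0 G v = A" "adjoins_value (value_le G v)"
      using value_extending_monomial(2)[OF v0 A r] by blast+
    show "extension G0 v0 G v" "appr v0 G v = A" by (rule v)+
    interpret extension_of G0 v0 G v by (rule extension_imp_extension_of[OF v0 v(1)])
    show "value_transcendental G v" by (rule value_transcendentalI[OF v(3)])
  qed
  show "\<forall>A. residue_extending G0 v0 A \<longrightarrow>
        (\<exists>\<delta>\<in>values_of v0 UNIV.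
           Some \<delta> \<in> supp A \<and> (\<forall>\<gamma>\<in>supp A. vle G0 \<gamma> (Some \<delta>))
           \<and> inter A = closed_at A (Some \<delta>)
           \<and> (\<forall>b\<in>inter A. \<exists>v. monomial_valuation v0 G0 id b \<delta> v
                \<and> extension G0 v0 G0 v \<and> appr v0 G0 v = A)
           \<and> (\<forall>b\<in>inter A. \<forall>(G :: 'h ogroup) \<iota>.
                ordered_abelian_group G \<and> group_order_embedding (value_group G0 v0) G \<iota> \<longrightarrow>
                  (\<exists>!v. monomial_valuation v0 G \<iota> b (\<iota> \<delta>) v)
                  \<and> (\<forall>v. monomial_valuation v0 G \<iota> b (\<iota> \<delta>) v \<longrightarrow>
                       extension G0 v0 G v \<and> appr v0 G v = A \<and> residue_transcendental G v)))"
  proof (intro allI impI)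
    fix A assume A: "residue_extending G0 v0 A"
    then have nt: "A \<in> nontrivial_types G0 v0" by (simp add: residue_extending_def)
    interpret A: approx_type G0 v0 A by (rule approx_typeI[OF v0 nt])
    obtain d where d: "d \<noteq> 0" "A.cl d \<noteq> {}" "A.op d = {}"
      "\<forall>e. A.cl e \<noteq> {} \<longrightarrow> value_le G0 v0 e d" "inter A = A.cl d"
      by (rule residue_extending_max[OF v0 A]) (rule that; assumption)
    obtain \<delta> where \<delta>: "v0 d = Some \<delta>" using valuationD(3)[OF v0, of d] d(1) by auto
    note mono = residue_extending_monomial[OF v0 nt \<delta> d(3,4)]
    show "\<exists>\<delta>\<in>values_of v0 UNIV.
           Some \<delta> \<in> supp A \<and> (\<forall>\<gamma>\<in>supp A. vle G0 \<gamma> (Some \<delta>))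
           \<and> inter A = closed_at A (Some \<delta>)
           \<and> (\<forall>b\<in>inter A. \<exists>v. monomial_valuation v0 G0 id b \<delta> v
                \<and> extension G0 v0 G0 v \<and> appr v0 G0 v = A)
           \<and> (\<forall>b\<in>inter A. \<forall>(G :: 'h ogroup) \<iota>.
                ordered_abelian_group G \<and> group_order_embedding (value_group G0 v0) G \<iota> \<longrightarrow>
                  (\<exists>!v. monomial_valuation v0 G \<iota> b (\<iota> \<delta>) v)
                  \<and> (\<forall>v. monomial_valuation v0 G \<iota> b (\<iota> \<delta>) v \<longrightarrow>
                       extension G0 v0 G v \<and> appr v0 G v = A \<and> residue_transcendental G v))"
    proof (intro bexI[of _ \<delta>] conjI ballI allI impI)
      show "\<delta> \<in> values_of v0 UNIV" using \<delta> by (auto simp: values_of_def)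
      show "Some \<delta> \<in> supp A" using d(2) A.supp_iff[of d] \<delta> by simp
      show "vle G0 \<gamma> (Some \<delta>)" if "\<gamma> \<in> supp A" for \<gamma>
        using that d(4) \<delta> unfolding A.supp_eq value_le_def by auto
      show "inter A = closed_at A (Some \<delta>)" unfolding d(5) A.cl_def \<delta> ..
      fix b assume "b \<in> inter A"
      then have b: "b \<in> A.cl d" unfolding d(5) .
      note mono' = mono[OF b valuationD(1)[OF v0] id_embedding[OF v0]]
      obtain v where v: "monomial_valuation v0 G0 id b (id \<delta>) v" using mono'(1) by blast
      have "monomial_valuation v0 G0 id b \<delta> v" using v by simp
      then show "\<exists>v. monomial_valuation v0 G0 id b \<delta> v \<and> extension G0 v0 G0 v \<and> appr v0 G0 v = A"
        using mono'(2)[OF v] by blast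
    next
      fix b assume "b \<in> inter A"
      then have b: "b \<in> A.cl d" unfolding d(5) .
      fix G :: "'h ogroup" and \<iota>
      assume "ordered_abelian_group G \<and> group_order_embedding (value_group G0 v0) G \<iota>"
      then have G: "ordered_abelian_group G" "group_order_embedding (value_group G0 v0) G \<iota>" by blast+
      show "\<exists>!v. monomial_valuation v0 G \<iota> b (\<iota> \<delta>) v" by (rule mono(1)[OF b G])
      fix v assume v: "monomial_valuation v0 G \<iota> b (\<iota> \<delta>) v"
      show "extension G0 v0 G v" "appr v0 G v = A" "residue_transcendental G v"
        using mono(2)[OF b G v] by blast+
    qed
  qed
qed

end
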